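(* Let $H$ be an affine algebraic group acting regularly on an irreducible affine variety $X$ over an algebraically closed field $\Bbbk$. The action of $H$ on $X$ is observable if and only if both of the following hold: (a) $[{}^H\Bbbk[X]]={}^H[\Bbbk[X]]$, i.e. every $H$--invariant rational function on $X$ is a quotient of two $H$--invariant regular functions; (b) the set $\Omega(X)$ has nonempty interior in $X$.
   Context: For a domain $A$, $[A]$ denotes its field of fractions; $H$ acts on $\Bbbk[X]$ and $\Bbbk(X)=[\Bbbk[X]]$ via its action on $X$; ${}^H(\cdot)$ denotes invariants. $\Omega(X)=\{p\in X: \text{the orbit } H\cdot p \text{ is closed in } X \text{ and of maximal dimension among all } H\text{--orbits in } X\}$. The action of $H$ on $X$ is observable if for every $H$--stable closed subset $Y\subsetneq X$ there exists a nonzero $f\in{}^H\Bbbk[X]$ vanishing on $Y$. *)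

theory Defs
  imports "HOL-Computational_Algebra.Polynomial" "HOL-Algebra.Group" "HOL-Library.Extended_Nat"
begin

text \<open>Points of affine n-space over k are functions 'i \<Rightarrow> 'k, with 'i a finite type
  of coordinates. Polynomial functions on affine space are the smallest class of
  functions containing constants and coordinate functions, closed under + and *.\<close>

inductive_set polyfun :: "(('i \<Rightarrow> 'k::comm_ring_1) \<Rightarrow> 'k) set" where
  pf_const: "(\<lambda>_. c) \<in> polyfun"
| pf_coord: "(\<lambda>p. p i) \<in> polyfun"
| pf_add: "f \<in> polyfun \<Longrightarrow> g \<in> polyfun \<Longrightarrow> (\<lambda>p. f p + g p) \<in> polyfun"
| pf_mult: "f \<in> polyfun \<Longrightarrow> g \<in> polyfun \<Longrightarrow> (\<lambda>p. f p * g p) \<in> polyfun"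

definition zclosed :: "('i \<Rightarrow> 'k::comm_ring_1) set \<Rightarrow> bool" where
  "zclosed Y \<longleftrightarrow> (\<exists>F \<subseteq> polyfun. Y = {p. \<forall>f\<in>F. f p = 0})"

definition zclosed_in :: "('i \<Rightarrow> 'k::comm_ring_1) set \<Rightarrow> ('i \<Rightarrow> 'k) set \<Rightarrow> bool" where
  "zclosed_in X Y \<longleftrightarrow> (\<exists>C. zclosed C \<and> Y = X \<inter> C)"

definition zopen_in :: "('i \<Rightarrow> 'k::comm_ring_1) set \<Rightarrow> ('i \<Rightarrow> 'k) set \<Rightarrow> bool" where
  "zopen_in X U \<longleftrightarrow> U \<subseteq> X \<and> zclosed_in X (X - U)"

definition zclosure :: "('i \<Rightarrow> 'k::comm_ring_1) set \<Rightarrow> ('i \<Rightarrow> 'k) set" where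
  "zclosure S = \<Inter>{C. zclosed C \<and> S \<subseteq> C}"

definition zirreducible :: "('i \<Rightarrow> 'k::comm_ring_1) set \<Rightarrow> bool" where
  "zirreducible X \<longleftrightarrow> X \<noteq> {} \<and>
     (\<forall>A B. zclosed A \<and> zclosed B \<and> X \<subseteq> A \<union> B \<longrightarrow> X \<subseteq> A \<or> X \<subseteq> B)"

definition affine_variety :: "('i::finite \<Rightarrow> 'k::comm_ring_1) set \<Rightarrow> bool" where
  "affine_variety X \<longleftrightarrow> zclosed X"

definition zdim :: "('i \<Rightarrow> 'k::comm_ring_1) set \<Rightarrow> enat" where
  "zdim S = (SUP n \<in> {n. \<exists>Z :: nat \<Rightarrow> ('i \<Rightarrow> 'k) set.
        (\<forall>j\<le>n. zclosed (Z j) \<and> zirreducible (Z j) \<and> Z j \<subseteq> zclosure S) \<and>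
        (\<forall>j<n. Z j \<subset> Z (Suc j))}. enat n)"

text \<open>Regular functions on X: restrictions of polynomial functions (elements of k[X]
  are represented by functions, compared only on X).\<close>
definition regular_fun :: "('i \<Rightarrow> 'k::comm_ring_1) set \<Rightarrow> (('i \<Rightarrow> 'k) \<Rightarrow> 'k) \<Rightarrow> bool" where
  "regular_fun X f \<longleftrightarrow> (\<exists>g\<in>polyfun. \<forall>p\<in>X. f p = g p)"

definition pair_pt :: "('i \<Rightarrow> 'k) \<Rightarrow> ('j \<Rightarrow> 'k) \<Rightarrow> ('i + 'j \<Rightarrow> 'k)" where
  "pair_pt p q = case_sum p q"

definition prod_set :: "('i \<Rightarrow> 'k) set \<Rightarrow> ('j \<Rightarrow> 'k) set \<Rightarrow> ('i + 'j \<Rightarrow> 'k) set" where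
  "prod_set X Y = {pair_pt p q | p q. p \<in> X \<and> q \<in> Y}"

definition regular_map :: "('i \<Rightarrow> 'k::comm_ring_1) set \<Rightarrow> ('j \<Rightarrow> 'k) set
     \<Rightarrow> (('i \<Rightarrow> 'k) \<Rightarrow> ('j \<Rightarrow> 'k)) \<Rightarrow> bool" where
  "regular_map X Y \<phi> \<longleftrightarrow> (\<forall>p\<in>X. \<phi> p \<in> Y) \<and> (\<forall>j. regular_fun X (\<lambda>p. \<phi> p j))"

definition affine_algebraic_group :: "('m::finite \<Rightarrow> 'k::comm_ring_1) monoid \<Rightarrow> bool" where
  "affine_algebraic_group G \<longleftrightarrow> group G \<and> affine_variety (carrier G) \<and>
     regular_map (prod_set (carrier G) (carrier G)) (carrier G)
        (\<lambda>z. (z \<circ> Inl) \<otimes>\<^bsub>G\<^esub> (z \<circ> Inr)) \<and>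
     regular_map (carrier G) (carrier G) (\<lambda>h. inv\<^bsub>G\<^esub> h)"

definition regular_action :: "('m::finite \<Rightarrow> 'k::comm_ring_1) monoid \<Rightarrow> ('n::finite \<Rightarrow> 'k) set
     \<Rightarrow> (('m \<Rightarrow> 'k) \<Rightarrow> ('n \<Rightarrow> 'k) \<Rightarrow> ('n \<Rightarrow> 'k)) \<Rightarrow> bool" where
  "regular_action G X act \<longleftrightarrow>
     (\<forall>x\<in>X. act \<one>\<^bsub>G\<^esub> x = x) \<and>
     (\<forall>g\<in>carrier G. \<forall>h\<in>carrier G. \<forall>x\<in>X. act (g \<otimes>\<^bsub>G\<^esub> h) x = act g (act h x)) \<and>
     regular_map (prod_set (carrier G) X) X (\<lambda>z. act (z \<circ> Inl) (z \<circ> Inr))"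

definition fun_act :: "('m \<Rightarrow> 'k) monoid \<Rightarrow> (('m \<Rightarrow> 'k) \<Rightarrow> ('n \<Rightarrow> 'k) \<Rightarrow> ('n \<Rightarrow> 'k))
     \<Rightarrow> ('m \<Rightarrow> 'k) \<Rightarrow> (('n \<Rightarrow> 'k) \<Rightarrow> 'k) \<Rightarrow> (('n \<Rightarrow> 'k) \<Rightarrow> 'k)" where
  "fun_act G act h f = (\<lambda>x. f (act (inv\<^bsub>G\<^esub> h) x))"

definition inv_regular :: "('m \<Rightarrow> 'k::comm_ring_1) monoid \<Rightarrow> ('n \<Rightarrow> 'k) set
     \<Rightarrow> (('m \<Rightarrow> 'k) \<Rightarrow> ('n \<Rightarrow> 'k) \<Rightarrow> ('n \<Rightarrow> 'k)) \<Rightarrow> (('n \<Rightarrow> 'k) \<Rightarrow> 'k) \<Rightarrow> bool" where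
  "inv_regular G X act f \<longleftrightarrow> regular_fun X f \<and>
     (\<forall>h\<in>carrier G. \<forall>x\<in>X. fun_act G act h f x = f x)"

text \<open>For irreducible X, k(X) = [k[X]] is the field of fractions of k[X]: a rational
  function is represented by a pair (f, g) of regular functions with g \<noteq> 0 in k[X];
  (f, g) and (f', g') represent the same element iff f g' = f' g in k[X].\<close>
definition rat_rep :: "('n \<Rightarrow> 'k::comm_ring_1) set \<Rightarrow> (('n \<Rightarrow> 'k) \<Rightarrow> 'k) \<times> (('n \<Rightarrow> 'k) \<Rightarrow> 'k) \<Rightarrow> bool" where
  "rat_rep X r \<longleftrightarrow> regular_fun X (fst r) \<and> regular_fun X (snd r) \<and> (\<exists>x\<in>X. snd r x \<noteq> 0)"

definition rat_eq :: "('n \<Rightarrow> 'k::comm_ring_1) set \<Rightarrow> (('n \<Rightarrow> 'k) \<Rightarrow> 'k) \<times> (('n \<Rightarrow> 'k) \<Rightarrow> 'k)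
     \<Rightarrow> (('n \<Rightarrow> 'k) \<Rightarrow> 'k) \<times> (('n \<Rightarrow> 'k) \<Rightarrow> 'k) \<Rightarrow> bool" where
  "rat_eq X r s \<longleftrightarrow> (\<forall>x\<in>X. fst r x * snd s x = fst s x * snd r x)"

definition inv_rational :: "('m \<Rightarrow> 'k::comm_ring_1) monoid \<Rightarrow> ('n \<Rightarrow> 'k) set
     \<Rightarrow> (('m \<Rightarrow> 'k) \<Rightarrow> ('n \<Rightarrow> 'k) \<Rightarrow> ('n \<Rightarrow> 'k))
     \<Rightarrow> (('n \<Rightarrow> 'k) \<Rightarrow> 'k) \<times> (('n \<Rightarrow> 'k) \<Rightarrow> 'k) \<Rightarrow> bool" where
  "inv_rational G X act r \<longleftrightarrow> rat_rep X r \<and>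
     (\<forall>h\<in>carrier G. rat_eq X (fun_act G act h (fst r), fun_act G act h (snd r)) r)"

text \<open>Condition (a): [{}^H k[X]] = {}^H[k[X]] inside k(X), i.e. every invariant rational
  function is a quotient of two invariant regular functions (the other inclusion
  is automatic).\<close>
definition quotients_of_invariants :: "('m \<Rightarrow> 'k::comm_ring_1) monoid \<Rightarrow> ('n \<Rightarrow> 'k) set
     \<Rightarrow> (('m \<Rightarrow> 'k) \<Rightarrow> ('n \<Rightarrow> 'k) \<Rightarrow> ('n \<Rightarrow> 'k)) \<Rightarrow> bool" where
  "quotients_of_invariants G X act \<longleftrightarrow>
     (\<forall>r. inv_rational G X act r \<longrightarrow>
        (\<exists>f g. inv_regular G X act f \<and> inv_regular G X act g \<and> (\<exists>x\<in>X. g x \<noteq> 0) \<and>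
               rat_eq X (f, g) r))"

definition orbit :: "('m \<Rightarrow> 'k) monoid \<Rightarrow> (('m \<Rightarrow> 'k) \<Rightarrow> ('n \<Rightarrow> 'k) \<Rightarrow> ('n \<Rightarrow> 'k))
     \<Rightarrow> ('n \<Rightarrow> 'k) \<Rightarrow> ('n \<Rightarrow> 'k) set" where
  "orbit G act p = (\<lambda>h. act h p) ` carrier G"

definition Omega :: "('m \<Rightarrow> 'k::comm_ring_1) monoid \<Rightarrow> ('n \<Rightarrow> 'k) set
     \<Rightarrow> (('m \<Rightarrow> 'k) \<Rightarrow> ('n \<Rightarrow> 'k) \<Rightarrow> ('n \<Rightarrow> 'k)) \<Rightarrow> ('n \<Rightarrow> 'k) set" where
  "Omega G X act = {p \<in> X. zclosed_in X (orbit G act p) \<and>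
      (\<forall>q\<in>X. zdim (orbit G act q) \<le> zdim (orbit G act p))}"

definition H_stable :: "('m \<Rightarrow> 'k) monoid \<Rightarrow> (('m \<Rightarrow> 'k) \<Rightarrow> ('n \<Rightarrow> 'k) \<Rightarrow> ('n \<Rightarrow> 'k))
     \<Rightarrow> ('n \<Rightarrow> 'k) set \<Rightarrow> bool" where
  "H_stable G act Y \<longleftrightarrow> (\<forall>h\<in>carrier G. \<forall>y\<in>Y. act h y \<in> Y)"

definition observable :: "('m \<Rightarrow> 'k::comm_ring_1) monoid \<Rightarrow> ('n \<Rightarrow> 'k) set
     \<Rightarrow> (('m \<Rightarrow> 'k) \<Rightarrow> ('n \<Rightarrow> 'k) \<Rightarrow> ('n \<Rightarrow> 'k)) \<Rightarrow> bool" where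
  "observable G X act \<longleftrightarrow>
     (\<forall>Y. zclosed_in X Y \<and> H_stable G act Y \<and> Y \<subset> X \<longrightarrow>
        (\<exists>f. inv_regular G X act f \<and> (\<exists>x\<in>X. f x \<noteq> 0) \<and> (\<forall>y\<in>Y. f y = 0)))"

end

theory Submission
  imports Defs "HOL-Library.Function_Algebras"
begin

text \<open>If the action is observable, the denominators of an invariant rational function form a stable
  ideal, so by the Nullstellensatz a power of some nonzero invariant is a denominator; this gives (a).
  For (b), take a nonzero invariant \<open>f\<close> vanishing on the stable closed set outside of which orbits
  have generic dimension. An orbit on which \<open>f \<noteq> 0\<close> is closed, because \<open>f\<close> is constant on its closure
  and boundary orbits have smaller dimension.

  Conversely, let \<open>Y \<noteq> X\<close> be closed and stable, and let \<open>\<Gamma> = {(x, hx)}\<close>. For generic \<open>x\<close> the fibre over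
  \<open>x\<close> of the closure of \<open>\<Gamma>\<close> is the closure of the orbit of \<open>x\<close> (by generic flatness), hence by (b) the
  orbit itself, which does not meet \<open>Y\<close>. So some nonzero \<open>a(x)\<close> vanishes on the intersection of
  \<open>X \<times> Y\<close> with the closure of \<open>\<Gamma>\<close>, and the Nullstellensatz gives a relation
  \<open>a(x)^n = \<Sum> c\<^sub>i(x) v\<^sub>i(hx)\<close> with \<open>v\<^sub>i\<close> vanishing on \<open>Y\<close>. In a shortest such relation all
  \<open>c\<^sub>i / a^n\<close> are invariant rational functions; writing them with invariant numerators and
  denominators by (a) and setting \<open>h = 1\<close> yields a nonzero invariant vanishing on \<open>Y\<close>.\<close>

section \<open>Subrings, ideals and Hilbert's basis theorem\<close>

text \<open>Generic flatness answers one obstacle: \<open>\<Gamma>\<close> contains the part s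
  \<noteq> 0 of its closure for some function s, but a fibre of the closure might have a whole
  component inside s = 0. Over generic points this is excluded, because s is not a zero divisor on
  the closure and the vanishing of Tor_1 preserves this on the fibre. Chains of irreducible closed
  sets, by which \<open>zdim\<close> is defined, cannot be followed from one orbit to another. A
  chain of length n in W is therefore converted into a polynomial map with dense image of W in
  affine n-space, and back. Density passes from one orbit to the generic ones, which gives
  semicontinuity, and it bounds n by the number of coordinates, so that a largest orbit dimension
  exists. Chains are kept for the drop of dimension at the boundary. The group may be disconnected,
  so arguments about images are applied to one irreducible component at a time. Rings are sets of
  functions of one type, and quotients occur only as conditions modulo an ideal.\<close>

definition subring_set :: "'r::comm_ring_1 set \<Rightarrow> bool" where
  "subring_set R \<longleftrightarrow> 1 \<in> R \<and> (\<forall>a\<in>R. \<forall>b\<in>R. a - b \<in> R \<and> a * b \<in> R)"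

definition ideal_of :: "'r::comm_ring_1 set \<Rightarrow> 'r set \<Rightarrow> bool" where
  "ideal_of R J \<longleftrightarrow> J \<subseteq> R \<and> 0 \<in> J \<and> (\<forall>a\<in>J. \<forall>b\<in>J. a + b \<in> J) \<and> (\<forall>r\<in>R. \<forall>a\<in>J. r * a \<in> J)"

definition polys_over :: "'r::comm_ring_1 set \<Rightarrow> 'r poly set" where
  "polys_over R = {p. \<forall>i. coeff p i \<in> R}"

definition adjoin :: "'r::comm_ring_1 set \<Rightarrow> 'r \<Rightarrow> 'r set" where
  "adjoin R t = (\<lambda>p. poly p t) ` polys_over R"

lemma subring_1: "subring_set R \<Longrightarrow> 1 \<in> R"
  and subring_diff: "subring_set R \<Longrightarrow> a \<in> R \<Longrightarrow> b \<in> R \<Longrightarrow> a - b \<in> R"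
  and subring_mult: "subring_set R \<Longrightarrow> a \<in> R \<Longrightarrow> b \<in> R \<Longrightarrow> a * b \<in> R"
  by (auto simp: subring_set_def)

lemma subring_0: "subring_set R \<Longrightarrow> 0 \<in> R"
  using subring_diff[of R 1 1] subring_1 by auto

lemma subring_uminus: "subring_set R \<Longrightarrow> a \<in> R \<Longrightarrow> - a \<in> R"
  using subring_diff[of R 0 a] subring_0 by auto

lemma subring_add: "subring_set R \<Longrightarrow> a \<in> R \<Longrightarrow> b \<in> R \<Longrightarrow> a + b \<in> R"
  using subring_diff[of R a "- b"] subring_uminus by auto

lemma subring_power: "subring_set R \<Longrightarrow> a \<in> R \<Longrightarrow> a ^ n \<in> R"
  by (induction n) (auto simp: subring_1 subring_mult)

lemma subring_sum: "subring_set R \<Longrightarrow> (\<And>i. i \<in> S \<Longrightarrow> f i \<in> R) \<Longrightarrow> sum f S \<in> R"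
  by (induction S rule: infinite_finite_induct) (auto simp: subring_0 subring_add)

lemmas subring_intros = subring_0 subring_1 subring_diff subring_mult subring_uminus
  subring_add subring_power

lemma ideal_sub: "ideal_of R J \<Longrightarrow> a \<in> J \<Longrightarrow> a \<in> R"
  and ideal_0: "ideal_of R J \<Longrightarrow> 0 \<in> J"
  and ideal_add: "ideal_of R J \<Longrightarrow> a \<in> J \<Longrightarrow> b \<in> J \<Longrightarrow> a + b \<in> J"
  and ideal_mult: "ideal_of R J \<Longrightarrow> r \<in> R \<Longrightarrow> a \<in> J \<Longrightarrow> r * a \<in> J"
  by (auto simp: ideal_of_def)

lemma ideal_mult_right: "ideal_of R J \<Longrightarrow> r \<in> R \<Longrightarrow> a \<in> J \<Longrightarrow> a * r \<in> J"
  using ideal_mult by (metis mult.commute)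

lemma ideal_uminus: "subring_set R \<Longrightarrow> ideal_of R J \<Longrightarrow> a \<in> J \<Longrightarrow> - a \<in> J"
  using ideal_mult[of R J "- 1" a] by (auto simp: subring_intros)

lemma ideal_diff: "subring_set R \<Longrightarrow> ideal_of R J \<Longrightarrow> a \<in> J \<Longrightarrow> b \<in> J \<Longrightarrow> a - b \<in> J"
  using ideal_add[of R J a "- b"] ideal_uminus by auto

lemma ideal_Int: "ideal_of R I \<Longrightarrow> ideal_of R J \<Longrightarrow> ideal_of R (I \<inter> J)"
  by (auto simp: ideal_of_def)

lemma ideal_self: "subring_set R \<Longrightarrow> ideal_of R R"
  by (auto simp: ideal_of_def subring_intros)

lemma ideal_restrict: "subring_set R \<Longrightarrow> ideal_of UNIV N \<Longrightarrow> ideal_of R (N \<inter> R)"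
  by (auto simp: ideal_of_def subring_intros)

lemma ideal_combination:
  assumes R: "subring_set R" and s: "s \<in> R" and K: "ideal_of R K" and I: "ideal_of R I"
  shows "ideal_of R {s * g + h | g h. g \<in> K \<and> h \<in> I}" (is "ideal_of R ?T")
  unfolding ideal_of_def
proof (intro conjI ballI subsetI)
  have mem: "g \<in> K \<Longrightarrow> h \<in> I \<Longrightarrow> a = s * g + h \<Longrightarrow> a \<in> ?T" for g h a by blast
  show "a \<in> R" if "a \<in> ?T" for a
    using that s ideal_sub[OF K] ideal_sub[OF I] by (auto intro!: subring_add[OF R] subring_mult[OF R])
  show "0 \<in> ?T" by (rule mem[OF ideal_0[OF K] ideal_0[OF I]]) simp
  fix a assume "a \<in> ?T"
  then obtain g h where gh: "g \<in> K" "h \<in> I" "a = s * g + h" by blast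
  show "a + b \<in> ?T" if b: "b \<in> ?T" for b
  proof -
    from b obtain g' h' where gh': "g' \<in> K" "h' \<in> I" "b = s * g' + h'" by blast
    show ?thesis
      by (rule mem[OF ideal_add[OF K gh(1) gh'(1)] ideal_add[OF I gh(2) gh'(2)]])
        (simp add: gh gh' algebra_simps)
  qed
  show "r * a \<in> ?T" if r: "r \<in> R" for r
    by (rule mem[OF ideal_mult[OF K r gh(1)] ideal_mult[OF I r gh(2)]]) (simp add: gh algebra_simps)
qed

lemma polys_over_add: "subring_set R \<Longrightarrow> p \<in> polys_over R \<Longrightarrow> q \<in> polys_over R \<Longrightarrow> p + q \<in> polys_over R"
  and polys_over_diff: "subring_set R \<Longrightarrow> p \<in> polys_over R \<Longrightarrow> q \<in> polys_over R \<Longrightarrow> p - q \<in> polys_over R"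
  and polys_over_smult: "subring_set R \<Longrightarrow> a \<in> R \<Longrightarrow> q \<in> polys_over R \<Longrightarrow> smult a q \<in> polys_over R"
  and polys_over_monom: "subring_set R \<Longrightarrow> a \<in> R \<Longrightarrow> monom a n \<in> polys_over R"
  and polys_over_0: "subring_set R \<Longrightarrow> 0 \<in> polys_over R"
  and polys_over_1: "subring_set R \<Longrightarrow> 1 \<in> polys_over R"
  and polys_over_pCons: "subring_set R \<Longrightarrow> a \<in> R \<Longrightarrow> q \<in> polys_over R \<Longrightarrow> pCons a q \<in> polys_over R"
  by (auto simp: polys_over_def subring_intros coeff_pCons split: nat.splits)

lemma polys_over_mult:
  "subring_set R \<Longrightarrow> p \<in> polys_over R \<Longrightarrow> q \<in> polys_over R \<Longrightarrow> p * q \<in> polys_over R"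
  by (auto simp: polys_over_def coeff_mult intro!: subring_sum subring_mult)

lemmas polys_over_intros = polys_over_add polys_over_diff polys_over_smult polys_over_monom
  polys_over_0 polys_over_1 polys_over_pCons polys_over_mult

lemma polys_over_coeff: "p \<in> polys_over R \<Longrightarrow> coeff p i \<in> R"
  by (simp add: polys_over_def)

lemma adjoinI: "p \<in> polys_over R \<Longrightarrow> poly p t \<in> adjoin R t"
  by (simp add: adjoin_def)

lemma subring_adjoin:
  assumes "subring_set R"
  shows "subring_set (adjoin R t)"
  unfolding subring_set_def
proof (intro conjI ballI)
  show "1 \<in> adjoin R t"
    using adjoinI[OF polys_over_1[OF assms], of t] by simp
  fix a b assume "a \<in> adjoin R t" "b \<in> adjoin R t"
  then obtain p q where pq: "p \<in> polys_over R" "q \<in> polys_over R" "a = poly p t" "b = poly q t"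
    by (auto simp: adjoin_def)
  show "a - b \<in> adjoin R t"
    using adjoinI[OF polys_over_diff[OF assms pq(1,2)], of t] by (simp add: pq)
  show "a * b \<in> adjoin R t"
    using adjoinI[OF polys_over_mult[OF assms pq(1,2)], of t] by (simp add: pq)
qed

lemma adjoin_superset: "subring_set R \<Longrightarrow> R \<subseteq> adjoin R t"
  using adjoinI[OF polys_over_monom, of R _ 0 t] by (auto simp: poly_monom)

lemma adjoin_gen: "subring_set R \<Longrightarrow> t \<in> adjoin R t"
  using adjoinI[OF polys_over_monom, of R 1 1 t] by (auto simp: poly_monom subring_1)

definition lead_ideal :: "'r::comm_ring_1 set \<Rightarrow> 'r \<Rightarrow> nat \<Rightarrow> 'r set \<Rightarrow> 'r set" where
  "lead_ideal R t d J = {coeff p d | p. p \<in> polys_over R \<and> degree p \<le> d \<and> poly p t \<in> J}"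

lemma lead_idealI:
  "p \<in> polys_over R \<Longrightarrow> degree p \<le> d \<Longrightarrow> poly p t \<in> J \<Longrightarrow> coeff p d \<in> lead_ideal R t d J"
  by (auto simp: lead_ideal_def)

lemma lead_idealE:
  assumes "c \<in> lead_ideal R t d J"
  obtains p where "p \<in> polys_over R" "degree p \<le> d" "poly p t \<in> J" "coeff p d = c"
  using assms by (auto simp: lead_ideal_def)

lemma ideal_lead_ideal:
  assumes R: "subring_set R" and J: "ideal_of (adjoin R t) J"
  shows "ideal_of R (lead_ideal R t d J)"
  unfolding ideal_of_def
proof (intro conjI ballI subsetI)
  fix a assume "a \<in> lead_ideal R t d J"
  thus "a \<in> R" by (auto elim!: lead_idealE simp: polys_over_coeff)
next
  show "0 \<in> lead_ideal R t d J"
    using lead_idealI[of 0 R d t J] ideal_0[OF J] polys_over_0[OF R] by simp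
next
  fix a b assume "a \<in> lead_ideal R t d J" "b \<in> lead_ideal R t d J"
  then obtain p q where p: "p \<in> polys_over R" "degree p \<le> d" "poly p t \<in> J" "coeff p d = a"
    and q: "q \<in> polys_over R" "degree q \<le> d" "poly q t \<in> J" "coeff q d = b"
    by (metis lead_idealE)
  show "a + b \<in> lead_ideal R t d J"
    using lead_idealI[OF polys_over_add[OF R p(1) q(1)], of d t J] ideal_add[OF J p(3) q(3)] p q
    by (simp add: degree_add_le)
next
  fix r a assume r: "r \<in> R" and "a \<in> lead_ideal R t d J"
  then obtain p where p: "p \<in> polys_over R" "degree p \<le> d" "poly p t \<in> J" "coeff p d = a"
    by (metis lead_idealE)
  have "r \<in> adjoin R t" using r adjoin_superset[OF R] by auto
  thus "r * a \<in> lead_ideal R t d J"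
    using lead_idealI[OF polys_over_smult[OF R r p(1)], of d t J] ideal_mult[OF J _ p(3)] p
    by (metis coeff_smult degree_smult_le le_trans poly_smult)
qed

lemma lead_ideal_mono: "J \<subseteq> J' \<Longrightarrow> lead_ideal R t d J \<subseteq> lead_ideal R t d J'"
  by (auto simp: lead_ideal_def)

lemma lead_ideal_mono_Suc:
  assumes R: "subring_set R" and J: "ideal_of (adjoin R t) J"
  shows "lead_ideal R t d J \<subseteq> lead_ideal R t (Suc d) J"
proof
  fix a assume "a \<in> lead_ideal R t d J"
  then obtain p where p: "p \<in> polys_over R" "degree p \<le> d" "poly p t \<in> J" "coeff p d = a"
    by (metis lead_idealE)
  show "a \<in> lead_ideal R t (Suc d) J"
    using lead_idealI[OF polys_over_pCons[OF R subring_0[OF R] p(1)], of "Suc d" t J] p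
      ideal_mult[OF J adjoin_gen[OF R] p(3)]
    by (simp add: le_trans[OF degree_pCons_le])
qed

lemma lead_ideal_mono_deg:
  assumes R: "subring_set R" and J: "ideal_of (adjoin R t) J" and "d \<le> e"
  shows "lead_ideal R t d J \<subseteq> lead_ideal R t e J"
  using assms(3) by (induction rule: dec_induct) (use lead_ideal_mono_Suc[OF R J] in blast)+

lemma degree_diff_less_bound:
  assumes "degree p \<le> Suc d" "degree q \<le> Suc d" "coeff p (Suc d) = coeff q (Suc d)"
  shows "degree (p - q) \<le> d"
proof (rule degree_le, intro allI impI)
  fix i assume "d < i"
  then consider "i = Suc d" | "i > Suc d" by linarith
  thus "coeff (p - q) i = 0"
    using assms by cases (auto simp: coeff_eq_0)
qed

text \<open>Induction on the degree of a representative: an element of \<open>J\<close> with the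
  same top coefficient is subtracted, and the difference stays in \<open>J'\<close> with a
  representative of smaller degree.\<close>

lemma ideal_eq_if_lead_ideals_eq:
  assumes R: "subring_set R" and J: "ideal_of (adjoin R t) J" and J': "ideal_of (adjoin R t) J'"
    and sub: "J \<subseteq> J'" and eq: "\<And>d. lead_ideal R t d J' \<subseteq> lead_ideal R t d J"
  shows "J' = J"
proof -
  have main: "p \<in> polys_over R \<Longrightarrow> degree p \<le> d \<Longrightarrow> poly p t \<in> J' \<Longrightarrow> poly p t \<in> J" for p d
  proof (induction d arbitrary: p)
    case 0
    obtain q where q: "q \<in> polys_over R" "degree q \<le> 0" "poly q t \<in> J" "coeff q 0 = coeff p 0"
      using eq[of 0] lead_idealI[OF 0] by (metis lead_idealE subsetD)
    have "p = q"
    proof (rule poly_eqI)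
      fix i show "coeff p i = coeff q i"
        using q(2,4) 0(2) by (cases i) (auto simp: coeff_eq_0)
    qed
    thus ?case using q by simp
  next
    case (Suc d)
    obtain q where q: "q \<in> polys_over R" "degree q \<le> Suc d" "poly q t \<in> J"
        "coeff q (Suc d) = coeff p (Suc d)"
      using eq[of "Suc d"] lead_idealI[OF Suc.prems] by (metis lead_idealE subsetD)
    have d: "degree (p - q) \<le> d"
      using degree_diff_less_bound[of p d q] Suc.prems q by simp
    have m: "poly (p - q) t \<in> J'"
      using ideal_diff[OF subring_adjoin[OF R] J' Suc.prems(3), of "poly q t"] q sub by auto
    have "poly (p - q) t \<in> J"
      using Suc.IH[OF polys_over_diff[OF R Suc.prems(1) q(1)] d m] .
    thus ?case using ideal_add[OF J _ q(3)] by fastforce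
  qed
  show ?thesis
  proof
    show "J' \<subseteq> J"
    proof
      fix a assume a: "a \<in> J'"
      then obtain p where "p \<in> polys_over R" "a = poly p t"
        using ideal_sub[OF J'] by (auto simp: adjoin_def)
      thus "a \<in> J" using main[of p "degree p"] a by auto
    qed
  qed (fact sub)
qed

section \<open>Ascending chains of ideals and Hilbert's basis theorem\<close>

definition noeth :: "'r::comm_ring_1 set \<Rightarrow> bool" where
  "noeth R \<longleftrightarrow> (\<forall>I::nat \<Rightarrow> 'r set. (\<forall>n. ideal_of R (I n)) \<and> (\<forall>n. I n \<subseteq> I (Suc n)) \<longrightarrow>
      (\<exists>N. \<forall>n\<ge>N. I n = I N))"

lemma noethD:
  assumes "noeth R" "\<And>n. ideal_of R (I n)" "\<And>n. I n \<subseteq> I (Suc n)"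
  obtains N where "\<And>n. n \<ge> N \<Longrightarrow> I n = I N"
  using assms unfolding noeth_def by metis

text \<open>The leading coefficient ideals grow both with the degree \<open>d\<close> and with the
  index \<open>n\<close>. The diagonal stabilises at some \<open>M\<close>, which settles all
  degrees beyond \<open>M\<close>; the finitely many rows \<open>d \<le> M\<close> stabilise
  separately.\<close>

theorem noeth_adjoin:
  assumes R: "subring_set R" and N: "noeth R"
  shows "noeth (adjoin R t)"
  unfolding noeth_def
proof (intro allI impI)
  fix I :: "nat \<Rightarrow> 'a set"
  assume "(\<forall>n. ideal_of (adjoin R t) (I n)) \<and> (\<forall>n. I n \<subseteq> I (Suc n))"
  hence I: "\<And>n. ideal_of (adjoin R t) (I n)" and "\<And>n. I n \<subseteq> I (Suc n)" by auto
  hence mono: "m \<le> n \<Longrightarrow> I m \<subseteq> I n" for m n by (simp add: lift_Suc_mono_le)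
  let ?L = "\<lambda>d n. lead_ideal R t d (I n)"
  have L: "ideal_of R (?L d n)" for d n by (rule ideal_lead_ideal[OF R I])
  have Lm: "d \<le> d' \<Longrightarrow> n \<le> n' \<Longrightarrow> ?L d n \<subseteq> ?L d' n'" for d d' n n'
    using lead_ideal_mono_deg[OF R I] lead_ideal_mono[OF mono] by (meson subset_trans)
  obtain M where M: "\<And>n. n \<ge> M \<Longrightarrow> ?L n n = ?L M M"
    using noethD[OF N, of "\<lambda>n. ?L n n"] L Lm by (metis le_SucI order_refl)
  have "\<exists>K. \<forall>n\<ge>K. ?L d n = ?L d K" for d
    using noethD[OF N, of "\<lambda>n. ?L d n"] L Lm by (metis le_SucI order_refl)
  then obtain K where K: "\<And>d n. n \<ge> K d \<Longrightarrow> ?L d n = ?L d (K d)" by metis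
  define K0 where "K0 = Max (insert M (K ` {..M}))"
  have K0: "K0 \<ge> M" "\<And>d. d \<le> M \<Longrightarrow> K0 \<ge> K d" unfolding K0_def
    by (simp, rule Max_ge) auto
  have "I n = I K0" if n: "n \<ge> K0" for n
  proof (rule ideal_eq_if_lead_ideals_eq[OF R I I mono[OF n]])
    fix d
    show "?L d n \<subseteq> ?L d K0"
    proof (cases "d \<le> M")
      case True
      thus ?thesis using K[of d n] K[of d K0] K0(2)[OF True] n by auto
    next
      case False
      have "?L d n \<subseteq> ?L (max d n) (max d n)" by (rule Lm) auto
      also have "\<dots> = ?L M M" using M[of "max d n"] False by auto
      also have "\<dots> \<subseteq> ?L d K0" using False K0 by (intro Lm) auto
      finally show ?thesis .
    qed
  qed
  thus "\<exists>N. \<forall>n\<ge>N. I n = I N" by blast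
qed

lemma noeth_maximal:
  assumes "noeth R" "I0 \<in> F" "\<And>I. I \<in> F \<Longrightarrow> ideal_of R I"
  obtains M where "M \<in> F" "\<And>I. I \<in> F \<Longrightarrow> M \<subseteq> I \<Longrightarrow> I = M"
proof (rule ccontr)
  assume "\<not> thesis"
  hence "\<forall>M\<in>F. \<exists>I\<in>F. M \<subset> I" using that by blast
  then obtain s where s: "\<And>M. M \<in> F \<Longrightarrow> s M \<in> F \<and> M \<subset> s M" by metis
  define I where "I n = (s ^^ n) I0" for n
  have IF: "I n \<in> F" for n by (induction n) (auto simp: I_def assms s)
  have strict: "I n \<subset> I (Suc n)" for n using s[OF IF[of n]] by (simp add: I_def)
  have "ideal_of R (I n)" "I n \<subseteq> I (Suc n)" for n
    using assms(3)[OF IF[of n]] strict[of n] by auto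
  then obtain N where "\<And>n. n \<ge> N \<Longrightarrow> I n = I N"
    using noethD[OF assms(1), of I] by metis
  from this[of "Suc N"] show False using strict[of N] by simp
qed

definition adjoins :: "'r::comm_ring_1 set \<Rightarrow> 'r list \<Rightarrow> 'r set" where
  "adjoins R ts = foldl adjoin R ts"

lemma adjoins_Nil [simp]: "adjoins R [] = R"
  and adjoins_snoc [simp]: "adjoins R (ts @ [t]) = adjoin (adjoins R ts) t"
  by (simp_all add: adjoins_def)

lemma subring_adjoins: "subring_set R \<Longrightarrow> subring_set (adjoins R ts)"
  by (induction ts rule: rev_induct) (auto simp: subring_adjoin)

lemma adjoins_superset:
  assumes "subring_set R"
  shows "R \<subseteq> adjoins R ts"
proof (induction ts rule: rev_induct)
  case (snoc t ts)
  thus ?case using adjoin_superset[OF subring_adjoins[OF assms, of ts], of t] by simp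
qed simp

lemma adjoins_gens:
  assumes "subring_set R" "t \<in> set ts"
  shows "t \<in> adjoins R ts"
  using assms(2)
proof (induction ts rule: rev_induct)
  case (snoc s ts)
  note sr = subring_adjoins[OF assms(1), of ts]
  from snoc show ?case using adjoin_superset[OF sr, of s] adjoin_gen[OF sr, of s] by auto
qed simp

lemma noeth_adjoins: "subring_set R \<Longrightarrow> noeth R \<Longrightarrow> noeth (adjoins R ts)"
  by (induction ts rule: rev_induct) (auto simp: noeth_adjoin subring_adjoins)

section \<open>Extending homomorphisms to an algebraically closed field\<close>

text \<open>Only the trace of \<open>P\<close> on \<open>B\<close> is constrained, so one and the
  same \<open>P\<close> can be used for every ring between the base ring and the full one
  (\<open>prime_on_mono\<close>).\<close>

definition prime_on :: "'r::comm_ring_1 set \<Rightarrow> 'r set \<Rightarrow> bool" where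
  "prime_on B P \<longleftrightarrow> 1 \<notin> P \<and> 0 \<in> P \<and> (\<forall>a\<in>B \<inter> P. \<forall>b\<in>B \<inter> P. a + b \<in> P) \<and>
     (\<forall>a\<in>B. \<forall>b\<in>B \<inter> P. a * b \<in> P) \<and> (\<forall>a\<in>B. \<forall>b\<in>B. a * b \<in> P \<longrightarrow> a \<in> P \<or> b \<in> P)"

lemma prime_on_mono: "prime_on B P \<Longrightarrow> A \<subseteq> B \<Longrightarrow> prime_on A P"
  unfolding prime_on_def by blast

lemma prime_on_1: "prime_on B P \<Longrightarrow> 1 \<notin> P"
  and prime_on_0: "prime_on B P \<Longrightarrow> 0 \<in> P"
  and prime_on_add: "prime_on B P \<Longrightarrow> a \<in> B \<Longrightarrow> b \<in> B \<Longrightarrow> a \<in> P \<Longrightarrow> b \<in> P \<Longrightarrow> a + b \<in> P"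
  and prime_on_mult: "prime_on B P \<Longrightarrow> a \<in> B \<Longrightarrow> b \<in> B \<Longrightarrow> b \<in> P \<Longrightarrow> a * b \<in> P"
  and prime_onD: "prime_on B P \<Longrightarrow> a \<in> B \<Longrightarrow> b \<in> B \<Longrightarrow> a * b \<in> P \<Longrightarrow> a \<in> P \<or> b \<in> P"
  by (auto simp: prime_on_def)

lemma prime_on_diff:
  assumes "subring_set B" "prime_on B P" "a \<in> B" "b \<in> B" "a \<in> P" "b \<in> P"
  shows "a - b \<in> P"
proof -
  have "- 1 \<in> B" using assms(1) by (simp add: subring_intros)
  hence "- 1 * b \<in> P" using prime_on_mult assms by blast
  thus ?thesis using prime_on_add[of B P a "- b"] assms by (simp add: subring_intros)
qed

lemma prime_on_power:
  assumes "subring_set B" "prime_on B P" "a \<in> B" "a ^ n \<in> P"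
  shows "a \<in> P"
  using assms(4)
proof (induction n)
  case 0 thus ?case using prime_on_1[OF assms(2)] by simp
next
  case (Suc n)
  thus ?case using prime_onD[OF assms(2,3) subring_power[OF assms(1,3), of n]] by auto
qed

definition hom_on :: "'r::comm_ring_1 set \<Rightarrow> ('r \<Rightarrow> 'k::field) \<Rightarrow> bool" where
  "hom_on A \<phi> \<longleftrightarrow> \<phi> 1 = 1 \<and> (\<forall>a\<in>A. \<forall>b\<in>A. \<phi> (a - b) = \<phi> a - \<phi> b \<and> \<phi> (a * b) = \<phi> a * \<phi> b)"

lemma hom_on_1: "hom_on A \<phi> \<Longrightarrow> \<phi> 1 = 1"
  and hom_on_diff: "hom_on A \<phi> \<Longrightarrow> a \<in> A \<Longrightarrow> b \<in> A \<Longrightarrow> \<phi> (a - b) = \<phi> a - \<phi> b"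
  and hom_on_mult: "hom_on A \<phi> \<Longrightarrow> a \<in> A \<Longrightarrow> b \<in> A \<Longrightarrow> \<phi> (a * b) = \<phi> a * \<phi> b"
  by (auto simp: hom_on_def)

lemma hom_on_0: "subring_set A \<Longrightarrow> hom_on A \<phi> \<Longrightarrow> \<phi> 0 = 0"
  using hom_on_diff[of A \<phi> 1 1] subring_1 by auto

lemma hom_on_uminus: "subring_set A \<Longrightarrow> hom_on A \<phi> \<Longrightarrow> a \<in> A \<Longrightarrow> \<phi> (- a) = - \<phi> a"
  using hom_on_diff[of A \<phi> 0 a] subring_0[of A] hom_on_0[of A \<phi>] by simp

lemma hom_on_add: "subring_set A \<Longrightarrow> hom_on A \<phi> \<Longrightarrow> a \<in> A \<Longrightarrow> b \<in> A \<Longrightarrow> \<phi> (a + b) = \<phi> a + \<phi> b"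
  using hom_on_diff[of A \<phi> a "- b"] subring_uminus hom_on_uminus by force

lemma hom_on_power: "subring_set A \<Longrightarrow> hom_on A \<phi> \<Longrightarrow> a \<in> A \<Longrightarrow> \<phi> (a ^ n) = \<phi> a ^ n"
  by (induction n) (auto simp: hom_on_1 hom_on_mult subring_power)

lemma hom_on_sum:
  "subring_set A \<Longrightarrow> hom_on A \<phi> \<Longrightarrow> (\<And>i. i \<in> S \<Longrightarrow> f i \<in> A) \<Longrightarrow> \<phi> (sum f S) = (\<Sum>i\<in>S. \<phi> (f i))"
  by (induction S rule: infinite_finite_induct) (auto simp: hom_on_0 hom_on_add subring_sum)

lemma subring_polys_over: "subring_set A \<Longrightarrow> subring_set (polys_over A)"
  unfolding subring_set_def[of "polys_over A"] by (auto intro: polys_over_intros)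

lemma infinite_alg_closed: "infinite (UNIV :: 'k::alg_closed_field set)"
proof
  assume fin: "finite (UNIV :: 'k set)"
  \<comment> \<open>Adding 1 to a polynomial that vanishes at every element of the field removes all
    roots.\<close>
  define p where "p = (\<Prod>a\<in>UNIV. [:- a, 1:] :: 'k poly) + 1"
  have "poly p x = 1" for x :: 'k
    using fin by (auto simp: p_def poly_prod prod_zero_iff)
  moreover have "degree p > 0"
  proof -
    have "degree (\<Prod>a\<in>UNIV. [:- a, 1:] :: 'k poly) = card (UNIV :: 'k set)"
      by (subst degree_prod_eq_sum_degree) auto
    moreover have "card (UNIV :: 'k set) > 0" using fin by (simp add: card_gt_0_iff)
    ultimately show ?thesis unfolding p_def by (subst degree_add_eq_left) auto
  qed
  ultimately show False using alg_closed_imp_poly_has_root[of p] by auto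
qed

context
  fixes A :: "'r::comm_ring_1 set" and \<phi> :: "'r \<Rightarrow> 'k::field"
  assumes A: "subring_set A" and hom: "hom_on A \<phi>"
begin

lemma hom_coeff: "coeff (map_poly \<phi> p) i = \<phi> (coeff p i)"
  by (simp add: coeff_map_poly hom_on_0[OF A hom])

lemma map_poly_hom_diff:
  "p \<in> polys_over A \<Longrightarrow> q \<in> polys_over A \<Longrightarrow> map_poly \<phi> (p - q) = map_poly \<phi> p - map_poly \<phi> q"
  by (rule poly_eqI) (simp add: hom_coeff hom_on_diff[OF hom] polys_over_coeff)

lemma map_poly_hom_add:
  "p \<in> polys_over A \<Longrightarrow> q \<in> polys_over A \<Longrightarrow> map_poly \<phi> (p + q) = map_poly \<phi> p + map_poly \<phi> q"
  by (rule poly_eqI) (simp add: hom_coeff hom_on_add[OF A hom] polys_over_coeff)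

lemma map_poly_hom_mult:
  assumes "p \<in> polys_over A" "q \<in> polys_over A"
  shows "map_poly \<phi> (p * q) = map_poly \<phi> p * map_poly \<phi> q"
proof (rule poly_eqI)
  fix n
  have "\<phi> (\<Sum>i\<le>n. coeff p i * coeff q (n - i)) = (\<Sum>i\<le>n. \<phi> (coeff p i * coeff q (n - i)))"
    using assms by (intro hom_on_sum[OF A hom]) (auto intro: subring_mult[OF A] polys_over_coeff)
  also have "\<dots> = (\<Sum>i\<le>n. \<phi> (coeff p i) * \<phi> (coeff q (n - i)))"
    using assms by (intro sum.cong refl hom_on_mult[OF hom]) (auto intro: polys_over_coeff)
  finally show "coeff (map_poly \<phi> (p * q)) n = coeff (map_poly \<phi> p * map_poly \<phi> q) n"
    by (simp add: hom_coeff coeff_mult)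
qed

lemma map_poly_hom_smult:
  "a \<in> A \<Longrightarrow> q \<in> polys_over A \<Longrightarrow> map_poly \<phi> (smult a q) = smult (\<phi> a) (map_poly \<phi> q)"
  by (rule poly_eqI) (simp add: hom_coeff hom_on_mult[OF hom] polys_over_coeff)

lemma map_poly_hom_const: "map_poly \<phi> [:a:] = [:\<phi> a:]"
  by (rule poly_eqI) (simp add: hom_coeff coeff_pCons hom_on_0[OF A hom] split: nat.splits)

end

section \<open>Pseudo-division modulo a prime ideal of A[X]\<close>

context
  fixes A :: "'r::comm_ring_1 set" and Q :: "'r poly set"
  assumes A: "subring_set A" and Q: "prime_on (polys_over A) Q"
begin

text \<open>The constants in \<open>Q\<close> form the contraction of \<open>Q\<close> to
  \<open>A\<close>. The condition says that \<open>F\<close> becomes zero over \<open>A\<close>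
  modulo this contraction, the integral domain over which the division takes place.\<close>

definition coeffs_in :: "'r poly \<Rightarrow> bool" where
  "coeffs_in F \<longleftrightarrow> (\<forall>i. [:coeff F i:] \<in> Q)"

lemma const_over: "a \<in> A \<Longrightarrow> [:a:] \<in> polys_over A"
  by (simp add: polys_over_intros A)

lemma coeffs_in_0: "coeffs_in 0"
  by (simp add: coeffs_in_def prime_on_0[OF Q])

lemma coeffs_in_add: "F \<in> polys_over A \<Longrightarrow> G \<in> polys_over A \<Longrightarrow> coeffs_in F \<Longrightarrow> coeffs_in G \<Longrightarrow> coeffs_in (F + G)"
proof -
  assume a: "F \<in> polys_over A" "G \<in> polys_over A" "coeffs_in F" "coeffs_in G"
  have "[:coeff F i:] + [:coeff G i:] \<in> Q" for i
    using a by (intro prime_on_add[OF Q]) (auto simp: const_over polys_over_coeff coeffs_in_def)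
  thus ?thesis by (simp add: coeffs_in_def)
qed

lemma coeffs_in_mem:
  "F \<in> polys_over A \<Longrightarrow> coeffs_in F \<Longrightarrow> F \<in> Q"
proof (induction F)
  case 0
  thus ?case using prime_on_0[OF Q] by simp
next
  case (pCons a F)
  have F: "F \<in> polys_over A" "coeffs_in F" "a \<in> A" "[:a:] \<in> Q"
    using pCons.prems by (auto simp: polys_over_def coeffs_in_def coeff_pCons split: nat.splits)
  have X: "[:0, 1:] \<in> polys_over A" by (simp add: polys_over_intros A subring_intros)
  have "[:0, 1:] * F \<in> Q" using prime_on_mult[OF Q X F(1)] pCons.IH F by auto
  hence "[:a:] + [:0, 1:] * F \<in> Q"
    using prime_on_add[OF Q const_over[OF F(3)] polys_over_mult[OF A X F(1)]] F by auto
  thus ?case by simp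
qed

lemma coeffs_in_mult:
  assumes "F \<in> polys_over A" "G \<in> polys_over A" "coeffs_in G"
  shows "coeffs_in (F * G)"
  unfolding coeffs_in_def
proof
  fix n
  have "S \<subseteq> {..n} \<Longrightarrow> [:\<Sum>i\<in>S. coeff F i * coeff G (n - i):] \<in> Q" for S
  proof (induction S rule: infinite_finite_induct)
    case (insert j S)
    have "[:coeff F j:] * [:coeff G (n - j):] \<in> Q"
      using assms by (intro prime_on_mult[OF Q]) (auto simp: const_over polys_over_coeff coeffs_in_def)
    hence "[:coeff F j * coeff G (n - j):] + [:\<Sum>i\<in>S. coeff F i * coeff G (n - i):] \<in> Q"
      using insert assms
      by (intro prime_on_add[OF Q] const_over subring_sum[OF A] subring_mult[OF A])
        (auto simp: polys_over_coeff mult.commute)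
    thus ?case using insert by (simp add: mult.commute)
  qed (auto simp: prime_on_0[OF Q])
  thus "[:coeff (F * G) n:] \<in> Q" by (simp add: coeff_mult)
qed

text \<open>If the top coefficient of an element of least degree were zero modulo the contraction of
  \<open>Q\<close>, its leading term would lie in \<open>Q\<close> and hence in \<open>W\<close>;
  subtracting it would leave an element of \<open>W\<close> of smaller degree that is still nonzero
  modulo the contraction.\<close>

lemma minimal_lead_coeff:
  assumes W: "ideal_of (polys_over A) W" "Q \<inter> polys_over A \<subseteq> W" and G: "G \<in> W" "\<not> coeffs_in G"
  obtains q where "q \<in> W" "[:lead_coeff q:] \<notin> Q" "\<And>F. F \<in> W \<Longrightarrow> \<not> coeffs_in F \<Longrightarrow> degree q \<le> degree F"
proof -
  obtain q where q: "q \<in> W" "\<not> coeffs_in q" "\<And>F. F \<in> W \<Longrightarrow> \<not> coeffs_in F \<Longrightarrow> degree q \<le> degree F"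
    using ex_has_least_nat[of "\<lambda>F. F \<in> W \<and> \<not> coeffs_in F" G degree] G by blast
  have qA: "q \<in> polys_over A" using ideal_sub[OF W(1) q(1)] .
  have "[:lead_coeff q:] \<notin> Q"
  proof
    assume lc: "[:lead_coeff q:] \<in> Q"
    define M where "M = monom (lead_coeff q) (degree q)"
    have M: "M \<in> polys_over A" unfolding M_def
      using qA by (intro polys_over_monom A) (rule polys_over_coeff)
    have sM: "coeffs_in M" using lc prime_on_0[OF Q] by (auto simp: coeffs_in_def M_def)
    have MW: "M \<in> W" using coeffs_in_mem[OF M sM] M W by auto
    have d: "q - M \<in> W" using ideal_diff[OF subring_polys_over[OF A] W(1) q(1) MW] .
    have ns: "\<not> coeffs_in (q - M)"
      using coeffs_in_add[OF polys_over_diff[OF A qA M] M _ sM] q(2) by auto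
    have "degree q \<noteq> 0"
    proof
      assume "degree q = 0"
      hence "q = M" by (auto simp: M_def elim!: degree_eq_zeroE simp: monom_0)
      thus False using ns coeffs_in_0 by simp
    qed
    hence "degree (q - M) < degree q"
      using degree_diff_less_bound[of q "degree q - 1" M] by (auto simp: M_def degree_monom_le)
    thus False using q(3)[OF d ns] by simp
  qed
  thus ?thesis using that q by blast
qed

text \<open>Fractions are avoided by multiplying with the leading coefficient of \<open>q\<close>.
  The intermediate remainders stay in \<open>W\<close>, so by the minimal degree of \<open>q\<close>
  the division can always continue until all coefficients lie in the contraction of
  \<open>Q\<close>.\<close>

lemma pseudo_division:
  assumes W: "ideal_of (polys_over A) W" and q: "q \<in> W"
    "\<And>F. F \<in> W \<Longrightarrow> \<not> coeffs_in F \<Longrightarrow> degree q \<le> degree F" and G: "G \<in> W"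
  shows "\<exists>N D R. smult (lead_coeff q ^ N) G = q * D + R \<and> D \<in> polys_over A \<and> R \<in> polys_over A \<and>
           coeffs_in R \<and> degree D \<le> degree G - degree q"
  using G
\<comment> \<open>The number of coefficients, unlike the degree, also drops from a nonzero constant
  to 0.\<close>
proof (induction "length (coeffs G)" arbitrary: G rule: less_induct)
  case less
  define c where "c = lead_coeff q"
  have qA: "q \<in> polys_over A" and GA: "G \<in> polys_over A" using ideal_sub[OF W] q(1) less.prems by auto
  hence cA: "c \<in> A" "lead_coeff G \<in> A" unfolding c_def by (auto intro: polys_over_coeff)
  show ?case
  proof (cases "coeffs_in G")
    case True
    have "smult (lead_coeff q ^ 0) G = q * 0 + G" by simp
    thus ?thesis using True GA polys_over_0[OF A] by (metis degree_0 zero_le)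
  next
    case False
    hence dq: "degree q \<le> degree G" using q(2) less.prems by blast
    define e where "e = degree G - degree q"
    define M where "M = monom (lead_coeff G) e"
    define H where "H = smult c G - M * q"
    have MA: "M \<in> polys_over A" unfolding M_def by (intro polys_over_monom A cA)
    have HW: "H \<in> W"
    proof -
      have "[:c:] * G \<in> W" "M * q \<in> W"
        using ideal_mult[OF W] const_over[OF cA(1)] MA less.prems q(1) by blast+
      thus ?thesis using ideal_diff[OF subring_polys_over[OF A] W] by (simp add: H_def)
    qed
    have Gn: "G \<noteq> 0" using False coeffs_in_0 by auto
    have Mq: "degree (M * q) \<le> degree G"
      using degree_mult_le[of M q] degree_monom_le[of "lead_coeff G" e] dq
      unfolding M_def e_def by linarith
    have top: "coeff H (degree G) = 0"
    proof -
      have "coeff (M * q) (degree G) = lead_coeff G * c"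
        using dq coeff_monom_mult[of "lead_coeff G" e q "degree q"] coeff_monom_mult[of "lead_coeff G" e q "degree G"]
        by (auto simp: M_def c_def e_def)
      thus ?thesis by (simp add: H_def mult.commute)
    qed
    have Hle: "degree H \<le> degree G" unfolding H_def
      using degree_diff_le_max[of "smult c G" "M * q"] degree_smult_le[of c G] Mq by linarith
    have "length (coeffs H) < length (coeffs G)"
    proof (cases "H = 0")
      case True
      thus ?thesis using Gn by (simp add: length_coeffs_degree)
    next
      case False
      hence "degree H \<noteq> degree G" using top by (metis leading_coeff_0_iff)
      thus ?thesis using False Gn Hle by (simp add: length_coeffs_degree)
    qed
    then obtain N D R where IH: "smult (c ^ N) H = q * D + R" "D \<in> polys_over A" "R \<in> polys_over A"
        "coeffs_in R" "degree D \<le> degree H - degree q"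
      using less.hyps[OF _ HW] unfolding c_def by blast
    have "smult (c ^ Suc N) G = smult (c ^ N) (H + M * q)"
      by (simp add: H_def mult.commute)
    also have "\<dots> = q * (D + smult (c ^ N) M) + R"
      using IH(1) by (simp add: smult_add_right algebra_simps)
    finally have "smult (c ^ Suc N) G = q * (D + smult (c ^ N) M) + R" .
    moreover have "D + smult (c ^ N) M \<in> polys_over A"
      by (intro polys_over_intros A IH MA subring_power cA)
    moreover have "degree (D + smult (c ^ N) M) \<le> degree G - degree q"
    proof (rule degree_add_le)
      show "degree D \<le> degree G - degree q" using IH(5) Hle by linarith
      show "degree (smult (c ^ N) M) \<le> degree G - degree q"
        using degree_smult_le[of "c ^ N" M] degree_monom_le[of "lead_coeff G" e]
        by (simp add: M_def e_def)
    qed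
    ultimately show ?thesis using IH unfolding c_def by blast
  qed
qed

text \<open>The element adjoined to \<open>A\<close> is the class of the variable modulo
  \<open>Q\<close>. If it is transcendental, \<open>\<xi>\<close> only has to avoid the roots of the
  image of \<open>v\<close>. If it is algebraic, \<open>\<xi>\<close> has to be a root of its
  minimal polynomial \<open>q\<close> at which \<open>v\<close> does not vanish. This is ensured by
  an equation \<open>c = v * b\<close> modulo \<open>Q\<close> with a constant \<open>c\<close>
  outside \<open>Q\<close>, which exists because nonzero elements of a finite field extension are
  invertible.\<close>

lemma hom_extension_poly:
  assumes v: "v \<in> polys_over A" "v \<notin> Q"
  shows "\<exists>u\<in>A. [:u:] \<notin> Q \<and> (\<forall>\<phi>::'r \<Rightarrow> 'k::alg_closed_field.
           hom_on A \<phi> \<and> (\<forall>a\<in>A. [:a:] \<in> Q \<longrightarrow> \<phi> a = 0) \<and> \<phi> u \<noteq> 0 \<longrightarrow>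
           (\<exists>\<xi>. (\<forall>F\<in>Q \<inter> polys_over A. poly (map_poly \<phi> F) \<xi> = 0) \<and> poly (map_poly \<phi> v) \<xi> \<noteq> 0))"
proof (cases "\<forall>F\<in>Q \<inter> polys_over A. coeffs_in F")
  case True
  \<comment> \<open>\<open>u\<close> will be this coefficient: if \<open>\<phi>\<close> does not
    kill it, the image of \<open>v\<close> is a nonzero polynomial.\<close>
  obtain i where i: "[:coeff v i:] \<notin> Q" using coeffs_in_mem v by (auto simp: coeffs_in_def)
  show ?thesis
  proof (intro bexI[of _ "coeff v i"] conjI allI impI)
    fix \<phi> :: "'r \<Rightarrow> 'k"
    assume *: "hom_on A \<phi> \<and> (\<forall>a\<in>A. [:a:] \<in> Q \<longrightarrow> \<phi> a = 0) \<and> \<phi> (coeff v i) \<noteq> 0"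
    hence hom: "hom_on A \<phi>" by blast
    have "map_poly \<phi> v \<noteq> 0" using * hom_coeff[OF A hom, of v i] by auto
    hence "finite {x. poly (map_poly \<phi> v) x = 0}" by (rule poly_roots_finite)
    then obtain \<xi> where "poly (map_poly \<phi> v) \<xi> \<noteq> 0"
      using ex_new_if_finite[OF infinite_alg_closed] by blast
    moreover have "map_poly \<phi> F = 0" if "F \<in> Q \<inter> polys_over A" for F
      using True that * by (intro poly_eqI) (auto simp: hom_coeff[OF A hom] coeffs_in_def polys_over_coeff)
    ultimately show "\<exists>\<xi>. (\<forall>F\<in>Q \<inter> polys_over A. poly (map_poly \<phi> F) \<xi> = 0) \<and> poly (map_poly \<phi> v) \<xi> \<noteq> 0"
      by (intro exI[of _ \<xi>]) auto
  qed (use i v polys_over_coeff in auto)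
next
  case False
  have PA: "subring_set (polys_over A)" by (rule subring_polys_over[OF A])
  define Q' where "Q' = Q \<inter> polys_over A"
  have idQ: "ideal_of (polys_over A) Q'"
    unfolding ideal_of_def Q'_def using prime_on_0[OF Q] prime_on_add[OF Q] prime_on_mult[OF Q]
    by (auto intro: polys_over_intros A)
  obtain G where G: "G \<in> Q'" "\<not> coeffs_in G" using False unfolding Q'_def by blast
  obtain q where q: "q \<in> Q'" "[:lead_coeff q:] \<notin> Q"
      "\<And>F. F \<in> Q' \<Longrightarrow> \<not> coeffs_in F \<Longrightarrow> degree q \<le> degree F"
    using minimal_lead_coeff[OF idQ _ G] unfolding Q'_def by (metis order_refl)
  have qA: "q \<in> polys_over A" "q \<in> Q" using q(1) by (auto simp: Q'_def)
  have dq: "degree q > 0"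
  proof (rule ccontr)
    assume "\<not> degree q > 0"
    hence "q = [:lead_coeff q:]" by (auto elim!: degree_eq_zeroE)
    thus False using q qA by metis
  qed
  \<comment> \<open>The ideal generated by \<open>v\<close> and \<open>Q\<close>. Its element
    \<open>F0\<close> of least degree turns out to be the constant \<open>c\<close>, since modulo
    the contraction of \<open>Q\<close> it divides \<open>v\<close> and \<open>q\<close> up to
    powers of \<open>c\<close>.\<close>
  define W where "W = {F \<in> polys_over A. \<exists>b\<in>polys_over A. F - v * b \<in> Q}"
  have idW: "ideal_of (polys_over A) W"
    unfolding ideal_of_def
  proof (intro conjI ballI)
    show "W \<subseteq> polys_over A" unfolding W_def by blast
    show "0 \<in> W" unfolding W_def using prime_on_0[OF Q] polys_over_0[OF A] by force
  next
    fix F G assume "F \<in> W" "G \<in> W"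
    then obtain b c where *: "F \<in> polys_over A" "G \<in> polys_over A" "b \<in> polys_over A" "c \<in> polys_over A"
        "F - v * b \<in> Q" "G - v * c \<in> Q" unfolding W_def by blast
    have "(F - v * b) + (G - v * c) \<in> Q"
      using * v by (intro prime_on_add[OF Q]) (auto intro!: polys_over_intros A)
    hence "F + G - v * (b + c) \<in> Q" by (simp add: algebra_simps)
    thus "F + G \<in> W" unfolding W_def using * by (auto intro!: polys_over_intros A bexI[of _ "b + c"])
  next
    fix r F assume r: "r \<in> polys_over A" and "F \<in> W"
    then obtain b where *: "F \<in> polys_over A" "b \<in> polys_over A" "F - v * b \<in> Q" unfolding W_def by blast
    have "r * (F - v * b) \<in> Q"
      using * v r by (intro prime_on_mult[OF Q]) (auto intro!: polys_over_intros A)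
    hence "r * F - v * (r * b) \<in> Q" by (simp add: algebra_simps)
    thus "r * F \<in> W" unfolding W_def using * r by (auto intro!: polys_over_intros A bexI[of _ "r * b"])
  qed
  have QW: "Q \<inter> polys_over A \<subseteq> W" unfolding W_def using polys_over_0[OF A] by force
  have vW: "v \<in> W" unfolding W_def using v polys_over_1[OF A] prime_on_0[OF Q] by force
  have "\<not> coeffs_in q" using q(2) by (auto simp: coeffs_in_def)
  obtain F0 where F0: "F0 \<in> W" "[:lead_coeff F0:] \<notin> Q"
      "\<And>F. F \<in> W \<Longrightarrow> \<not> coeffs_in F \<Longrightarrow> degree F0 \<le> degree F"
    using minimal_lead_coeff[OF idW QW _ \<open>\<not> coeffs_in q\<close>] qA QW by (metis IntI subsetD)
  have F0A: "F0 \<in> polys_over A" using ideal_sub[OF idW F0(1)] .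
  define c where "c = lead_coeff F0"
  have cA: "c \<in> A" unfolding c_def using F0A by (rule polys_over_coeff)
  have cN: "[:c ^ N:] \<notin> Q" for N
    using prime_on_power[OF PA Q const_over[OF cA], of N] F0(2) by (auto simp: c_def poly_const_pow)
  have F0Q: "F0 \<notin> Q"
  proof
    assume F: "F0 \<in> Q"
    obtain N D R where *: "smult (c ^ N) v = F0 * D + R" "D \<in> polys_over A" "R \<in> polys_over A" "coeffs_in R"
      using pseudo_division[OF idW F0(1,3) vW] unfolding c_def by blast
    have "D * F0 + R \<in> Q"
      using * F F0A by (intro prime_on_add[OF Q] prime_on_mult[OF Q]) (auto intro: polys_over_intros A coeffs_in_mem)
    hence "[:c ^ N:] * v \<in> Q" using * by (simp add: mult.commute)
    thus False using prime_onD[OF Q const_over[OF subring_power[OF A cA]] v(1)] cN v by blast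
  qed
  have "degree F0 = 0"
  proof (rule ccontr)
    assume d0: "degree F0 \<noteq> 0"
    obtain N D R where *: "smult (c ^ N) q = F0 * D + R" "D \<in> polys_over A" "R \<in> polys_over A" "coeffs_in R"
        "degree D \<le> degree q - degree F0"
      using pseudo_division[OF idW F0(1,3), of q] qA QW unfolding c_def by blast
    have "[:c ^ N:] * q - R \<in> Q"
      using * qA cA F0A by (intro prime_on_diff[OF PA Q] prime_on_mult[OF Q])
        (auto intro: polys_over_intros A coeffs_in_mem subring_power const_over)
    hence "F0 * D \<in> Q" using *(1) by simp
    hence DQ: "D \<in> Q'" using prime_onD[OF Q F0A *(2)] F0Q *(2) by (auto simp: Q'_def)
    \<comment> \<open>\<open>D\<close> lies in \<open>Q\<close> and has smaller degree than
      \<open>q\<close>, so its coefficients lie in the contraction; then so would those of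
      \<open>c ^ N\<close> times \<open>q\<close>, against the leading coefficient of
      \<open>q\<close>.\<close>
    have "coeffs_in D" using q(3)[OF DQ] *(5) d0 dq by fastforce
    hence "coeffs_in (F0 * D + R)"
      using * F0A by (intro coeffs_in_add coeffs_in_mult) (auto intro: polys_over_intros A)
    hence "[:coeff (smult (c ^ N) q) (degree q):] \<in> Q" using * by (auto simp: coeffs_in_def)
    hence "[:c ^ N:] * [:lead_coeff q:] \<in> Q" by (simp add: mult.commute)
    thus False using prime_onD[OF Q const_over const_over] cN q(2) cA qA
      by (metis polys_over_coeff subring_power A)
  qed
  hence F0c: "F0 = [:c:]" unfolding c_def by (auto elim!: degree_eq_zeroE)
  obtain b where b: "b \<in> polys_over A" "F0 - v * b \<in> Q" using F0(1) unfolding W_def by blast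
  define l where "l = lead_coeff q"
  have lA: "l \<in> A" unfolding l_def using qA(1) by (rule polys_over_coeff)
  show ?thesis
  \<comment> \<open>\<open>\<phi> l \<noteq> 0\<close> keeps the degree of the image of
    \<open>q\<close> positive, so that a root \<open>\<xi>\<close> exists;
    \<open>\<phi> c \<noteq> 0\<close> keeps the image of \<open>v\<close> nonzero at this
    root.\<close>
  proof (intro bexI[of _ "l * c"] conjI allI impI)
    show "[:l * c:] \<notin> Q"
      using prime_onD[OF Q const_over[OF lA] const_over[OF cA]] q(2) F0(2)
      by (auto simp: l_def c_def mult.commute)
    fix \<phi> :: "'r \<Rightarrow> 'k"
    assume *: "hom_on A \<phi> \<and> (\<forall>a\<in>A. [:a:] \<in> Q \<longrightarrow> \<phi> a = 0) \<and> \<phi> (l * c) \<noteq> 0"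
    hence hom: "hom_on A \<phi>" by blast
    have ph: "\<phi> l \<noteq> 0" "\<phi> c \<noteq> 0" using * hom_on_mult[OF hom lA cA] by auto
    have "degree (map_poly \<phi> q) > 0"
      using dq le_degree[of "map_poly \<phi> q" "degree q"] ph by (auto simp: hom_coeff[OF A hom] l_def)
    then obtain \<xi> where \<xi>: "poly (map_poly \<phi> q) \<xi> = 0" using alg_closed_imp_poly_has_root by blast
    have kill: "poly (map_poly \<phi> F) \<xi> = 0" if F: "F \<in> Q \<inter> polys_over A" for F
    proof -
      obtain N D R where d: "smult (l ^ N) F = q * D + R" "D \<in> polys_over A" "R \<in> polys_over A" "coeffs_in R"
        using pseudo_division[OF idQ q(1,3), of F] F unfolding Q'_def l_def by blast
      have "map_poly \<phi> R = 0"
        using d * by (intro poly_eqI) (auto simp: hom_coeff[OF A hom] coeffs_in_def polys_over_coeff)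
      hence "smult (\<phi> (l ^ N)) (map_poly \<phi> F) = map_poly \<phi> q * map_poly \<phi> D"
        using map_poly_hom_smult[OF A hom subring_power[OF A lA, of N], of F] d qA F
        by (simp add: map_poly_hom_add[OF A hom] map_poly_hom_mult[OF A hom] polys_over_intros A)
      hence "\<phi> l ^ N * poly (map_poly \<phi> F) \<xi> = 0"
        using \<xi> by (metis hom_on_power[OF A hom lA] mult_zero_left poly_mult poly_smult)
      thus ?thesis using ph by simp
    qed
    have "poly (map_poly \<phi> (F0 - v * b)) \<xi> = 0"
      using b v F0A by (intro kill) (auto intro: polys_over_intros A)
    hence "\<phi> c = poly (map_poly \<phi> v) \<xi> * poly (map_poly \<phi> b) \<xi>"
      using b v F0A map_poly_hom_const[OF A hom, of c]
      by (simp add: map_poly_hom_diff[OF A hom] map_poly_hom_mult[OF A hom] polys_over_intros A F0c)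
    thus "\<exists>\<xi>. (\<forall>F\<in>Q \<inter> polys_over A. poly (map_poly \<phi> F) \<xi> = 0) \<and> poly (map_poly \<phi> v) \<xi> \<noteq> 0"
      using kill ph by (intro exI[of _ \<xi>]) auto
  qed (use lA cA subring_mult[OF A] in auto)
qed

end

text \<open>The preimage \<open>Q\<close> of \<open>P\<close> under evaluation at \<open>t\<close>
  reduces this to polynomials. The extension \<open>\<psi>\<close> evaluates at
  \<open>\<xi>\<close>; it is well defined because two representatives of an element differ by a
  member of \<open>Q\<close>, whose image vanishes at \<open>\<xi>\<close>.\<close>

lemma hom_extension_adjoin:
  assumes A: "subring_set A" and P: "prime_on (adjoin A t) P" and v: "v \<in> adjoin A t" "v \<notin> P"
  shows "\<exists>u\<in>A. u \<notin> P \<and> (\<forall>\<phi>::'r::comm_ring_1 \<Rightarrow> 'k::alg_closed_field.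
           hom_on A \<phi> \<and> (\<forall>a\<in>A \<inter> P. \<phi> a = 0) \<and> \<phi> u \<noteq> 0 \<longrightarrow>
           (\<exists>\<psi>. hom_on (adjoin A t) \<psi> \<and> (\<forall>a\<in>A. \<psi> a = \<phi> a) \<and> (\<forall>a\<in>adjoin A t \<inter> P. \<psi> a = 0) \<and> \<psi> v \<noteq> 0))"
proof -
  define Q where "Q = {p \<in> polys_over A. poly p t \<in> P}"
  have Q: "prime_on (polys_over A) Q"
    unfolding prime_on_def Q_def
    using prime_on_1[OF P] prime_on_0[OF P] prime_on_add[OF P adjoinI adjoinI]
      prime_on_mult[OF P adjoinI adjoinI] prime_onD[OF P adjoinI adjoinI]
    by (auto simp: polys_over_intros A)
  obtain p where p: "p \<in> polys_over A" "v = poly p t" using v by (auto simp: adjoin_def)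
  have cQ: "[:a:] \<in> Q \<longleftrightarrow> a \<in> P" if "a \<in> A" for a
    using that by (auto simp: Q_def polys_over_intros A)
  obtain u where u: "u \<in> A" "[:u:] \<notin> Q" and ext: "\<And>\<phi>::'r \<Rightarrow> 'k. hom_on A \<phi> \<Longrightarrow>
      (\<forall>a\<in>A. [:a:] \<in> Q \<longrightarrow> \<phi> a = 0) \<Longrightarrow> \<phi> u \<noteq> 0 \<Longrightarrow>
      \<exists>\<xi>. (\<forall>F\<in>Q \<inter> polys_over A. poly (map_poly \<phi> F) \<xi> = 0) \<and> poly (map_poly \<phi> p) \<xi> \<noteq> 0"
    using hom_extension_poly[OF A Q p(1)] p v unfolding Q_def by blast
  show ?thesis
  proof (intro bexI[of _ u] conjI allI impI)
    show "u \<notin> P" using u cQ by blast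
    fix \<phi> :: "'r \<Rightarrow> 'k"
    assume *: "hom_on A \<phi> \<and> (\<forall>a\<in>A \<inter> P. \<phi> a = 0) \<and> \<phi> u \<noteq> 0"
    hence hom: "hom_on A \<phi>" by blast
    obtain \<xi> where \<xi>: "\<And>F. F \<in> Q \<Longrightarrow> poly (map_poly \<phi> F) \<xi> = 0" "poly (map_poly \<phi> p) \<xi> \<noteq> 0"
      using ext[of \<phi>] * cQ unfolding Q_def by blast
    define rep where "rep b = (SOME q. q \<in> polys_over A \<and> poly q t = b)" for b
    define \<psi> where "\<psi> b = poly (map_poly \<phi> (rep b)) \<xi>" for b
    have \<psi>: "\<psi> (poly q t) = poly (map_poly \<phi> q) \<xi>" if q: "q \<in> polys_over A" for q
    proof -
      have r: "rep (poly q t) \<in> polys_over A \<and> poly (rep (poly q t)) t = poly q t"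
        unfolding rep_def by (rule someI[of _ q]) (use q in auto)
      hence "rep (poly q t) - q \<in> Q"
        using q prime_on_0[OF P] by (auto simp: Q_def polys_over_intros A)
      from \<xi>(1)[OF this] show ?thesis
        using r q by (simp add: \<psi>_def map_poly_hom_diff[OF A hom])
    qed
    have "hom_on (adjoin A t) \<psi>"
      unfolding hom_on_def
    proof (intro conjI ballI)
      show "\<psi> 1 = 1" using \<psi>[OF polys_over_1[OF A]] map_poly_hom_const[OF A hom, of 1] hom_on_1[OF hom]
        by (simp add: one_pCons)
      fix a b assume "a \<in> adjoin A t" "b \<in> adjoin A t"
      then obtain q r where qr: "q \<in> polys_over A" "r \<in> polys_over A" "a = poly q t" "b = poly r t"
        by (auto simp: adjoin_def)
      show "\<psi> (a - b) = \<psi> a - \<psi> b"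
        using \<psi>[OF polys_over_diff[OF A qr(1,2)]] qr \<psi>
        by (simp add: map_poly_hom_diff[OF A hom])
      show "\<psi> (a * b) = \<psi> a * \<psi> b"
        using \<psi>[OF polys_over_mult[OF A qr(1,2)]] qr \<psi>
        by (simp add: map_poly_hom_mult[OF A hom])
    qed
    moreover have "\<psi> a = \<phi> a" if "a \<in> A" for a
      using \<psi>[of "[:a:]"] that by (simp add: polys_over_intros A map_poly_hom_const[OF A hom])
    moreover have "\<psi> a = 0" if "a \<in> adjoin A t \<inter> P" for a
      using that \<psi> \<xi>(1) by (auto simp: adjoin_def Q_def)
    moreover have "\<psi> v \<noteq> 0" using \<psi>[OF p(1)] \<xi>(2) p by simp
    ultimately show "\<exists>\<psi>. hom_on (adjoin A t) \<psi> \<and> (\<forall>a\<in>A. \<psi> a = \<phi> a) \<and>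
        (\<forall>a\<in>adjoin A t \<inter> P. \<psi> a = 0) \<and> \<psi> v \<noteq> 0" by blast
  qed (use u in auto)
qed

text \<open>Common source of the Nullstellensatz (with the constants as \<open>A\<close>) and of the
  theorem that images contain open sets (with the functions pulled back from the target as
  \<open>A\<close>). Descending from \<open>v\<close> through the generators produces
  \<open>u\<close>; ascending from \<open>\<phi>\<close> in the opposite order produces the
  extension.\<close>

theorem hom_extension:
  assumes A: "subring_set A" and P: "prime_on (adjoins A ts) P" and v: "v \<in> adjoins A ts" "v \<notin> P"
  shows "\<exists>u\<in>A. u \<notin> P \<and> (\<forall>\<phi>::'r::comm_ring_1 \<Rightarrow> 'k::alg_closed_field.
           hom_on A \<phi> \<and> (\<forall>a\<in>A \<inter> P. \<phi> a = 0) \<and> \<phi> u \<noteq> 0 \<longrightarrow>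
           (\<exists>\<psi>. hom_on (adjoins A ts) \<psi> \<and> (\<forall>a\<in>A. \<psi> a = \<phi> a) \<and> (\<forall>a\<in>adjoins A ts \<inter> P. \<psi> a = 0)
             \<and> \<psi> v \<noteq> 0))"
  using P v
proof (induction ts arbitrary: v rule: rev_induct)
  case Nil
  thus ?case by (intro bexI[of _ v]) auto
next
  case (snoc t ts)
  let ?B = "adjoins A ts"
  have B: "subring_set ?B" by (rule subring_adjoins[OF A])
  have sub: "?B \<subseteq> adjoin ?B t" "A \<subseteq> ?B" using adjoin_superset[OF B] adjoins_superset[OF A] by auto
  obtain w where w: "w \<in> ?B" "w \<notin> P" and w_ext: "\<And>\<phi>::'r \<Rightarrow> 'k. hom_on ?B \<phi> \<Longrightarrow> (\<forall>a\<in>?B \<inter> P. \<phi> a = 0) \<Longrightarrow>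
      \<phi> w \<noteq> 0 \<Longrightarrow> \<exists>\<psi>. hom_on (adjoin ?B t) \<psi> \<and> (\<forall>a\<in>?B. \<psi> a = \<phi> a) \<and>
        (\<forall>a\<in>adjoin ?B t \<inter> P. \<psi> a = 0) \<and> \<psi> v \<noteq> 0"
    using hom_extension_adjoin[OF B, of t P v] snoc.prems by auto
  have "prime_on ?B P" using prime_on_mono[OF snoc.prems(1)] sub by auto
  from snoc.IH[OF this w] obtain u where u: "u \<in> A" "u \<notin> P" and u_ext: "\<And>\<phi>::'r \<Rightarrow> 'k. hom_on A \<phi> \<Longrightarrow>
      (\<forall>a\<in>A \<inter> P. \<phi> a = 0) \<Longrightarrow> \<phi> u \<noteq> 0 \<Longrightarrow> \<exists>\<psi>. hom_on ?B \<psi> \<and> (\<forall>a\<in>A. \<psi> a = \<phi> a) \<and>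
        (\<forall>a\<in>?B \<inter> P. \<psi> a = 0) \<and> \<psi> w \<noteq> 0" by blast
  show ?case
  proof (intro bexI[of _ u] conjI allI impI u)
    fix \<phi> :: "'r \<Rightarrow> 'k"
    assume *: "hom_on A \<phi> \<and> (\<forall>a\<in>A \<inter> P. \<phi> a = 0) \<and> \<phi> u \<noteq> 0"
    then obtain \<psi>1 where 1: "hom_on ?B \<psi>1" "\<forall>a\<in>A. \<psi>1 a = \<phi> a" "\<forall>a\<in>?B \<inter> P. \<psi>1 a = 0" "\<psi>1 w \<noteq> 0"
      using u_ext by blast
    from w_ext[OF 1(1,3,4)] obtain \<psi> where 2: "hom_on (adjoin ?B t) \<psi>" "\<forall>a\<in>?B. \<psi> a = \<psi>1 a"
        "\<forall>a\<in>adjoin ?B t \<inter> P. \<psi> a = 0" "\<psi> v \<noteq> 0" by blast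
    show "\<exists>\<psi>. hom_on (adjoins A (ts @ [t])) \<psi> \<and> (\<forall>a\<in>A. \<psi> a = \<phi> a) \<and>
        (\<forall>a\<in>adjoins A (ts @ [t]) \<inter> P. \<psi> a = 0) \<and> \<psi> v \<noteq> 0"
      using 1 2 sub by (intro exI[of _ \<psi>]) auto
  qed
qed

section \<open>Zariski topology on affine space\<close>

lemma power_fun_apply [simp]: "(f ^ n) p = f p ^ n" for f :: "'a \<Rightarrow> 'b::comm_semiring_1"
  by (induction n) auto

lemma sum_fun_apply: "(\<Sum>i\<in>S. f i) p = (\<Sum>i\<in>S. f i p)" for f :: "'c \<Rightarrow> 'a \<Rightarrow> 'b::comm_semiring_1"
  by (induction S rule: infinite_finite_induct) auto

lemma uminus_fun_apply [simp]: "(- f) p = - f p" for f :: "'a \<Rightarrow> 'b::comm_ring_1"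
  by (simp add: fun_Compl_def)

lemma minus_fun_apply [simp]: "(f - g) p = f p - g p" for f :: "'a \<Rightarrow> 'b::comm_ring_1"
  by (simp add: fun_diff_def)

lemma polyfun_uminus: "f \<in> polyfun \<Longrightarrow> (\<lambda>p. - f p) \<in> polyfun"
  using pf_mult[OF pf_const[of "- 1"], of f] by simp

lemma polyfun_diff: "f \<in> polyfun \<Longrightarrow> g \<in> polyfun \<Longrightarrow> (\<lambda>p. f p - g p) \<in> polyfun"
  using pf_add[OF _ polyfun_uminus, of f g] by simp

lemma polyfun_power: "f \<in> polyfun \<Longrightarrow> (\<lambda>p. f p ^ n) \<in> polyfun"
  by (induction n) (auto intro: pf_const pf_mult)

lemma polyfun_sum: "(\<And>i. i \<in> S \<Longrightarrow> f i \<in> polyfun) \<Longrightarrow> (\<lambda>p. \<Sum>i\<in>S. f i p) \<in> polyfun"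
  by (induction S rule: infinite_finite_induct) (auto intro: pf_const pf_add)

lemma polyfun_prod: "(\<And>i. i \<in> S \<Longrightarrow> f i \<in> polyfun) \<Longrightarrow> (\<lambda>p. \<Prod>i\<in>S. f i p) \<in> polyfun"
  by (induction S rule: infinite_finite_induct) (auto intro: pf_const pf_mult)

lemmas polyfun_intros = pf_const pf_coord pf_add pf_mult polyfun_uminus polyfun_diff
  polyfun_power polyfun_sum polyfun_prod

lemma subring_polyfun: "subring_set polyfun"
  unfolding subring_set_def one_fun_def times_fun_def fun_diff_def
  by (auto intro: polyfun_intros)

definition polymap :: "(('i \<Rightarrow> 'k::comm_ring_1) \<Rightarrow> ('j \<Rightarrow> 'k)) \<Rightarrow> bool" where
  "polymap \<phi> \<longleftrightarrow> (\<forall>j. (\<lambda>p. \<phi> p j) \<in> polyfun)"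

lemma polyfun_subst:
  assumes "polymap \<phi>" "f \<in> polyfun"
  shows "(\<lambda>p. f (\<phi> p)) \<in> polyfun"
  using assms(2) by induction (use assms(1) in \<open>auto simp: polymap_def intro: polyfun_intros\<close>)

lemma subring_pullback: "subring_set ((\<lambda>g p. g (\<phi> p)) ` polyfun)"
  unfolding subring_set_def
proof (intro conjI ballI)
  let ?A = "(\<lambda>g p. g (\<phi> p)) ` polyfun"
  show "1 \<in> ?A" using pf_const[of 1] by (intro image_eqI[of _ _ "\<lambda>_. 1"]) (auto simp: one_fun_def)
  fix a b assume "a \<in> ?A" "b \<in> ?A"
  then obtain f g where fg: "f \<in> polyfun" "g \<in> polyfun" "a = (\<lambda>p. f (\<phi> p))" "b = (\<lambda>p. g (\<phi> p))" by blast
  show "a - b \<in> ?A"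
    using polyfun_diff[OF fg(1,2)] by (intro image_eqI[of _ _ "\<lambda>p. f p - g p"]) (auto simp: fg)
  show "a * b \<in> ?A"
    using pf_mult[OF fg(1,2)] by (intro image_eqI[of _ _ "\<lambda>p. f p * g p"]) (auto simp: fg)
qed

definition vanish :: "('i \<Rightarrow> 'k::comm_ring_1) set \<Rightarrow> (('i \<Rightarrow> 'k) \<Rightarrow> 'k) set" where
  "vanish S = {f \<in> polyfun. \<forall>p\<in>S. f p = 0}"

lemma ideal_vanish: "ideal_of polyfun (vanish S)"
  unfolding ideal_of_def vanish_def times_fun_def plus_fun_def zero_fun_def
  by (auto intro: polyfun_intros)

lemma vanish_antimono: "S \<subseteq> T \<Longrightarrow> vanish T \<subseteq> vanish S"
  by (auto simp: vanish_def)

lemma zclosure_eq: "zclosure S = {p. \<forall>f\<in>vanish S. f p = 0}"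
proof
  have "zclosed {p. \<forall>f\<in>vanish S. f p = 0}" "S \<subseteq> {p. \<forall>f\<in>vanish S. f p = 0}"
    unfolding zclosed_def by (auto simp: vanish_def intro!: exI[of _ "vanish S"])
  thus "zclosure S \<subseteq> {p. \<forall>f\<in>vanish S. f p = 0}" unfolding zclosure_def by blast
  show "{p. \<forall>f\<in>vanish S. f p = 0} \<subseteq> zclosure S"
    unfolding zclosure_def zclosed_def vanish_def by blast
qed

lemma zclosed_zclosure: "zclosed (zclosure S)"
  unfolding zclosure_eq zclosed_def by (auto simp: vanish_def intro!: exI[of _ "vanish S"])

lemma zclosure_superset: "S \<subseteq> zclosure S"
  by (auto simp: zclosure_def)

lemma zclosure_minimal: "S \<subseteq> C \<Longrightarrow> zclosed C \<Longrightarrow> zclosure S \<subseteq> C"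
  by (auto simp: zclosure_def)

lemma zclosure_closed: "zclosed C \<Longrightarrow> zclosure C = C"
  using zclosure_minimal[of C C] zclosure_superset[of C] by auto

lemma zclosure_mono: "S \<subseteq> T \<Longrightarrow> zclosure S \<subseteq> zclosure T"
  using zclosure_minimal[OF _ zclosed_zclosure] zclosure_superset by blast

lemma zclosureD: "p \<in> zclosure S \<Longrightarrow> f \<in> polyfun \<Longrightarrow> (\<And>q. q \<in> S \<Longrightarrow> f q = 0) \<Longrightarrow> f p = 0"
  by (auto simp: zclosure_eq vanish_def)

lemma zclosureI: "(\<And>f. f \<in> polyfun \<Longrightarrow> (\<And>q. q \<in> S \<Longrightarrow> f q = 0) \<Longrightarrow> f p = 0) \<Longrightarrow> p \<in> zclosure S"
  by (auto simp: zclosure_eq vanish_def)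

lemma zclosed_eq_zeros: "zclosed C \<Longrightarrow> C = {p. \<forall>f\<in>vanish C. f p = 0}"
  using zclosure_closed[of C] by (simp add: zclosure_eq)

lemma zclosed_separate:
  assumes "zclosed C" "p \<notin> C"
  obtains f where "f \<in> polyfun" "\<And>q. q \<in> C \<Longrightarrow> f q = 0" "f p \<noteq> 0"
  using zclosed_eq_zeros[OF assms(1)] assms(2) that unfolding vanish_def by blast

lemma zclosed_zeros: "(\<And>f. f \<in> F \<Longrightarrow> f \<in> polyfun) \<Longrightarrow> zclosed {p. \<forall>f\<in>F. f p = 0}"
  unfolding zclosed_def by blast

lemma zclosed_zero: "f \<in> polyfun \<Longrightarrow> zclosed {p. f p = 0}"
  using zclosed_zeros[of "{f}"] by simp

lemma zclosed_empty: "zclosed ({} :: ('i \<Rightarrow> 'k::comm_ring_1) set)"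
  using zclosed_zeros[of "{\<lambda>_. 1} :: (('i \<Rightarrow> 'k) \<Rightarrow> 'k) set"] by (simp add: pf_const)

lemma zclosed_INT:
  assumes "\<And>C. C \<in> \<C> \<Longrightarrow> zclosed C"
  shows "zclosed (\<Inter>\<C>)"
proof -
  have "\<Inter>\<C> = {p. \<forall>f\<in>(\<Union>C\<in>\<C>. vanish C). f p = 0}"
    using zclosed_eq_zeros assms by blast
  thus ?thesis using zclosed_zeros[of "\<Union>C\<in>\<C>. vanish C"] by (auto simp: vanish_def)
qed

lemma zclosed_Int: "zclosed A \<Longrightarrow> zclosed B \<Longrightarrow> zclosed (A \<inter> B)"
  using zclosed_INT[of "{A, B}"] by auto

lemma zclosed_Un:
  fixes A B :: "('i \<Rightarrow> 'k::idom) set"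
  assumes "zclosed A" "zclosed B"
  shows "zclosed (A \<union> B)"
proof -
  define H where "H = (\<lambda>(f, g) p. f p * g p) ` (vanish A \<times> vanish B)"
  have H: "(\<forall>h\<in>H. h p = 0) \<longleftrightarrow> (\<forall>f\<in>vanish A. \<forall>g\<in>vanish B. f p * g p = 0)" for p
    unfolding H_def by auto
  have "p \<in> A \<union> B \<longleftrightarrow> (\<forall>f\<in>vanish A. \<forall>g\<in>vanish B. f p * g p = 0)" for p
  proof -
    have "p \<in> A \<longleftrightarrow> (\<forall>f\<in>vanish A. f p = 0)" "p \<in> B \<longleftrightarrow> (\<forall>f\<in>vanish B. f p = 0)"
      using zclosed_eq_zeros[OF assms(1)] zclosed_eq_zeros[OF assms(2)] by blast+
    thus ?thesis by (metis Un_iff mult_eq_0_iff)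
  qed
  hence "A \<union> B = {p. \<forall>h\<in>H. h p = 0}" by (auto simp: H)
  moreover have "H \<subseteq> polyfun" unfolding H_def vanish_def by (auto intro: pf_mult)
  ultimately show ?thesis using zclosed_zeros[of H] by auto
qed

lemma zclosed_UN:
  fixes C :: "'a \<Rightarrow> ('i \<Rightarrow> 'k::idom) set"
  shows "finite S \<Longrightarrow> (\<And>i. i \<in> S \<Longrightarrow> zclosed (C i)) \<Longrightarrow> zclosed (\<Union>i\<in>S. C i)"
  by (induction S rule: finite_induct) (auto simp: zclosed_empty zclosed_Un)

lemma zclosed_preimage:
  assumes "polymap \<phi>" "zclosed C"
  shows "zclosed {p. \<phi> p \<in> C}"
proof -
  have "{p. \<phi> p \<in> C} = {p. \<forall>f\<in>(\<lambda>f p. f (\<phi> p)) ` vanish C. f p = 0}"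
    using zclosed_eq_zeros[OF assms(2)] by auto
  thus ?thesis
    using zclosed_zeros[of "(\<lambda>f p. f (\<phi> p)) ` vanish C"] polyfun_subst[OF assms(1)]
    by (auto simp: vanish_def)
qed

lemma zclosure_image:
  assumes "polymap \<phi>" "p \<in> zclosure S"
  shows "\<phi> p \<in> zclosure (\<phi> ` S)"
  using assms(2) zclosureD[OF _ polyfun_subst[OF assms(1)]] by (intro zclosureI) auto

lemma zclosed_singleton: "zclosed {p :: 'i \<Rightarrow> 'k::comm_ring_1}"
proof -
  have eq: "{p} = {q. \<forall>f\<in>range (\<lambda>i q. q i - p i). f q = 0}" by (auto simp: fun_eq_iff)
  show ?thesis unfolding eq by (rule zclosed_zeros) (auto intro: polyfun_intros)
qed

lemma zclosed_in_iff: "zclosed X \<Longrightarrow> zclosed_in X Y \<longleftrightarrow> zclosed Y \<and> Y \<subseteq> X"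
  unfolding zclosed_in_def using zclosed_Int by (metis Int_absorb1 inf.cobounded1)

subsection \<open>Irreducible sets\<close>

lemma zirreducible_iff:
  fixes X :: "('i \<Rightarrow> 'k::idom) set"
  shows "zirreducible X \<longleftrightarrow> X \<noteq> {} \<and> (\<forall>f\<in>polyfun. \<forall>g\<in>polyfun. (\<forall>p\<in>X. f p * g p = 0) \<longrightarrow>
     (\<forall>p\<in>X. f p = 0) \<or> (\<forall>p\<in>X. g p = 0))" (is "?L \<longleftrightarrow> ?R")
proof
  assume L: ?L
  show ?R
  proof (intro conjI ballI impI)
    show "X \<noteq> {}" using L by (simp add: zirreducible_def)
    fix f g :: "('i \<Rightarrow> 'k) \<Rightarrow> 'k" assume fg: "f \<in> polyfun" "g \<in> polyfun" "\<forall>p\<in>X. f p * g p = 0"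
    hence "X \<subseteq> {p. f p = 0} \<union> {p. g p = 0}" by auto
    hence "X \<subseteq> {p. f p = 0} \<or> X \<subseteq> {p. g p = 0}"
      using L zclosed_zero[OF fg(1)] zclosed_zero[OF fg(2)] unfolding zirreducible_def by blast
    thus "(\<forall>p\<in>X. f p = 0) \<or> (\<forall>p\<in>X. g p = 0)" by auto
  qed
next
  assume R: ?R
  show ?L unfolding zirreducible_def
  proof (intro conjI allI impI)
    show "X \<noteq> {}" using R by simp
    fix A B :: "('i \<Rightarrow> 'k) set" assume AB: "zclosed A \<and> zclosed B \<and> X \<subseteq> A \<union> B"
    show "X \<subseteq> A \<or> X \<subseteq> B"
    proof (rule ccontr)
      assume "\<not> (X \<subseteq> A \<or> X \<subseteq> B)"
      then obtain p q where pq: "p \<in> X" "p \<notin> A" "q \<in> X" "q \<notin> B" by blast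
      obtain f where f: "f \<in> polyfun" "\<And>q. q \<in> A \<Longrightarrow> f q = 0" "f p \<noteq> 0"
        using zclosed_separate[of A p] AB pq by blast
      obtain g where g: "g \<in> polyfun" "\<And>q. q \<in> B \<Longrightarrow> g q = 0" "g q \<noteq> 0"
        using zclosed_separate[of B q] AB pq by blast
      have "\<forall>p\<in>X. f p * g p = 0" using AB f g by auto
      thus False using R f g pq by blast
    qed
  qed
qed

lemma zirreducible_nonempty: "zirreducible X \<Longrightarrow> X \<noteq> {}"
  by (simp add: zirreducible_def)

lemma zirreducibleD:
  fixes X :: "('i \<Rightarrow> 'k::idom) set"
  assumes "zirreducible X" "f \<in> polyfun" "g \<in> polyfun" "\<And>p. p \<in> X \<Longrightarrow> f p * g p = 0" "q \<in> X" "f q \<noteq> 0"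
    "p \<in> X"
  shows "g p = 0"
  using assms unfolding zirreducible_iff by blast

lemma zirreducible_common_nonzero:
  fixes X :: "('i \<Rightarrow> 'k::idom) set"
  assumes "zirreducible X" "f \<in> polyfun" "g \<in> polyfun" "\<exists>p\<in>X. f p \<noteq> 0" "\<exists>p\<in>X. g p \<noteq> 0"
  shows "\<exists>p\<in>X. f p \<noteq> 0 \<and> g p \<noteq> 0"
proof (rule ccontr)
  assume "\<not> ?thesis"
  hence "f p * g p = 0" if "p \<in> X" for p using that by auto
  thus False using zirreducibleD[OF assms(1-3)] assms(4,5) by blast
qed

lemma zirreducible_zclosure:
  fixes X :: "('i \<Rightarrow> 'k::idom) set"
  assumes "zirreducible X"
  shows "zirreducible (zclosure X)"
  unfolding zirreducible_iff
proof (intro conjI ballI impI)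
  show "zclosure X \<noteq> {}" using zirreducible_nonempty[OF assms] zclosure_superset by blast
  fix f g :: "('i \<Rightarrow> 'k) \<Rightarrow> 'k" assume "f \<in> polyfun" "g \<in> polyfun" "\<forall>p\<in>zclosure X. f p * g p = 0"
  moreover from this have "(\<forall>p\<in>X. f p = 0) \<or> (\<forall>p\<in>X. g p = 0)"
    using assms zclosure_superset[of X] unfolding zirreducible_iff by blast
  ultimately show "(\<forall>p\<in>zclosure X. f p = 0) \<or> (\<forall>p\<in>zclosure X. g p = 0)"
    using zclosureD by blast
qed

lemma zirreducible_image:
  fixes X :: "('i \<Rightarrow> 'k::idom) set" and \<phi> :: "('i \<Rightarrow> 'k) \<Rightarrow> ('j \<Rightarrow> 'k)"
  assumes "zirreducible X" "polymap \<phi>"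
  shows "zirreducible (\<phi> ` X)"
  unfolding zirreducible_iff
proof (intro conjI ballI impI)
  show "\<phi> ` X \<noteq> {}" using zirreducible_nonempty[OF assms(1)] by blast
  fix f g :: "('j \<Rightarrow> 'k) \<Rightarrow> 'k" assume *: "f \<in> polyfun" "g \<in> polyfun" "\<forall>p\<in>\<phi> ` X. f p * g p = 0"
  have "(\<forall>p\<in>X. f (\<phi> p) = 0) \<or> (\<forall>p\<in>X. g (\<phi> p) = 0)"
    using assms(1)[unfolded zirreducible_iff, THEN conjunct2, rule_format,
        OF polyfun_subst[OF assms(2) *(1)] polyfun_subst[OF assms(2) *(2)]] *(3) by auto
  thus "(\<forall>p\<in>\<phi> ` X. f p = 0) \<or> (\<forall>p\<in>\<phi> ` X. g p = 0)" by blast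
qed

lemma zirreducible_singleton: "zirreducible {p :: 'i \<Rightarrow> 'k::idom}"
  unfolding zirreducible_iff by auto

lemma prime_vanish:
  fixes X :: "('i \<Rightarrow> 'k::idom) set"
  assumes "zirreducible X"
  shows "prime_on polyfun (vanish X)"
  using ideal_vanish[of X] assms zirreducible_nonempty[OF assms]
  unfolding prime_on_def ideal_of_def zirreducible_iff by (auto simp: vanish_def)

lemma zirreducible_cover:
  fixes Z :: "('i \<Rightarrow> 'k::idom) set"
  assumes Z: "zirreducible Z" and fin: "finite S" and cl: "\<And>i. i \<in> S \<Longrightarrow> zclosed (C i)"
    and sub: "Z \<subseteq> (\<Union>i\<in>S. C i)"
  obtains i where "i \<in> S" "Z \<subseteq> C i"
proof -
  have "\<exists>i\<in>S. Z \<subseteq> C i"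
    using fin cl sub
  proof (induction S rule: finite_induct)
    case empty
    thus ?case using zirreducible_nonempty[OF Z] by auto
  next
    case (insert j S)
    have "zclosed (\<Union>i\<in>S. C i)" using insert by (intro zclosed_UN) auto
    hence "Z \<subseteq> C j \<or> Z \<subseteq> (\<Union>i\<in>S. C i)"
      using Z insert.prems unfolding zirreducible_def by auto
    thus ?case using insert by auto
  qed
  thus ?thesis using that by blast
qed

subsection \<open>Noetherianity, the Nullstellensatz and images of polynomial maps\<close>

definition coords :: "(('i::finite \<Rightarrow> 'k::comm_ring_1) \<Rightarrow> 'k) list" where
  "coords = map (\<lambda>i p. p i) (SOME xs. set xs = UNIV)"

lemma set_coords: "set coords = range (\<lambda>i p. p i)"
proof -
  obtain xs :: "'a list" where "set xs = UNIV" using finite_list[OF finite_UNIV] by blast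
  hence "set (SOME xs :: 'a list. set xs = UNIV) = UNIV" by (rule someI)
  thus ?thesis by (simp add: coords_def)
qed

lemma subring_consts: "subring_set (range (\<lambda>c _. c) :: ('a \<Rightarrow> 'k::comm_ring_1) set)"
  unfolding subring_set_def one_fun_def times_fun_def fun_diff_def by auto

lemma adjoins_subset:
  "subring_set B \<Longrightarrow> R \<subseteq> B \<Longrightarrow> set ts \<subseteq> B \<Longrightarrow> adjoins R ts \<subseteq> B"
proof (induction ts rule: rev_induct)
  case (snoc t ts)
  have "poly p t \<in> B" if "p \<in> polys_over (adjoins R ts)" for p
  proof -
    have "coeff p i \<in> B" for i using snoc polys_over_coeff[OF that, of i] by auto
    thus ?thesis unfolding poly_altdef
      using snoc.prems by (intro subring_sum subring_mult subring_power) auto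
  qed
  thus ?case by (auto simp: adjoin_def)
qed simp

lemma adjoins_eq_polyfun:
  fixes R :: "(('i \<Rightarrow> 'k::comm_ring_1) \<Rightarrow> 'k) set"
  assumes R: "subring_set R" "R \<subseteq> polyfun" "range (\<lambda>c _. c) \<subseteq> R" and ts: "set ts \<subseteq> polyfun"
    and gens: "\<And>i. (\<lambda>p. p i) \<in> adjoins R ts"
  shows "adjoins R ts = polyfun"
proof
  show "adjoins R ts \<subseteq> polyfun" by (rule adjoins_subset[OF subring_polyfun R(2) ts])
  note sr = subring_adjoins[OF R(1), of ts]
  show "polyfun \<subseteq> adjoins R ts"
  proof
    fix f :: "('i \<Rightarrow> 'k) \<Rightarrow> 'k" assume "f \<in> polyfun"
    thus "f \<in> adjoins R ts"
    proof induction
      case (pf_const c)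
      thus ?case using adjoins_superset[OF R(1), of ts] R(3) by auto
    next
      case (pf_coord i)
      thus ?case by (rule gens)
    next
      case (pf_add f g)
      thus ?case using subring_add[OF sr, of f g] by (simp add: plus_fun_def)
    next
      case (pf_mult f g)
      thus ?case using subring_mult[OF sr, of f g] by (simp add: times_fun_def)
    qed
  qed
qed

lemma adjoins_coords:
  fixes R :: "(('i::finite \<Rightarrow> 'k::comm_ring_1) \<Rightarrow> 'k) set"
  assumes "subring_set R" "R \<subseteq> polyfun" "range (\<lambda>c _. c) \<subseteq> R"
  shows "adjoins R coords = polyfun"
  by (rule adjoins_eq_polyfun[OF assms])
    (auto simp: set_coords intro: pf_coord adjoins_gens[OF assms(1)])

lemma noeth_consts: "noeth (range (\<lambda>c _. c) :: ('a \<Rightarrow> 'k::field) set)"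
proof -
  let ?K = "range (\<lambda>c _. c) :: ('a \<Rightarrow> 'k) set"
  have ideal: "I = {0} \<or> I = ?K" if I: "ideal_of ?K I" for I
  proof (cases "I \<subseteq> {0}")
    case False
    then obtain f where f: "f \<in> I" "f \<noteq> 0" by auto
    then obtain c where c: "f = (\<lambda>_. c)" "c \<noteq> 0"
      using ideal_sub[OF I] by (auto simp: zero_fun_def)
    have "(\<lambda>_. d) \<in> I" for d
      using ideal_mult[OF I _ f(1), of "\<lambda>_. d / c"] c by (auto simp: times_fun_def)
    thus ?thesis using ideal_sub[OF I] by blast
  qed (use ideal_0[OF I] in auto)
  show ?thesis unfolding noeth_def
  proof (intro allI impI)
    fix I :: "nat \<Rightarrow> ('a \<Rightarrow> 'k) set"
    assume "(\<forall>n. ideal_of ?K (I n)) \<and> (\<forall>n. I n \<subseteq> I (Suc n))"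
    hence I: "\<And>n. ideal_of ?K (I n)" and "\<And>n. I n \<subseteq> I (Suc n)" by auto
    hence mono: "m \<le> n \<Longrightarrow> I m \<subseteq> I n" for m n by (simp add: lift_Suc_mono_le)
    show "\<exists>N. \<forall>n\<ge>N. I n = I N"
    proof (cases "\<exists>N. I N = ?K")
      case True
      then obtain N where "I N = ?K" by blast
      thus ?thesis using mono ideal_sub[OF I] by (intro exI[of _ N]) blast
    next
      case False
      thus ?thesis using ideal[OF I] by metis
    qed
  qed
qed

lemma noeth_polyfun: "noeth (polyfun :: (('i::finite \<Rightarrow> 'k::field) \<Rightarrow> 'k) set)"
proof -
  have "adjoins (range (\<lambda>c _. c)) coords = (polyfun :: (('i \<Rightarrow> 'k) \<Rightarrow> 'k) set)"
    by (rule adjoins_coords[OF subring_consts]) (auto intro: pf_const)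
  thus ?thesis using noeth_adjoins[OF subring_consts noeth_consts] by metis
qed

text \<open>The pulled back ring is a quotient of \<open>polyfun\<close>, so a chain of its ideals
  is controlled by the chain of their preimages.\<close>

lemma noeth_pullback:
  "noeth ((\<lambda>g p. g (\<phi> p)) ` (polyfun :: (('i::finite \<Rightarrow> 'k::field) \<Rightarrow> 'k) set))"
  unfolding noeth_def
proof (intro allI impI)
  let ?l = "\<lambda>g p. g (\<phi> p)" and ?P = "polyfun :: (('i \<Rightarrow> 'k) \<Rightarrow> 'k) set"
  fix I assume "(\<forall>n. ideal_of (?l ` ?P) (I n)) \<and> (\<forall>n. I n \<subseteq> I (Suc n))"
  hence I: "\<And>n. ideal_of (?l ` ?P) (I n)" and mono: "\<And>n. I n \<subseteq> I (Suc n)" by auto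
  define K where "K n = {g \<in> ?P. ?l g \<in> I n}" for n
  have "ideal_of ?P (K n)" for n
    unfolding ideal_of_def
  proof (intro conjI ballI)
    show "K n \<subseteq> ?P" unfolding K_def by blast
    show "0 \<in> K n"
      using ideal_0[OF I[of n]] pf_const[of 0] by (simp add: K_def zero_fun_def)
    fix f assume f: "f \<in> K n"
    show "f + g \<in> K n" if g: "g \<in> K n" for g
      using ideal_add[OF I[of n], of "?l f" "?l g"] f g pf_add[of f g] by (simp add: K_def plus_fun_def)
    show "r * f \<in> K n" if r: "r \<in> ?P" for r
      using ideal_mult[OF I[of n] imageI[OF r], of "?l f"] f pf_mult[OF r, of f]
      by (simp add: K_def times_fun_def)
  qed
  moreover have "K n \<subseteq> K (Suc n)" for n using mono[of n] unfolding K_def by blast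
  ultimately obtain N where N: "\<And>n. n \<ge> N \<Longrightarrow> K n = K N" using noethD[OF noeth_polyfun] by metis
  have "I n = ?l ` K n" for n using ideal_sub[OF I[of n]] unfolding K_def by blast
  thus "\<exists>N. \<forall>n\<ge>N. I n = I N" using N by metis
qed

text \<open>Noetherian induction: among the closed sets without a decomposition, one with maximal
  vanishing ideal is reducible, and the two pieces of a splitting have larger vanishing ideals,
  hence decompose.\<close>

lemma irreducible_decomposition:
  fixes C :: "('i::finite \<Rightarrow> 'k::field) set"
  assumes "zclosed C"
  obtains F where "finite F" "\<And>V. V \<in> F \<Longrightarrow> zclosed V \<and> zirreducible V" "\<Union>F = C"
proof -
  define dec where "dec C \<longleftrightarrow> (\<exists>F. finite F \<and> (\<forall>V\<in>F. zclosed V \<and> zirreducible V) \<and> \<Union>F = C)"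
    for C :: "('i \<Rightarrow> 'k) set"
  have "dec C"
  proof (rule ccontr)
    assume nd: "\<not> dec C"
    obtain M where M: "M \<in> {vanish C | C. zclosed C \<and> \<not> dec C}"
      "\<And>I. I \<in> {vanish C | C. zclosed C \<and> \<not> dec C} \<Longrightarrow> M \<subseteq> I \<Longrightarrow> I = M"
      using noeth_maximal[OF noeth_polyfun, of "vanish C" "{vanish C | C. zclosed C \<and> \<not> dec C}"]
        assms nd ideal_vanish by blast
    then obtain D where D: "zclosed D" "\<not> dec D" "M = vanish D" by blast
    have smaller: "dec (D \<inter> A)" if A: "zclosed A" "\<not> D \<subseteq> A" for A
    proof (rule ccontr)
      assume "\<not> dec (D \<inter> A)"
      hence "vanish (D \<inter> A) = vanish D"
        using M(2)[of "vanish (D \<inter> A)"] vanish_antimono[of "D \<inter> A" D] zclosed_Int[OF D(1) A(1)] D(3)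
        by blast
      hence "D \<inter> A = D" using zclosed_eq_zeros[OF D(1)] zclosed_eq_zeros[OF zclosed_Int[OF D(1) A(1)]]
        by simp
      thus False using A by blast
    qed
    have "D \<noteq> {}" using D(2) unfolding dec_def by (metis Union_empty ball_empty finite.emptyI)
    moreover have "\<not> zirreducible D"
    proof
      assume "zirreducible D"
      hence "dec D" unfolding dec_def using D(1) by (intro exI[of _ "{D}"]) auto
      thus False using D(2) by blast
    qed
    ultimately obtain A B where AB: "zclosed A" "zclosed B" "D \<subseteq> A \<union> B" "\<not> D \<subseteq> A" "\<not> D \<subseteq> B"
      unfolding zirreducible_def by blast
    obtain F G where "finite F" "\<forall>V\<in>F. zclosed V \<and> zirreducible V" "\<Union>F = D \<inter> A"
      "finite G" "\<forall>V\<in>G. zclosed V \<and> zirreducible V" "\<Union>G = D \<inter> B"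
      using smaller[OF AB(1,4)] smaller[OF AB(2,5)] unfolding dec_def by blast
    hence "dec D" unfolding dec_def using AB(3) by (intro exI[of _ "F \<union> G"]) auto
    thus False using D(2) by blast
  qed
  thus ?thesis using that unfolding dec_def by blast
qed

lemma hom_on_polyfun_eval:
  assumes hom: "hom_on polyfun \<psi>" and const: "\<And>c. \<psi> (\<lambda>_. c) = c" and f: "f \<in> polyfun"
  shows "\<psi> f = f (\<lambda>i. \<psi> (\<lambda>p. p i))"
  using f
proof induction
  case (pf_add f g)
  thus ?case using hom_on_add[OF subring_polyfun hom, of f g] by (simp add: plus_fun_def)
next
  case (pf_mult f g)
  thus ?case using hom_on_mult[OF hom, of f g] by (simp add: times_fun_def)
qed (auto simp: const)

text \<open>An ideal \<open>M\<close> maximal among those that contain \<open>J\<close> and avoid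
  all powers of \<open>s\<close> is prime. Over the field of constants, \<open>hom_extension\<close>
  yields a homomorphism to the field that kills \<open>M\<close> but not \<open>s\<close>. A
  homomorphism that fixes the constants is evaluation at a point, here a zero of \<open>J\<close> at
  which \<open>s\<close> does not vanish.\<close>

theorem nullstellensatz:
  fixes J :: "(('i::finite \<Rightarrow> 'k::alg_closed_field) \<Rightarrow> 'k) set"
  assumes J: "ideal_of polyfun J" and s: "s \<in> polyfun"
    and zero: "\<And>p. (\<And>f. f \<in> J \<Longrightarrow> f p = 0) \<Longrightarrow> s p = 0"
  obtains n where "s ^ n \<in> J"
proof (rule ccontr)
  assume "\<not> thesis"
  hence avoid: "s ^ n \<notin> J" for n using that by blast
  define F where "F = {I. ideal_of polyfun I \<and> J \<subseteq> I \<and> (\<forall>n. s ^ n \<notin> I)}"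
  obtain M where MF: "M \<in> F" and max: "\<And>I. I \<in> F \<Longrightarrow> M \<subseteq> I \<Longrightarrow> I = M"
    using noeth_maximal[OF noeth_polyfun, of J F] J avoid unfolding F_def by blast
  have M: "ideal_of polyfun M" "J \<subseteq> M" "\<And>n. s ^ n \<notin> M" using MF unfolding F_def by auto
  have sr: "subring_set (polyfun :: (('i \<Rightarrow> 'k) \<Rightarrow> 'k) set)" by (rule subring_polyfun)
  have hit: "\<exists>n m r. s ^ n = m + r * a \<and> m \<in> M \<and> r \<in> polyfun" if a: "a \<in> polyfun" "a \<notin> M" for a
  proof -
    define I where "I = {a * r + m | r m. r \<in> polyfun \<and> m \<in> M}"
    have memI: "r \<in> polyfun \<Longrightarrow> m \<in> M \<Longrightarrow> x = a * r + m \<Longrightarrow> x \<in> I" for r m x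
      unfolding I_def by blast
    have ideal: "ideal_of polyfun I"
      unfolding I_def by (rule ideal_combination[OF sr a(1) ideal_self[OF sr] M(1)])
    have MI: "M \<subseteq> I" using memI[OF subring_0[OF sr]] by auto
    have "a \<in> I" by (rule memI[OF subring_1[OF sr] ideal_0[OF M(1)]]) simp
    hence "I \<notin> F" using max a MI by blast
    then obtain n where "s ^ n \<in> I" using ideal MI M(2) unfolding F_def by blast
    then obtain r m where "r \<in> polyfun" "m \<in> M" "s ^ n = a * r + m" unfolding I_def by blast
    thus ?thesis by (metis add.commute mult.commute)
  qed
  have prime: "prime_on polyfun M"
    unfolding prime_on_def
  proof (intro conjI ballI impI)
    show "1 \<notin> M" using M(3)[of 0] by simp
    show "0 \<in> M" by (rule ideal_0[OF M(1)])
    fix a b :: "('i \<Rightarrow> 'k) \<Rightarrow> 'k" assume ab: "a \<in> polyfun" "b \<in> polyfun" "a * b \<in> M"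
    show "a \<in> M \<or> b \<in> M"
    proof (rule ccontr)
      assume "\<not> (a \<in> M \<or> b \<in> M)"
      then obtain n m r n' m' r' where *: "s ^ n = m + r * a" "m \<in> M" "r \<in> polyfun"
         "s ^ n' = m' + r' * b" "m' \<in> M" "r' \<in> polyfun"
        using hit ab(1,2) by metis
      have "s ^ (n + n') = (m' + r' * b) * m + (r * a) * m' + (r * r') * (a * b)"
        unfolding power_add *(1,4) by (simp add: algebra_simps)
      also have "\<dots> \<in> M"
      proof (intro ideal_add[OF M(1)])
        show "(m' + r' * b) * m \<in> M"
          using * ab ideal_sub[OF M(1)] by (intro ideal_mult[OF M(1) _ *(2)] subring_intros sr) auto
        show "(r * a) * m' \<in> M"
          using * ab by (intro ideal_mult[OF M(1) _ *(5)] subring_intros sr) auto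
        show "(r * r') * (a * b) \<in> M"
          using * ab by (intro ideal_mult[OF M(1) _ ab(3)] subring_intros sr) auto
      qed
      finally show False using M(3) by blast
    qed
  qed (use ideal_add[OF M(1)] ideal_mult[OF M(1)] in auto)
  let ?K = "range (\<lambda>c _. c) :: (('i \<Rightarrow> 'k) \<Rightarrow> 'k) set"
  have adj: "adjoins ?K coords = polyfun"
    by (rule adjoins_coords[OF subring_consts]) (auto intro: pf_const)
  have "s \<notin> M" using M(3)[of 1] by simp
  then obtain u where u: "u \<in> ?K" "u \<notin> M" and ext: "\<And>\<phi>. hom_on ?K \<phi> \<Longrightarrow> (\<forall>a\<in>?K \<inter> M. \<phi> a = 0) \<Longrightarrow>
      \<phi> u \<noteq> (0::'k) \<Longrightarrow> \<exists>\<psi>. hom_on polyfun \<psi> \<and> (\<forall>a\<in>?K. \<psi> a = \<phi> a) \<and> (\<forall>a\<in>polyfun \<inter> M. \<psi> a = 0) \<and> \<psi> s \<noteq> 0"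
    using hom_extension[OF subring_consts, of coords M s, where ?'k = 'k] prime s unfolding adj by blast
  \<comment> \<open>On constant functions this reads off the constant.\<close>
  define \<phi> where "\<phi> f = f (\<lambda>_. 0)" for f :: "('i \<Rightarrow> 'k) \<Rightarrow> 'k"
  have "hom_on ?K \<phi>" unfolding hom_on_def \<phi>_def by auto
  moreover have "\<phi> a = 0" if "a \<in> ?K \<inter> M" for a
  proof (rule ccontr)
    assume "\<phi> a \<noteq> 0"
    moreover obtain c where c: "a = (\<lambda>_. c)" using \<open>a \<in> ?K \<inter> M\<close> by blast
    ultimately have "(\<lambda>_. inverse c) * a = 1" by (auto simp: \<phi>_def times_fun_def one_fun_def)
    moreover have "(\<lambda>_. inverse c) * a \<in> M"
      using that by (intro ideal_mult[OF M(1)] pf_const) auto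
    ultimately show False using prime_on_1[OF prime] by simp
  qed
  moreover have "\<phi> u \<noteq> 0" using u ideal_0[OF M(1)] by (auto simp: \<phi>_def zero_fun_def)
  ultimately obtain \<psi> where \<psi>: "hom_on polyfun \<psi>" "\<forall>a\<in>?K. \<psi> a = \<phi> a" "\<forall>a\<in>polyfun \<inter> M. \<psi> a = 0" "\<psi> s \<noteq> 0"
    using ext by blast
  have "\<psi> (\<lambda>_. c) = c" for c using \<psi>(2) by (auto simp: \<phi>_def)
  note ev = hom_on_polyfun_eval[OF \<psi>(1) this]
  show False
    using zero[of "\<lambda>i. \<psi> (\<lambda>p. p i)"] ev \<psi>(3,4) s M(2) ideal_sub[OF J] by auto
qed

text \<open>A point \<open>w\<close> of the closure defines a homomorphism on the pulled back
  functions, sending the pullback of \<open>g\<close> to \<open>g w\<close>. Extending it to all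
  polynomial functions so that it kills \<open>vanish V\<close> amounts to finding a preimage of
  \<open>w\<close> in \<open>V\<close>. The target may have infinitely many coordinates, as is the
  case for the affine spaces inside \<open>nat \<Rightarrow> 'k\<close>.\<close>

theorem image_contains_open:
  fixes V :: "('i::finite \<Rightarrow> 'k::alg_closed_field) set" and \<phi> :: "('i \<Rightarrow> 'k) \<Rightarrow> ('j \<Rightarrow> 'k)"
  assumes V: "zclosed V" "zirreducible V" and \<phi>: "polymap \<phi>"
  obtains s where "s \<in> polyfun" "\<exists>v\<in>V. s (\<phi> v) \<noteq> 0"
    "\<And>w. w \<in> zclosure (\<phi> ` V) \<Longrightarrow> s w \<noteq> 0 \<Longrightarrow> w \<in> \<phi> ` V"
proof -
  define A where "A = (\<lambda>g p. g (\<phi> p)) ` polyfun"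
  have A: "subring_set A" unfolding A_def by (rule subring_pullback)
  have constA: "(\<lambda>_. c) \<in> A" for c
    unfolding A_def by (rule image_eqI[of _ _ "\<lambda>_. c"]) (auto intro: pf_const)
  have adj: "adjoins A coords = polyfun"
    using polyfun_subst[OF \<phi>] constA by (intro adjoins_coords[OF A]) (auto simp: A_def)
  note prime = prime_vanish[OF V(2)]
  obtain u where u: "u \<in> A" "u \<notin> vanish V" and ext: "\<And>\<theta>. hom_on A \<theta> \<Longrightarrow> (\<forall>a\<in>A \<inter> vanish V. \<theta> a = 0) \<Longrightarrow>
      \<theta> u \<noteq> (0::'k) \<Longrightarrow> \<exists>\<psi>. hom_on polyfun \<psi> \<and> (\<forall>a\<in>A. \<psi> a = \<theta> a) \<and> (\<forall>a\<in>polyfun \<inter> vanish V. \<psi> a = 0)"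
    using hom_extension[OF A, of coords "vanish V" 1, where ?'k = 'k] prime prime_on_1[OF prime]
      subring_1[OF subring_polyfun] unfolding adj by blast
  obtain s where s: "s \<in> polyfun" "u = (\<lambda>p. s (\<phi> p))" using u(1) unfolding A_def by blast
  show ?thesis
  proof (rule that[OF s(1)])
    show "\<exists>v\<in>V. s (\<phi> v) \<noteq> 0"
      using u(2) polyfun_subst[OF \<phi> s(1)] by (auto simp: vanish_def s(2))
    fix w assume w: "w \<in> zclosure (\<phi> ` V)" "s w \<noteq> 0"
    define rep where "rep a = (SOME g. g \<in> polyfun \<and> a = (\<lambda>p. g (\<phi> p)))" for a
    define \<theta> where "\<theta> a = rep a w" for a
    \<comment> \<open>Independent of the chosen representative: two of them agree on the image of
      \<open>V\<close>, hence on its closure, once they have the same pullback.\<close>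
    have \<theta>: "\<theta> (\<lambda>p. g (\<phi> p)) = g w" if g: "g \<in> polyfun" for g
    proof -
      have r: "rep (\<lambda>p. g (\<phi> p)) \<in> polyfun \<and> (\<lambda>p. g (\<phi> p)) = (\<lambda>p. rep (\<lambda>p. g (\<phi> p)) (\<phi> p))"
        unfolding rep_def by (rule someI[of _ g]) (use g in auto)
      have e: "rep (\<lambda>p. g (\<phi> p)) (\<phi> v) = g (\<phi> v)" for v using fun_cong[OF conjunct2[OF r], of v] by simp
      have "rep (\<lambda>p. g (\<phi> p)) w - g w = 0"
        using r e by (intro zclosureD[OF w(1) polyfun_diff[OF _ g]]) auto
      thus ?thesis by (simp add: \<theta>_def)
    qed
    have "hom_on A \<theta>"
      unfolding hom_on_def
    proof (intro conjI ballI)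
      show "\<theta> 1 = 1" using \<theta>[OF pf_const[of 1]] by (simp add: one_fun_def)
      fix a b assume "a \<in> A" "b \<in> A"
      then obtain f g where fg: "f \<in> polyfun" "g \<in> polyfun" "a = (\<lambda>p. f (\<phi> p))" "b = (\<lambda>p. g (\<phi> p))"
        unfolding A_def by blast
      show "\<theta> (a - b) = \<theta> a - \<theta> b"
        using \<theta>[OF polyfun_diff[OF fg(1,2)]] \<theta>[OF fg(1)] \<theta>[OF fg(2)] by (simp add: fg fun_diff_def)
      show "\<theta> (a * b) = \<theta> a * \<theta> b"
        using \<theta>[OF pf_mult[OF fg(1,2)]] \<theta>[OF fg(1)] \<theta>[OF fg(2)] by (simp add: fg times_fun_def)
    qed
    moreover have "\<theta> a = 0" if a: "a \<in> A \<inter> vanish V" for a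
    proof -
      obtain g where g: "g \<in> polyfun" "a = (\<lambda>p. g (\<phi> p))" using a unfolding A_def by blast
      have "g w = 0" using a g by (intro zclosureD[OF w(1) g(1)]) (auto simp: vanish_def)
      thus ?thesis using \<theta>[OF g(1)] g by simp
    qed
    moreover have "\<theta> u \<noteq> 0" using \<theta>[OF s(1)] s w by simp
    ultimately obtain \<psi> where \<psi>: "hom_on polyfun \<psi>" "\<forall>a\<in>A. \<psi> a = \<theta> a" "\<forall>a\<in>polyfun \<inter> vanish V. \<psi> a = 0"
      using ext by blast
    have "\<psi> (\<lambda>_. c) = c" for c using \<psi>(2) constA[of c] \<theta>[OF pf_const[of c]] by simp
    note ev = hom_on_polyfun_eval[OF \<psi>(1) this]
    define v where "v = (\<lambda>i. \<psi> (\<lambda>p. p i))"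
    have "v \<in> V"
      using zclosed_eq_zeros[OF V(1)] \<psi>(3) ev unfolding v_def by (auto simp: vanish_def)
    moreover have "\<phi> v = w"
    proof
      fix j
      have c: "(\<lambda>p. \<phi> p j) \<in> polyfun" using \<phi> by (simp add: polymap_def)
      have "\<phi> v j = \<psi> (\<lambda>p. \<phi> p j)" using ev[OF c] by (simp add: v_def)
      also have "\<dots> = \<theta> (\<lambda>p. \<phi> p j)"
      proof -
        have "(\<lambda>p. \<phi> p j) \<in> A" unfolding A_def by (rule image_eqI[OF _ pf_coord[of j]]) simp
        thus ?thesis using \<psi>(2) by blast
      qed
      also have "\<dots> = w j" using \<theta>[OF pf_coord[of j]] by simp
      finally show "\<phi> v j = w j" .
    qed
    ultimately show "w \<in> \<phi> ` V" by blast
  qed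
qed

section \<open>Products\<close>

lemma pair_pt_simps [simp]:
  "pair_pt p q (Inl i) = p i" "pair_pt p q (Inr j) = q j"
  "pair_pt p q \<circ> Inl = p" "pair_pt p q \<circ> Inr = q" "pair_pt (z \<circ> Inl) (z \<circ> Inr) = z"
  by (auto simp: pair_pt_def fun_eq_iff split: sum.splits)

lemma prod_set_eq: "prod_set X Y = {z. z \<circ> Inl \<in> X \<and> z \<circ> Inr \<in> Y}"
  unfolding prod_set_def by (force intro: exI[of _ "z \<circ> Inl" for z])

lemma pair_pt_in_prod_set [simp]: "pair_pt p q \<in> prod_set A B \<longleftrightarrow> p \<in> A \<and> q \<in> B"
  by (simp add: prod_set_eq)

lemma polymap_fst: "polymap (\<lambda>z. z \<circ> Inl)"
  and polymap_snd: "polymap (\<lambda>z. z \<circ> Inr)"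
  by (auto simp: polymap_def intro: pf_coord)

lemma polymap_const: "polymap (\<lambda>_. c)"
  by (auto simp: polymap_def intro: pf_const)

lemma polymap_id: "polymap (\<lambda>p. p)"
  by (auto simp: polymap_def intro: pf_coord)

lemma polymap_comp: "polymap \<phi> \<Longrightarrow> polymap \<psi> \<Longrightarrow> polymap (\<lambda>p. \<phi> (\<psi> p))"
  using polyfun_subst[of \<psi>] by (auto simp: polymap_def)

lemma polymap_pair:
  assumes "polymap \<phi>" "polymap \<psi>"
  shows "polymap (\<lambda>p. pair_pt (\<phi> p) (\<psi> p))"
  unfolding polymap_def
proof
  fix j show "(\<lambda>p. pair_pt (\<phi> p) (\<psi> p) j) \<in> polyfun"
    using assms by (cases j) (auto simp: polymap_def)
qed

lemmas polymap_intros = polymap_fst polymap_snd polymap_const polymap_id polymap_pair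

lemma polyfun_fst: "f \<in> polyfun \<Longrightarrow> (\<lambda>z. f (z \<circ> Inl)) \<in> polyfun"
  and polyfun_snd: "g \<in> polyfun \<Longrightarrow> (\<lambda>z. g (z \<circ> Inr)) \<in> polyfun"
  by (rule polyfun_subst[OF polymap_fst] polyfun_subst[OF polymap_snd]; assumption)+

lemma polyfun_pair_left: "F \<in> polyfun \<Longrightarrow> (\<lambda>p. F (pair_pt p q)) \<in> polyfun"
  by (rule polyfun_subst[OF polymap_pair[OF polymap_id polymap_const]])

lemma polyfun_pair_right: "F \<in> polyfun \<Longrightarrow> (\<lambda>q. F (pair_pt p q)) \<in> polyfun"
  by (rule polyfun_subst[OF polymap_pair[OF polymap_const polymap_id]])

lemma zclosed_prod_set: "zclosed X \<Longrightarrow> zclosed Y \<Longrightarrow> zclosed (prod_set X Y)"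
  using zclosed_Int[OF zclosed_preimage[OF polymap_fst] zclosed_preimage[OF polymap_snd], of X Y]
  by (simp add: prod_set_eq Collect_conj_eq)

text \<open>Since \<open>V\<close> is irreducible, on each slice over a point of \<open>X\<close>
  one of \<open>F\<close> and \<open>G\<close> vanishes identically. The points where this happens
  for \<open>F\<close>, respectively \<open>G\<close>, form two closed sets that cover
  \<open>X\<close>, so one of them contains \<open>X\<close>.\<close>

lemma zirreducible_prod_set:
  fixes X :: "('i \<Rightarrow> 'k::idom) set" and V :: "('j \<Rightarrow> 'k) set"
  assumes X: "zirreducible X" and V: "zirreducible V"
  shows "zirreducible (prod_set X V)"
  unfolding zirreducible_iff
proof (intro conjI ballI impI)
  show "prod_set X V \<noteq> {}"
    using zirreducible_nonempty[OF X] zirreducible_nonempty[OF V] by (auto simp: prod_set_def)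
  fix F G :: "('i + 'j \<Rightarrow> 'k) \<Rightarrow> 'k"
  assume FG: "F \<in> polyfun" "G \<in> polyfun" "\<forall>z\<in>prod_set X V. F z * G z = 0"
  define Z where "Z F = {x. \<forall>f\<in>(\<lambda>v x. F (pair_pt x v)) ` V. f x = 0}" for F :: "('i + 'j \<Rightarrow> 'k) \<Rightarrow> 'k"
  have Z: "x \<in> Z F \<longleftrightarrow> (\<forall>v\<in>V. F (pair_pt x v) = 0)" for F x unfolding Z_def by simp
  have cl: "zclosed (Z F)" if "F \<in> polyfun" for F
    unfolding Z_def using polyfun_pair_left[OF that] by (intro zclosed_zeros) auto
  have "X \<subseteq> Z F \<union> Z G"
  proof
    fix x assume x: "x \<in> X"
    have "\<forall>v\<in>V. F (pair_pt x v) * G (pair_pt x v) = 0" using FG(3) x by (auto simp: prod_set_def)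
    thus "x \<in> Z F \<union> Z G"
      using V[unfolded zirreducible_iff, THEN conjunct2, rule_format,
          OF polyfun_pair_right[OF FG(1)] polyfun_pair_right[OF FG(2)], of x x] by (auto simp: Z)
  qed
  hence "X \<subseteq> Z F \<or> X \<subseteq> Z G"
    using X cl[OF FG(1)] cl[OF FG(2)] unfolding zirreducible_def by blast
  thus "(\<forall>z\<in>prod_set X V. F z = 0) \<or> (\<forall>z\<in>prod_set X V. G z = 0)"
    by (auto simp: prod_set_def Z subset_iff)
qed

section \<open>Functions on a product as finite sums of products\<close>

definition tensor_sum :: "(('a \<Rightarrow> 'k::comm_ring_1) \<times> ('b \<Rightarrow> 'k)) list \<Rightarrow> 'a \<Rightarrow> 'b \<Rightarrow> 'k" where
  "tensor_sum l x y = (\<Sum>(c, d)\<leftarrow>l. c x * d y)"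

definition tensor_mult :: "(('a \<Rightarrow> 'k::comm_ring_1) \<times> ('b \<Rightarrow> 'k)) list \<Rightarrow>
    (('a \<Rightarrow> 'k) \<times> ('b \<Rightarrow> 'k)) list \<Rightarrow> (('a \<Rightarrow> 'k) \<times> ('b \<Rightarrow> 'k)) list" where
  "tensor_mult l m = concat (map (\<lambda>p. map (\<lambda>q. (fst p * fst q, snd p * snd q)) m) l)"

lemma tensor_sum_append: "tensor_sum (l @ m) x y = tensor_sum l x y + tensor_sum m x y"
  by (simp add: tensor_sum_def)

lemma tensor_sum_mult: "tensor_sum (tensor_mult l m) x y = tensor_sum l x y * tensor_sum m x y"
proof -
  have 1: "tensor_sum (map (\<lambda>q. (a * fst q, b * snd q)) m) x y = (a x * b y) * tensor_sum m x y" for a b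
    unfolding tensor_sum_def by (induction m) (auto simp: algebra_simps)
  show ?thesis
  proof (induction l)
    case Nil
    show ?case by (simp add: tensor_sum_def tensor_mult_def)
  next
    case (Cons p l)
    have "tensor_mult (p # l) m = map (\<lambda>q. (fst p * fst q, snd p * snd q)) m @ tensor_mult l m"
      by (simp add: tensor_mult_def)
    thus ?case
      using Cons by (simp add: tensor_sum_append 1) (simp add: tensor_sum_def case_prod_beta algebra_simps)
  qed
qed

lemma set_tensor_mult:
  "(c, d) \<in> set (tensor_mult l m) \<longleftrightarrow>
    (\<exists>a b a' b'. (a, b) \<in> set l \<and> (a', b') \<in> set m \<and> c = a * a' \<and> d = b * b')"
  unfolding tensor_mult_def by force

lemma polyfun_tensor:
  fixes F :: "('i + 'j \<Rightarrow> 'k::comm_ring_1) \<Rightarrow> 'k"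
  assumes "F \<in> polyfun"
  shows "\<exists>l. set l \<subseteq> polyfun \<times> polyfun \<and> (\<forall>x y. F (pair_pt x y) = tensor_sum l x y)"
  using assms
proof induction
  case (pf_const c)
  show ?case
    by (rule exI[of _ "[(\<lambda>_. c, \<lambda>_. 1)]"]) (auto simp: tensor_sum_def intro: polyfun.pf_const)
next
  case (pf_coord i)
  show ?case
  proof (cases i)
    case (Inl a)
    thus ?thesis
      by (intro exI[of _ "[(\<lambda>x. x a, \<lambda>_. 1)]"])
        (auto simp: tensor_sum_def intro: polyfun.pf_const polyfun.pf_coord)
  next
    case (Inr b)
    thus ?thesis
      by (intro exI[of _ "[(\<lambda>_. 1, \<lambda>y. y b)]"])
        (auto simp: tensor_sum_def intro: polyfun.pf_const polyfun.pf_coord)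
  qed
next
  case (pf_add f g)
  then obtain l m where "set l \<subseteq> polyfun \<times> polyfun" "\<forall>x y. f (pair_pt x y) = tensor_sum l x y"
    "set m \<subseteq> polyfun \<times> polyfun" "\<forall>x y. g (pair_pt x y) = tensor_sum m x y" by blast
  thus ?case by (intro exI[of _ "l @ m"]) (simp add: tensor_sum_append)
next
  case (pf_mult f g)
  then obtain l m where lm: "set l \<subseteq> polyfun \<times> polyfun" "\<forall>x y. f (pair_pt x y) = tensor_sum l x y"
    "set m \<subseteq> polyfun \<times> polyfun" "\<forall>x y. g (pair_pt x y) = tensor_sum m x y" by blast
  have "set (tensor_mult l m) \<subseteq> polyfun \<times> polyfun"
    by (auto simp: set_tensor_mult dest!: subsetD[OF lm(1)] subsetD[OF lm(3)]
        intro!: subring_mult[OF subring_polyfun])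
  thus ?case using lm by (intro exI[of _ "tensor_mult l m"]) (simp add: tensor_sum_mult)
qed

section \<open>Generic freeness and generic fibres\<close>

text \<open>\<open>A\<close> plays the role of the coordinate ring of the base (with \<open>P\<close> the ideal of the base
  variety), \<open>R\<close> that of the total space, and \<open>NN\<close> is the family of ideals of the fibres.
  The conclusion is the vanishing of \<open>Tor\<^sub>1(R/J, A/m)\<close> over a nonempty open subset of the base.\<close>

definition generically_flat :: "'r::comm_ring_1 set \<Rightarrow> 'r set \<Rightarrow> 'r set set \<Rightarrow> 'r set \<Rightarrow> bool" where
  "generically_flat A P NN R \<longleftrightarrow> (\<forall>J. ideal_of R J \<and> P \<subseteq> J \<longrightarrow> (\<exists>f\<in>A - P. \<forall>N\<in>NN. \<forall>T.
     ideal_of R T \<and> T \<subseteq> J \<inter> N \<and> P \<subseteq> T \<and> (\<forall>m\<in>A \<inter> N. \<forall>j\<in>J. m * j \<in> T) \<longrightarrow>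
       (\<forall>e\<in>J \<inter> N. \<exists>n. f ^ n * e \<in> T)))"

text \<open>For \<open>J = P\<close> the ideal \<open>T\<close> contains all of \<open>J\<close>.
  Otherwise any \<open>f\<close> in \<open>J - P\<close> works at once: \<open>e\<close> itself is
  an element of \<open>A \<inter> N\<close>, so \<open>e * f\<close> lies in
  \<open>T\<close>.\<close>

lemma generically_flat_base:
  assumes A: "subring_set A" and P: "1 \<notin> P"
  shows "generically_flat A P NN A"
  unfolding generically_flat_def
proof (intro allI impI)
  fix J assume J: "ideal_of A J \<and> P \<subseteq> J"
  show "\<exists>f\<in>A - P. \<forall>N\<in>NN. \<forall>T. ideal_of A T \<and> T \<subseteq> J \<inter> N \<and> P \<subseteq> T \<and> (\<forall>m\<in>A \<inter> N. \<forall>j\<in>J. m * j \<in> T) \<longrightarrow>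
       (\<forall>e\<in>J \<inter> N. \<exists>n. f ^ n * e \<in> T)"
  proof (cases "J = P")
    case True
    thus ?thesis using P subring_1[OF A] by (intro bexI[of _ 1]) auto
  next
    case False
    then obtain f where f: "f \<in> J" "f \<notin> P" using J by blast
    have "\<exists>n. f ^ n * e \<in> T" if "e \<in> J \<inter> N" "\<forall>m\<in>A \<inter> N. \<forall>j\<in>J. m * j \<in> T" for e N T
    proof -
      have "e * f \<in> T" using that f J ideal_sub[of A J e] by blast
      thus ?thesis by (intro exI[of _ 1]) (simp add: mult.commute)
    qed
    thus ?thesis using f J ideal_sub[of A J f] by (intro bexI[of _ f]) blast+
  qed
qed

text \<open>Leading coefficients reduce R[t] to \<open>R\<close>. By noetherianity \<open>J\<close>
  has only finitely many leading coefficient ideals, so a product of finitely many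
  \<open>g d\<close> serves all degrees. The hypothesis on polynomials in \<open>t\<close> says that
  \<open>t\<close> stays algebraically independent over \<open>R\<close> modulo each
  \<open>N\<close>; it puts the leading coefficients of \<open>e\<close> and of the elements of
  \<open>T\<close> into \<open>N\<close>.\<close>

lemma generically_flat_adjoin:
  assumes R: "subring_set R" and noeth: "noeth R" and A: "subring_set A" "A \<subseteq> R"
    and P: "P \<subseteq> A" "1 \<notin> P" "\<And>a b. a \<in> A - P \<Longrightarrow> b \<in> A - P \<Longrightarrow> a * b \<notin> P"
    and NN: "\<And>N. N \<in> NN \<Longrightarrow> ideal_of UNIV N"
    and transc: "\<And>N p i. N \<in> NN \<Longrightarrow> p \<in> polys_over R \<Longrightarrow> poly p t \<in> N \<Longrightarrow> coeff p i \<in> N"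
    and flat: "generically_flat A P NN R"
  shows "generically_flat A P NN (adjoin R t)"
  unfolding generically_flat_def
proof (intro allI impI)
  fix J assume "ideal_of (adjoin R t) J \<and> P \<subseteq> J"
  hence J: "ideal_of (adjoin R t) J" "P \<subseteq> J" by auto
  let ?L = "lead_ideal R t"
  note Rt = subring_adjoin[OF R, of t]
  have PL: "P \<subseteq> ?L d K" if K: "ideal_of (adjoin R t) K" "P \<subseteq> K" for d K
  proof
    fix p assume p: "p \<in> P"
    hence pR: "p \<in> R" using P A by blast
    have "t ^ d * p \<in> K" using K p adjoin_gen[OF R] by (intro ideal_mult[OF K(1)] subring_power[OF Rt]) auto
    thus "p \<in> ?L d K"
      using lead_idealI[OF polys_over_monom[OF R pR, of d], of d t K]
      by (simp add: degree_monom_le poly_monom mult.commute)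
  qed
  have "\<exists>f\<in>A - P. \<forall>N\<in>NN. \<forall>T. ideal_of R T \<and> T \<subseteq> ?L d J \<inter> N \<and> P \<subseteq> T \<and>
      (\<forall>m\<in>A \<inter> N. \<forall>j\<in>?L d J. m * j \<in> T) \<longrightarrow> (\<forall>e\<in>?L d J \<inter> N. \<exists>n. f ^ n * e \<in> T)" for d
    using flat ideal_lead_ideal[OF R J(1)] PL[OF J] unfolding generically_flat_def by blast
  then obtain g where g: "\<And>d. g d \<in> A - P" and g_flat: "\<And>d N T e. N \<in> NN \<Longrightarrow> ideal_of R T \<Longrightarrow>
      T \<subseteq> ?L d J \<inter> N \<Longrightarrow> P \<subseteq> T \<Longrightarrow> (\<forall>m\<in>A \<inter> N. \<forall>j\<in>?L d J. m * j \<in> T) \<Longrightarrow> e \<in> ?L d J \<inter> N \<Longrightarrow>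
      \<exists>n. g d ^ n * e \<in> T" by metis
  obtain D where D: "\<And>d. d \<ge> D \<Longrightarrow> ?L d J = ?L D J"
    using noethD[OF noeth, of "\<lambda>d. ?L d J"] ideal_lead_ideal[OF R J(1)] lead_ideal_mono_Suc[OF R J(1)]
    by metis
  define f where "f = (\<Prod>d\<le>D. g d)"
  have prodA: "prod g S \<in> A - P" for S
    using g subring_1[OF A(1)] P(2) P(3) subring_mult[OF A(1)]
    by (induction S rule: infinite_finite_induct) auto
  show "\<exists>f\<in>A - P. \<forall>N\<in>NN. \<forall>T. ideal_of (adjoin R t) T \<and> T \<subseteq> J \<inter> N \<and> P \<subseteq> T \<and>
      (\<forall>m\<in>A \<inter> N. \<forall>j\<in>J. m * j \<in> T) \<longrightarrow> (\<forall>e\<in>J \<inter> N. \<exists>n. f ^ n * e \<in> T)"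
  proof (intro bexI[of _ f] ballI allI impI)
    show fAP: "f \<in> A - P" unfolding f_def by (rule prodA)
    hence fR: "f ^ n \<in> R" for n using A subring_power[OF R] by auto
    hence fRt: "f ^ n \<in> adjoin R t" for n using adjoin_superset[OF R] by blast
    fix N T e
    assume N: "N \<in> NN" and "ideal_of (adjoin R t) T \<and> T \<subseteq> J \<inter> N \<and> P \<subseteq> T \<and> (\<forall>m\<in>A \<inter> N. \<forall>j\<in>J. m * j \<in> T)"
      and e: "e \<in> J \<inter> N"
    hence T: "ideal_of (adjoin R t) T" "T \<subseteq> J" "T \<subseteq> N" "P \<subseteq> T" "\<And>m j. m \<in> A \<inter> N \<Longrightarrow> j \<in> J \<Longrightarrow> m * j \<in> T" by auto
    note Ni = NN[OF N]
    have lead: "\<exists>n. f ^ n * c \<in> ?L d T" if c: "c \<in> ?L d J" "c \<in> N" for c d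
    proof -
      \<comment> \<open>From degree \<open>D\<close> on the ideals agree, so an index is available
        whose element \<open>g d'\<close> is among the factors of \<open>f\<close>.\<close>
      define d' where "d' = min d D"
      have Ld: "?L d' J = ?L d J" using D[of d] by (auto simp: d'_def min_def)
      have "?L d T \<subseteq> ?L d' J \<inter> N"
        using lead_ideal_mono[OF T(2)] transc[OF N] T(3) unfolding Ld by (auto elim!: lead_idealE)
      moreover have "m * j \<in> ?L d T" if m: "m \<in> A \<inter> N" and j: "j \<in> ?L d' J" for m j
      proof -
        from j obtain p where p: "p \<in> polys_over R" "degree p \<le> d" "poly p t \<in> J" "coeff p d = j"
          unfolding Ld by (metis lead_idealE)
        show ?thesis
          using lead_idealI[OF polys_over_smult[OF R _ p(1), of m], of d t T] T(5)[OF m p(3)] p m A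
            le_trans[OF degree_smult_le p(2)] by auto
      qed
      ultimately obtain n where n: "g d' ^ n * c \<in> ?L d T"
        using g_flat[OF N ideal_lead_ideal[OF R T(1)], of d d' c] PL[OF T(1,4)] c Ld by blast
      define h where "h = prod g ({..D} - {d'})"
      have "h ^ n \<in> R" using prodA A(2) subring_power[OF R] unfolding h_def by blast
      hence "h ^ n * (g d' ^ n * c) \<in> ?L d T" using ideal_mult[OF ideal_lead_ideal[OF R T(1)] _ n] by blast
      moreover have "f = h * g d'" unfolding f_def h_def
        using prod.remove[of "{..D}" d' g] by (simp add: d'_def mult.commute)
      ultimately show ?thesis by (intro exI[of _ n]) (simp add: power_mult_distrib mult.assoc)
    qed
    have main: "\<exists>n. f ^ n * poly p t \<in> T"
      if "p \<in> polys_over R" "degree p \<le> d" "poly p t \<in> J" "poly p t \<in> N" for p d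
      using that
    proof (induction d arbitrary: p)
      case 0
      obtain n where "f ^ n * coeff p 0 \<in> ?L 0 T"
        using lead[OF lead_idealI[OF 0(1,2,3)] transc[OF N 0(1,4)]] by blast
      then obtain q where q: "degree q \<le> 0" "poly q t \<in> T" "coeff q 0 = f ^ n * coeff p 0"
        by (metis lead_idealE)
      have "p = [:coeff p 0:]" "q = [:coeff q 0:]" using q(1) 0(2) by (auto elim!: degree_eq_zeroE)
      hence "poly q t = f ^ n * poly p t" using q(3) by (metis mult_zero_right poly_pCons poly_0 add.right_neutral)
      thus ?case using q by metis
    next
      case (Suc d)
      obtain n where "f ^ n * coeff p (Suc d) \<in> ?L (Suc d) T"
        using lead[OF lead_idealI[OF Suc.prems(1,2,3)] transc[OF N Suc.prems(1,4)]] by blast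
      then obtain q where q: "q \<in> polys_over R" "degree q \<le> Suc d" "poly q t \<in> T"
          "coeff q (Suc d) = f ^ n * coeff p (Suc d)"
        by (metis lead_idealE)
      \<comment> \<open>Subtracting an element of \<open>T\<close> cancels the top coefficient and
        keeps the remainder in \<open>J \<inter> N\<close>, so that the induction on the degree
        applies.\<close>
      define r where "r = smult (f ^ n) p - q"
      have rv: "poly r t = f ^ n * poly p t - poly q t" by (simp add: r_def)
      have "r \<in> polys_over R" unfolding r_def
        using q Suc.prems fR by (intro polys_over_intros R)
      moreover have "degree r \<le> d" unfolding r_def
        using q Suc.prems(2) le_trans[OF degree_smult_le Suc.prems(2)] by (intro degree_diff_less_bound) auto
      moreover have "poly r t \<in> J" unfolding rv
        using q T(2) Suc.prems(3) fRt by (intro ideal_diff[OF Rt J(1)] ideal_mult[OF J(1)]) auto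
      moreover have "poly r t \<in> N" unfolding rv
        using q T(3) Suc.prems(4) by (intro ideal_diff[OF _ Ni] ideal_mult[OF Ni]) (auto simp: subring_set_def)
      ultimately obtain k where k: "f ^ k * poly r t \<in> T" using Suc.IH by blast
      have "f ^ k * poly r t + f ^ k * poly q t \<in> T"
        by (intro ideal_add[OF T(1) k] ideal_mult[OF T(1) fRt] q)
      hence "f ^ (k + n) * poly p t \<in> T" by (simp add: rv algebra_simps power_add)
      thus ?case by blast
    qed
    obtain p where "p \<in> polys_over R" "e = poly p t"
      using e ideal_sub[OF J(1)] by (auto simp: adjoin_def)
    thus "\<exists>n. f ^ n * e \<in> T" using main[of p "degree p"] e by auto
  qed
qed

lemma poly_fun_apply: "(poly p t) z = poly (map_poly (\<lambda>f. f z) p) (t z)"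
  for p :: "('a \<Rightarrow> 'k::comm_ring_1) poly"
  by (induction p) (auto simp: map_poly_pCons)

text \<open>An ideal of the ring of all functions, not just of \<open>polyfun\<close>, so that the
  same family can be intersected with every intermediate ring of the induction.\<close>

definition fibre_ideal :: "('i \<Rightarrow> 'k::comm_ring_1) \<Rightarrow> (('i + 'j \<Rightarrow> 'k) \<Rightarrow> 'k) set" where
  "fibre_ideal x = {E. \<forall>y. E (pair_pt x y) = 0}"

text \<open>The ring of the total space arises from that of the base by adjoining the coordinates of
  the second factor one at a time.\<close>

lemma generically_flat_polyfun:
  fixes X :: "('i::finite \<Rightarrow> 'k::alg_closed_field) set"
  assumes X: "zirreducible X"
  shows "generically_flat ((\<lambda>g z. g (z \<circ> Inl)) ` polyfun) ((\<lambda>g z. g (z \<circ> Inl)) ` vanish X)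
    (fibre_ideal ` X) (polyfun :: (('i + 'j::finite \<Rightarrow> 'k) \<Rightarrow> 'k) set)"
proof -
  let ?lift = "\<lambda>g (z :: 'i + 'j \<Rightarrow> 'k). g (z \<circ> Inl)"
  let ?A = "?lift ` polyfun" and ?P = "?lift ` vanish X"
  let ?NN = "fibre_ideal ` X :: (('i + 'j \<Rightarrow> 'k) \<Rightarrow> 'k) set set"
  have inj: "?lift f = ?lift g \<Longrightarrow> f = g" for f g :: "('i \<Rightarrow> 'k) \<Rightarrow> 'k"
  proof
    fix p assume "?lift f = ?lift g"
    from fun_cong[OF this, of "pair_pt p (\<lambda>_. 0)"] show "f p = g p" by simp
  qed
  have A: "subring_set ?A" by (rule subring_pullback)
  have A_sub: "?A \<subseteq> polyfun" using polyfun_fst by blast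
  have constA: "range (\<lambda>c _. c) \<subseteq> ?A"
  proof
    fix a :: "('i + 'j \<Rightarrow> 'k) \<Rightarrow> 'k" assume "a \<in> range (\<lambda>c _. c)"
    then obtain c where "a = (\<lambda>_. c)" by blast
    thus "a \<in> ?A" using pf_const[of c] by (intro image_eqI[of _ _ "\<lambda>_. c"]) auto
  qed
  have noethA: "noeth ?A" by (rule noeth_pullback)
  have P: "?P \<subseteq> ?A" by (auto simp: vanish_def)
  have memP: "?lift f \<in> ?P \<longleftrightarrow> f \<in> vanish X" for f using inj by blast
  have P1: "1 \<notin> ?P"
    using memP[of "\<lambda>_. 1"] zirreducible_nonempty[OF X] by (auto simp: vanish_def one_fun_def)
  have Pprime: "a * b \<notin> ?P" if aA: "a \<in> ?A - ?P" and bA: "b \<in> ?A - ?P" for a b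
  proof
    assume ab: "a * b \<in> ?P"
    obtain f g where fg: "f \<in> polyfun" "g \<in> polyfun" "a = ?lift f" "b = ?lift g" using aA bA by blast
    have "f * g \<in> vanish X" using ab memP[of "f * g"] by (simp add: fg times_fun_def)
    hence "f \<in> vanish X \<or> g \<in> vanish X" using prime_onD[OF prime_vanish[OF X] fg(1,2)] by blast
    thus False using aA bA fg memP by blast
  qed
  have NN: "ideal_of UNIV N" if "N \<in> ?NN" for N
    using that by (auto simp: ideal_of_def fibre_ideal_def)
  \<comment> \<open>The list is distinct because a coordinate adjoined a second time would not be
    algebraically independent.\<close>
  obtain js :: "'j list" where js: "set js = UNIV" "distinct js"
    using finite_distinct_list[OF finite_UNIV] by blast
  let ?co = "\<lambda>j (z :: 'i + 'j \<Rightarrow> 'k). z (Inr j)"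
  have transc: "coeff p i \<in> N" if N: "N \<in> ?NN" and p: "p \<in> polys_over (adjoins ?A (map ?co ks))"
      "poly p (?co j) \<in> N" and j: "j \<notin> set ks" for N p i ks j
  proof -
    \<comment> \<open>The functions independent of coordinate \<open>j\<close>. Letting only this
      coordinate vary over the infinite field turns the vanishing of the polynomial on the fibre
      into the vanishing of each of its coefficients.\<close>
    define B where "B = {E :: ('i + 'j \<Rightarrow> 'k) \<Rightarrow> 'k. \<forall>z c. E (z(Inr j := c)) = E z}"
    have upd: "z(Inr j := c) \<circ> Inl = z \<circ> Inl" for z :: "'i + 'j \<Rightarrow> 'k" and c by auto
    have "adjoins ?A (map ?co ks) \<subseteq> B"
      using j by (intro adjoins_subset) (auto simp: B_def subring_set_def upd)
    hence cB: "coeff p i (z(Inr j := c)) = coeff p i z" for i z c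
      using polys_over_coeff[OF p(1), of i] unfolding B_def by blast
    obtain x where x: "x \<in> X" "N = fibre_ideal x" using N by blast
    have "coeff p i (pair_pt x y) = 0" for y
    proof -
      define q where "q = map_poly (\<lambda>f. f (pair_pt x y)) p"
      have "poly q c = 0" for c
      proof -
        have e: "pair_pt x (y(j := c)) = (pair_pt x y)(Inr j := c)"
          by (auto simp: fun_eq_iff pair_pt_def split: sum.splits)
        have "map_poly (\<lambda>f. f (pair_pt x (y(j := c)))) p = q"
          unfolding q_def by (rule poly_eqI) (simp add: coeff_map_poly e cB)
        hence "poly q c = (poly p (?co j)) (pair_pt x (y(j := c)))"
          by (simp add: poly_fun_apply)
        also have "\<dots> = 0" using p(2) x(2) by (simp add: fibre_ideal_def)
        finally show ?thesis .
      qed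
      hence "q = 0" using poly_roots_finite[of q] infinite_alg_closed by auto
      thus ?thesis unfolding q_def by (metis coeff_0 coeff_map_poly zero_fun_apply)
    qed
    thus ?thesis using x(2) by (simp add: fibre_ideal_def)
  qed
  have "generically_flat ?A ?P ?NN (adjoins ?A (map ?co ks))" if "distinct ks" for ks
    using that
  proof (induction ks rule: rev_induct)
    case Nil
    show ?case unfolding list.map adjoins_Nil by (rule generically_flat_base[OF A P1])
  next
    case (snoc k ks)
    have k: "distinct ks" "k \<notin> set ks" using snoc.prems by auto
    show ?case unfolding map_append list.map adjoins_snoc
      by (rule generically_flat_adjoin[OF subring_adjoins[OF A] noeth_adjoins[OF A noethA] A
            adjoins_superset[OF A] P P1 Pprime NN transc[OF _ _ _ k(2)] snoc.IH[OF k(1)]])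
  qed
  moreover have "adjoins ?A (map ?co js) = polyfun"
  proof (rule adjoins_eq_polyfun[OF A A_sub constA])
    show "set (map ?co js) \<subseteq> polyfun" by (auto intro: pf_coord)
    fix i show "(\<lambda>z. z i) \<in> adjoins ?A (map ?co js)"
    proof (cases i)
      case (Inl a)
      have "(\<lambda>z. z i) \<in> ?A" by (rule image_eqI[OF _ pf_coord[of a]]) (simp add: Inl)
      thus ?thesis using adjoins_superset[OF A] by blast
    next
      case (Inr b)
      thus ?thesis using js by (intro adjoins_gens[OF A]) auto
    qed
  qed
  ultimately show ?thesis using js(2) by metis
qed

text \<open>As \<open>\<Gamma>\<close> is irreducible, \<open>s\<close> is not a zero divisor modulo
  its ideal \<open>I\<close>; flatness of the quotient by \<open>J\<close>, generated by
  \<open>I\<close> and \<open>s\<close>, carries this over to restrictions to the fibre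
  (\<open>nzd\<close>). If \<open>g\<close> vanishes on the fibre of \<open>\<Gamma>\<close>, then
  \<open>s * g\<close> vanishes on the fibre of the closure, so by the Nullstellensatz a power of
  \<open>s * g\<close> is the restriction of an element of \<open>I\<close>. Cancelling
  \<open>s\<close> shows that \<open>g\<close> vanishes there too.\<close>

theorem generic_fibre_closure:
  fixes X :: "('i::finite \<Rightarrow> 'k::alg_closed_field) set" and \<Gamma> :: "('i + 'j::finite \<Rightarrow> 'k) set"
  assumes X: "zirreducible X" and \<Gamma>: "zirreducible \<Gamma>" "\<And>z. z \<in> \<Gamma> \<Longrightarrow> z \<circ> Inl \<in> X"
    and s: "s \<in> polyfun" "\<exists>z\<in>\<Gamma>. s z \<noteq> 0" "\<And>z. z \<in> zclosure \<Gamma> \<Longrightarrow> s z \<noteq> 0 \<Longrightarrow> z \<in> \<Gamma>"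
  obtains f where "f \<in> polyfun" "\<exists>x\<in>X. f x \<noteq> 0"
    "\<And>x y. x \<in> X \<Longrightarrow> f x \<noteq> 0 \<Longrightarrow> pair_pt x y \<in> zclosure \<Gamma> \<Longrightarrow> y \<in> zclosure {y. pair_pt x y \<in> \<Gamma>}"
proof -
  let ?R = "polyfun :: (('i + 'j \<Rightarrow> 'k) \<Rightarrow> 'k) set"
  let ?lift = "\<lambda>g (z :: 'i + 'j \<Rightarrow> 'k). g (z \<circ> Inl)"
  let ?A = "?lift ` polyfun" and ?P = "?lift ` vanish X"
  have sr: "subring_set ?R" by (rule subring_polyfun)
  define I where "I = vanish \<Gamma>"
  have I: "ideal_of ?R I" unfolding I_def by (rule ideal_vanish)
  note prime = prime_vanish[OF \<Gamma>(1), folded I_def]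
  have PI: "?P \<subseteq> I" using \<Gamma>(2) polyfun_fst by (auto simp: I_def vanish_def)
  define J where "J = {s * G + F | G F. G \<in> ?R \<and> F \<in> I}"
  have JI: "s * G + F \<in> J" if "G \<in> ?R" "F \<in> I" for G F using that unfolding J_def by blast
  have J: "ideal_of ?R J"
    unfolding J_def by (rule ideal_combination[OF sr s(1) ideal_self[OF sr] I])
  have PJ: "?P \<subseteq> J"
  proof
    fix p assume "p \<in> ?P"
    thus "p \<in> J" using JI[OF subring_0[OF sr], of p] PI by auto
  qed
  obtain f0 where f0: "f0 \<in> ?A - ?P" and flat: "\<And>N T e. N \<in> fibre_ideal ` X \<Longrightarrow> ideal_of ?R T \<Longrightarrow>
      T \<subseteq> J \<inter> N \<Longrightarrow> ?P \<subseteq> T \<Longrightarrow> (\<forall>m\<in>?A \<inter> N. \<forall>j\<in>J. m * j \<in> T) \<Longrightarrow> e \<in> J \<inter> N \<Longrightarrow> \<exists>n. f0 ^ n * e \<in> T"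
    using generically_flat_polyfun[OF X, where ?'j = 'j] J PJ unfolding generically_flat_def by metis
  obtain f where f: "f \<in> polyfun" "f0 = ?lift f" "f \<notin> vanish X" using f0 by blast
  have f0R: "f0 \<in> ?R" using polyfun_fst f by auto
  have sI: "s \<notin> I" using s(2) by (auto simp: I_def vanish_def)
  have nzd: "\<exists>F'\<in>I. \<forall>y. G (pair_pt x y) = F' (pair_pt x y)"
    if x: "x \<in> X" "f x \<noteq> 0" and G: "G \<in> ?R" and F: "F \<in> I"
      and eq: "\<And>y. s (pair_pt x y) * G (pair_pt x y) = F (pair_pt x y)" for x G F
  proof -
    define N :: "(('i + 'j \<Rightarrow> 'k) \<Rightarrow> 'k) set" where "N = fibre_ideal x"
    have N: "ideal_of UNIV N" by (auto simp: ideal_of_def N_def fibre_ideal_def)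
    \<comment> \<open>This ideal contains the products of elements of \<open>J\<close> with base
      functions vanishing at \<open>x\<close>. Once a multiple of \<open>s * G - F\<close> lies in
      it, the relation on the fibre lifts to a relation modulo \<open>I\<close> for a function
      agreeing on the fibre with a multiple of \<open>G\<close>, and there \<open>s\<close> can be
      cancelled.\<close>
    define T where "T = {s * g + h | g h. g \<in> N \<inter> ?R \<and> h \<in> I \<inter> N}"
    have TI: "s * g + h \<in> T" if "g \<in> N" "g \<in> ?R" "h \<in> I" "h \<in> N" for g h
      using that unfolding T_def by blast
    have TJ: "T \<subseteq> J" unfolding T_def J_def by blast
    have "T = {s * g + h | g h. g \<in> N \<inter> ?R \<and> h \<in> I \<inter> (N \<inter> ?R)}"
      using ideal_sub[OF I] unfolding T_def by blast
    hence "ideal_of ?R T"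
      using ideal_combination[OF sr s(1) ideal_restrict[OF sr N] ideal_Int[OF I ideal_restrict[OF sr N]]]
      by simp
    moreover have "T \<subseteq> J \<inter> N"
      using TJ ideal_add[OF N] ideal_mult[OF N] unfolding T_def by blast
    moreover have "?P \<subseteq> T"
    proof
      fix p assume p: "p \<in> ?P"
      hence "p \<in> I" "p \<in> N" using PI x by (auto simp: N_def fibre_ideal_def vanish_def)
      thus "p \<in> T" using TI[of 0 p] ideal_0[OF N] subring_0[OF sr] by simp
    qed
    moreover have "\<forall>m\<in>?A \<inter> N. \<forall>j\<in>J. m * j \<in> T"
    proof (intro ballI)
      fix m j assume m: "m \<in> ?A \<inter> N" and "j \<in> J"
      then obtain G F where *: "j = s * G + F" "G \<in> ?R" "F \<in> I" unfolding J_def by blast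
      have mR: "m \<in> ?R" using m polyfun_fst by auto
      have "s * (m * G) + m * F \<in> T"
        using * m mR by (intro TI ideal_mult_right[OF N] ideal_mult[OF I] subring_mult[OF sr]) auto
      thus "m * j \<in> T" by (simp add: * algebra_simps)
    qed
    moreover have "s * G - F \<in> J \<inter> N"
      using JI[OF G ideal_uminus[OF sr I F]] eq by (simp add: N_def fibre_ideal_def)
    ultimately obtain n where "f0 ^ n * (s * G - F) \<in> T"
      using flat[of N T "s * G - F"] x(1) unfolding N_def by blast
    then obtain g h where gh: "f0 ^ n * (s * G - F) = s * g + h" "g \<in> N" "g \<in> ?R" "h \<in> I"
      unfolding T_def by blast
    have fn: "f0 ^ n \<in> ?R" using f0R by (rule subring_power[OF sr])
    have "s * (f0 ^ n * G - g) = f0 ^ n * F + h" using gh(1) by (simp add: algebra_simps)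
    also have "\<dots> \<in> I" using fn F gh(4) by (intro ideal_add[OF I] ideal_mult[OF I])
    finally have "f0 ^ n * G - g \<in> I"
      using prime_onD[OF prime s(1), of "f0 ^ n * G - g"] sI fn G gh(3)
      by (auto intro: subring_diff[OF sr] subring_mult[OF sr])
    \<comment> \<open>On the fibre \<open>f0\<close> is the nonzero constant \<open>f x\<close>, so
      its power can be divided out.\<close>
    hence "(\<lambda>_. inverse (f x ^ n)) * (f0 ^ n * G - g) \<in> I"
      by (intro ideal_mult[OF I] pf_const)
    moreover have "((\<lambda>_. inverse (f x ^ n)) * (f0 ^ n * G - g)) (pair_pt x y) = G (pair_pt x y)" for y
      using gh(2) x(2) by (simp add: f(2) N_def fibre_ideal_def)
    ultimately show ?thesis by metis
  qed
  have nzd_power: "\<exists>F'\<in>I. \<forall>y. G (pair_pt x y) = F' (pair_pt x y)"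
    if x: "x \<in> X" "f x \<noteq> 0" and G: "G \<in> ?R" and F: "F \<in> I"
      and eq: "\<And>y. s (pair_pt x y) ^ n * G (pair_pt x y) = F (pair_pt x y)" for x G F n
    using F eq
  proof (induction n arbitrary: F)
    case 0
    thus ?case by force
  next
    case (Suc n)
    have "s ^ n * G \<in> ?R" using s(1) G by (intro subring_mult[OF sr] subring_power[OF sr])
    then obtain F' where "F' \<in> I" "\<forall>y. (s ^ n * G) (pair_pt x y) = F' (pair_pt x y)"
      using nzd[OF x _ Suc.prems(1), of "s ^ n * G"] Suc.prems(2) by (auto simp: mult.assoc)
    thus ?case using Suc.IH[of F'] by simp
  qed
  show ?thesis
  proof (rule that[OF f(1)])
    show "\<exists>x\<in>X. f x \<noteq> 0" using f by (auto simp: vanish_def)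
    fix x y0 assume x: "x \<in> X" "f x \<noteq> 0" and y0: "pair_pt x y0 \<in> zclosure \<Gamma>"
    show "y0 \<in> zclosure {y. pair_pt x y \<in> \<Gamma>}"
    proof (rule zclosureI)
      fix g :: "('j \<Rightarrow> 'k) \<Rightarrow> 'k" assume g: "g \<in> polyfun" "\<And>q. q \<in> {y. pair_pt x y \<in> \<Gamma>} \<Longrightarrow> g q = 0"
      \<comment> \<open>The common zeros of this ideal are the fibre of the closure, but it need not
        be radical; hence the powers below.\<close>
      define Ix where "Ix = (\<lambda>F y. F (pair_pt x y)) ` I"
      have Ix: "ideal_of polyfun Ix"
        unfolding ideal_of_def
      proof (intro conjI ballI)
        show "Ix \<subseteq> polyfun" using ideal_sub[OF I] polyfun_pair_right unfolding Ix_def by blast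
        show "0 \<in> Ix" unfolding Ix_def using ideal_0[OF I] by (intro image_eqI[of _ _ 0]) auto
        fix a b assume "a \<in> Ix" "b \<in> Ix"
        then obtain F G where "F \<in> I" "G \<in> I" "a = (\<lambda>y. F (pair_pt x y))" "b = (\<lambda>y. G (pair_pt x y))"
          unfolding Ix_def by blast
        thus "a + b \<in> Ix" unfolding Ix_def
          using ideal_add[OF I] by (intro image_eqI[of _ _ "F + G"]) auto
      next
        fix r a :: "('j \<Rightarrow> 'k) \<Rightarrow> 'k" assume r: "r \<in> polyfun" and "a \<in> Ix"
        then obtain F where F: "F \<in> I" "a = (\<lambda>y. F (pair_pt x y))" unfolding Ix_def by blast
        show "r * a \<in> Ix" unfolding Ix_def
          using ideal_mult[OF I polyfun_snd[OF r] F(1)] F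
          by (intro image_eqI[of _ _ "(\<lambda>z. r (z \<circ> Inr)) * F"]) auto
      qed
      have sg: "(\<lambda>y. s (pair_pt x y) * g y) \<in> polyfun"
        by (intro pf_mult polyfun_pair_right s g)
      have "s (pair_pt x p) * g p = 0" if "\<And>a. a \<in> Ix \<Longrightarrow> a p = 0" for p
      proof (cases "s (pair_pt x p) = 0")
        case False
        have "pair_pt x p \<in> zclosure \<Gamma>"
          using that unfolding zclosure_eq Ix_def I_def by auto
        thus ?thesis using s(3) False g(2) by auto
      qed simp
      then obtain n where "(\<lambda>y. s (pair_pt x y) * g y) ^ n \<in> Ix"
        using nullstellensatz[OF Ix sg] by blast
      then obtain F where F: "F \<in> I" "(\<lambda>y. s (pair_pt x y) * g y) ^ n = (\<lambda>y. F (pair_pt x y))"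
        unfolding Ix_def by blast
      define G :: "('i + 'j \<Rightarrow> 'k) \<Rightarrow> 'k" where "G = (\<lambda>z. g (z \<circ> Inr) ^ n)"
      have G: "G \<in> ?R" unfolding G_def by (intro polyfun_power polyfun_snd g)
      have "s (pair_pt x y) ^ n * G (pair_pt x y) = F (pair_pt x y)" for y
        using fun_cong[OF F(2), of y] by (simp add: G_def power_mult_distrib)
      then obtain F' where F': "F' \<in> I" "\<forall>y. G (pair_pt x y) = F' (pair_pt x y)"
        using nzd_power[OF x G F(1)] by blast
      have "F' (pair_pt x y0) = 0" using F'(1) y0 unfolding zclosure_eq I_def by blast
      hence "g y0 ^ n = 0" using F'(2) by (simp add: G_def)
      thus "g y0 = 0" by simp
    qed
  qed
qed

section \<open>Dimension\<close>

text \<open>Affine spaces of all dimensions are realised inside \<open>nat \<Rightarrow> 'k\<close>, so that one can argue by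
  induction on the dimension.\<close>

definition aspace :: "nat \<Rightarrow> (nat \<Rightarrow> 'k::comm_ring_1) set" where
  "aspace n = {t. \<forall>j\<ge>n. t j = 0}"

lemma aspace_0: "aspace 0 = {\<lambda>_. 0}"
  by (auto simp: aspace_def)

lemma aspace_upd: "t \<in> aspace n \<Longrightarrow> t(n := c) \<in> aspace (Suc n)"
  and aspace_upd_0: "t \<in> aspace (Suc n) \<Longrightarrow> t(n := 0) \<in> aspace n"
  by (auto simp: aspace_def Suc_le_eq)

lemma polymap_upd:
  assumes "polymap \<phi>" "f \<in> polyfun"
  shows "polymap (\<lambda>p. (\<phi> p)(j := f p))"
  unfolding polymap_def
proof
  fix i show "(\<lambda>p. ((\<phi> p)(j := f p)) i) \<in> polyfun"
    using assms by (cases "i = j") (auto simp: polymap_def)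
qed

lemma polyfun_line:
  assumes "f \<in> polyfun"
  shows "\<exists>p. \<forall>c. f (t(j := c)) = poly p c"
  using assms
proof induction
  case (pf_const d)
  show ?case by (rule exI[of _ "[:d:]"]) simp
next
  case (pf_coord i)
  show ?case by (rule exI[of _ "if i = j then [:0, 1:] else [:t i:]"]) simp
next
  case (pf_add f g)
  then obtain p q where "\<forall>c. f (t(j := c)) = poly p c" "\<forall>c. g (t(j := c)) = poly q c" by blast
  hence "\<forall>c. f (t(j := c)) + g (t(j := c)) = poly (p + q) c" by (metis poly_add)
  thus ?case by blast
next
  case (pf_mult f g)
  then obtain p q where "\<forall>c. f (t(j := c)) = poly p c" "\<forall>c. g (t(j := c)) = poly q c" by blast
  hence "\<forall>c. f (t(j := c)) * g (t(j := c)) = poly (p * q) c" by (metis poly_mult)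
  thus ?case by blast
qed

lemma polyfun_line_nonzero:
  fixes f :: "('i \<Rightarrow> 'k::alg_closed_field) \<Rightarrow> 'k"
  assumes "f \<in> polyfun" "f t \<noteq> 0" "finite S"
  obtains c where "c \<notin> S" "f (t(j := c)) \<noteq> 0"
proof -
  obtain p where p: "\<forall>c. f (t(j := c)) = poly p c" using polyfun_line[OF assms(1)] by blast
  have "poly p (t j) \<noteq> 0" using p assms(2) by (metis fun_upd_triv)
  hence "p \<noteq> 0" by auto
  hence "finite ({c. poly p c = 0} \<union> S)" using poly_roots_finite assms(3) by blast
  then obtain c where "c \<notin> {c. poly p c = 0} \<union> S"
    using ex_new_if_finite[OF infinite_alg_closed] by blast
  thus ?thesis using that p by auto
qed

lemma zirreducible_aspace: "zirreducible (aspace n :: (nat \<Rightarrow> 'k::alg_closed_field) set)"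
proof (induction n)
  case 0
  show ?case unfolding aspace_0 by (rule zirreducible_singleton)
next
  case (Suc n)
  show ?case unfolding zirreducible_iff
  proof (intro conjI ballI impI)
    show "aspace (Suc n) \<noteq> {}" by (auto simp: aspace_def intro: exI[of _ "\<lambda>_. 0"])
    fix f g :: "(nat \<Rightarrow> 'k) \<Rightarrow> 'k"
    assume fg: "f \<in> polyfun" "g \<in> polyfun" "\<forall>p\<in>aspace (Suc n). f p * g p = 0"
    show "(\<forall>p\<in>aspace (Suc n). f p = 0) \<or> (\<forall>p\<in>aspace (Suc n). g p = 0)"
    proof (rule ccontr)
      assume "\<not> ?thesis"
      then obtain t u where t: "t \<in> aspace (Suc n)" "f t \<noteq> 0" and u: "u \<in> aspace (Suc n)" "g u \<noteq> 0" by blast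
      \<comment> \<open>Restricted to these lines in the direction of the last coordinate,
        \<open>f\<close> and \<open>g\<close> are nonzero polynomials, so some value
        \<open>c\<close> of that coordinate keeps both nonzero. Fixing it reduces the claim to
        \<open>aspace n\<close>.\<close>
      obtain p where p: "\<And>c. f (t(n := c)) = poly p c" using polyfun_line[OF fg(1)] by blast
      obtain q where q: "\<And>c. g (u(n := c)) = poly q c" using polyfun_line[OF fg(2)] by blast
      have "poly p (t n) \<noteq> 0" "poly q (u n) \<noteq> 0" using p[of "t n"] q[of "u n"] t u by auto
      hence "p * q \<noteq> 0" by auto
      then obtain c where "poly (p * q) c \<noteq> 0"
        using ex_new_if_finite[OF infinite_alg_closed poly_roots_finite] by blast
      hence c: "f ((t(n := 0))(n := c)) \<noteq> 0" "g ((u(n := 0))(n := c)) \<noteq> 0" by (auto simp flip: p q)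
      have up: "polymap (\<lambda>p :: nat \<Rightarrow> 'k. p(n := c))"
        by (intro polymap_upd polymap_id pf_const)
      have "\<forall>p\<in>aspace n. f (p(n := c)) * g (p(n := c)) = 0" using fg(3) aspace_upd by blast
      hence "(\<forall>p\<in>aspace n. f (p(n := c)) = 0) \<or> (\<forall>p\<in>aspace n. g (p(n := c)) = 0)"
        using Suc[unfolded zirreducible_iff, THEN conjunct2, rule_format,
            OF polyfun_subst[OF up fg(1)] polyfun_subst[OF up fg(2)]] by blast
      thus False using c aspace_upd_0[OF t(1)] aspace_upd_0[OF u(1)] by blast
    qed
  qed
qed

section \<open>Dominating maps, a substitute for algebraically independent functions, and
  chains\<close>

definition dominating :: "(('i \<Rightarrow> 'k::comm_ring_1) \<Rightarrow> nat \<Rightarrow> 'k) \<Rightarrow> nat \<Rightarrow> ('i \<Rightarrow> 'k) set \<Rightarrow> bool" where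
  "dominating y n W \<longleftrightarrow> polymap y \<and> (\<forall>p. y p \<in> aspace n) \<and> aspace n \<subseteq> zclosure (y ` W)"

lemma dominatingD: "dominating y n W \<Longrightarrow> f \<in> polyfun \<Longrightarrow> (\<And>p. p \<in> W \<Longrightarrow> f (y p) = 0) \<Longrightarrow> t \<in> aspace n \<Longrightarrow> f t = 0"
  unfolding dominating_def by (auto intro!: zclosureD[of t "y ` W" f])

lemma dominating_mono: "dominating y n W \<Longrightarrow> W \<subseteq> W' \<Longrightarrow> dominating y n W'"
  unfolding dominating_def using zclosure_mono[OF image_mono] by blast

lemma dominating_zclosure_iff: "dominating y n (zclosure W) \<longleftrightarrow> dominating y n W"
proof
  assume *: "dominating y n (zclosure W)"
  hence p: "polymap y" by (simp add: dominating_def)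
  have "y ` zclosure W \<subseteq> zclosure (y ` W)" using zclosure_image[OF p] by blast
  hence "zclosure (y ` zclosure W) \<subseteq> zclosure (y ` W)"
    using zclosure_minimal[OF _ zclosed_zclosure] by blast
  thus "dominating y n W" using * unfolding dominating_def by blast
qed (rule dominating_mono[OF _ zclosure_superset])

definition chain_in :: "nat \<Rightarrow> ('i \<Rightarrow> 'k::comm_ring_1) set \<Rightarrow> bool" where
  "chain_in n W \<longleftrightarrow> (\<exists>Z. (\<forall>j\<le>n. zclosed (Z j) \<and> zirreducible (Z j) \<and> Z j \<subseteq> W) \<and> (\<forall>j<n. Z j \<subset> Z (Suc j)))"

lemma chain_in_mono:
  assumes "chain_in n W" "W \<subseteq> W'"
  shows "chain_in n W'"
proof -
  obtain Z where "\<forall>j\<le>n. zclosed (Z j) \<and> zirreducible (Z j) \<and> Z j \<subseteq> W" "\<forall>j<n. Z j \<subset> Z (Suc j)"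
    using assms(1) unfolding chain_in_def by blast
  thus ?thesis unfolding chain_in_def using assms(2) by (intro exI[of _ Z]) blast
qed

lemma chain_in_le:
  assumes "chain_in n W" "m \<le> n"
  shows "chain_in m W"
proof -
  obtain Z where "\<forall>j\<le>n. zclosed (Z j) \<and> zirreducible (Z j) \<and> Z j \<subseteq> W" "\<forall>j<n. Z j \<subset> Z (Suc j)"
    using assms(1) unfolding chain_in_def by blast
  thus ?thesis unfolding chain_in_def using assms(2) by (intro exI[of _ Z]) auto
qed

lemma chain_in_extend:
  assumes "chain_in n Z" "Z \<subset> V" "zclosed V" "zirreducible V"
  shows "chain_in (Suc n) V"
proof -
  obtain C where C: "\<And>j. j \<le> n \<Longrightarrow> zclosed (C j) \<and> zirreducible (C j) \<and> C j \<subseteq> Z" "\<And>j. j < n \<Longrightarrow> C j \<subset> C (Suc j)"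
    using assms(1) unfolding chain_in_def by blast
  define C' where "C' j = (if j \<le> n then C j else V)" for j
  have "zclosed (C' j) \<and> zirreducible (C' j) \<and> C' j \<subseteq> V" if "j \<le> Suc n" for j
    using C(1)[of j] assms unfolding C'_def by auto
  moreover have "C' j \<subset> C' (Suc j)" if "j < Suc n" for j
    using C(1)[of j] C(2)[of j] assms(2) that unfolding C'_def by (cases "j < n") auto
  ultimately show ?thesis unfolding chain_in_def by blast
qed

lemma chain_in_top:
  assumes "chain_in n W"
  obtains Z where "zclosed Z" "zirreducible Z" "Z \<subseteq> W" "chain_in n Z"
proof -
  obtain C where C: "\<And>j. j \<le> n \<Longrightarrow> zclosed (C j) \<and> zirreducible (C j) \<and> C j \<subseteq> W" "\<And>j. j < n \<Longrightarrow> C j \<subset> C (Suc j)"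
    using assms unfolding chain_in_def by blast
  have "C j \<subseteq> C n" if "j \<le> n" for j
    using that C(2) by (induction rule: inc_induct) auto
  hence "chain_in n (C n)" unfolding chain_in_def using C by blast
  thus ?thesis using that[of "C n"] C(1)[of n] by blast
qed

text \<open>The supremum in \<open>enat\<close> may be infinite, but every finite lower bound is
  realised by truncating a longer chain. For the bound 0 the chain is a point of
  \<open>S\<close>.\<close>

lemma zdim_ge_iff:
  fixes S :: "('i \<Rightarrow> 'k::idom) set"
  assumes "S \<noteq> {}"
  shows "enat n \<le> zdim S \<longleftrightarrow> chain_in n (zclosure S)"
proof -
  have eq: "zdim S = (SUP n \<in> {n. chain_in n (zclosure S)}. enat n)"
    unfolding zdim_def chain_in_def ..
  show ?thesis
  proof
    assume "chain_in n (zclosure S)"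
    thus "enat n \<le> zdim S" unfolding eq by (intro SUP_upper) simp
  next
    assume le: "enat n \<le> zdim S"
    show "chain_in n (zclosure S)"
    proof (cases n)
      case 0
      obtain p where "p \<in> S" using assms by blast
      hence "{p} \<subseteq> zclosure S" using zclosure_superset by blast
      thus ?thesis unfolding chain_in_def 0
        by (intro exI[of _ "\<lambda>_. {p}"]) (auto simp: zclosed_singleton zirreducible_singleton)
    next
      case (Suc m)
      hence "enat m < zdim S" using le by (metis Suc_ile_eq)
      then obtain a where "chain_in a (zclosure S)" "m < a"
        unfolding eq less_SUP_iff by auto
      thus ?thesis using chain_in_le Suc by (metis Suc_leI)
    qed
  qed
qed

text \<open>Expansion in powers of coordinate \<open>j\<close>. The coefficients are functions of
  all coordinates evaluated at \<open>t(j := 0)\<close>, which avoids a separate type with one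
  coordinate fewer.\<close>

lemma polyfun_expand:
  fixes f :: "('i \<Rightarrow> 'k::field) \<Rightarrow> 'k"
  assumes "f \<in> polyfun"
  shows "\<exists>q\<in>polys_over polyfun. \<forall>t. f t = poly (map_poly (\<lambda>g. g (t(j := 0))) q) (t j)"
proof -
  let ?e = "\<lambda>t (g :: ('i \<Rightarrow> 'k) \<Rightarrow> 'k). g (t(j := 0))"
  have A: "subring_set (polyfun :: (('i \<Rightarrow> 'k) \<Rightarrow> 'k) set)" by (rule subring_polyfun)
  have hom: "hom_on polyfun (?e t)" for t by (simp add: hom_on_def)
  show ?thesis
    using assms
  proof induction
    case (pf_const c)
    show ?case by (rule bexI[of _ "[:\<lambda>_. c:]"])
      (auto simp: map_poly_pCons intro: polys_over_intros[OF A] polyfun.pf_const)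
  next
    case (pf_coord i)
    show ?case
    proof (cases "i = j")
      case True
      show ?thesis by (rule bexI[of _ "[:0, 1:]"])
        (auto simp: True map_poly_pCons intro: polys_over_intros[OF A] subring_intros[OF A])
    next
      case False
      show ?thesis by (rule bexI[of _ "[:\<lambda>t. t i:]"])
        (auto simp: False map_poly_pCons intro: polys_over_intros[OF A] polyfun.pf_coord)
    qed
  next
    case (pf_add f g)
    then obtain q r where qr: "q \<in> polys_over polyfun" "r \<in> polys_over polyfun"
      "\<And>t. f t = poly (map_poly (?e t) q) (t j)" "\<And>t. g t = poly (map_poly (?e t) r) (t j)" by blast
    show ?case
      by (rule bexI[of _ "q + r"], simp only: qr(3,4) map_poly_hom_add[OF A hom qr(1,2)] poly_add)
        (rule allI, rule refl, rule polys_over_add[OF A qr(1,2)])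
  next
    case (pf_mult f g)
    then obtain q r where qr: "q \<in> polys_over polyfun" "r \<in> polys_over polyfun"
      "\<And>t. f t = poly (map_poly (?e t) q) (t j)" "\<And>t. g t = poly (map_poly (?e t) r) (t j)" by blast
    show ?case
      by (rule bexI[of _ "q * r"], simp only: qr(3,4) map_poly_hom_mult[OF A hom qr(1,2)] poly_mult)
        (rule allI, rule refl, rule polys_over_mult[OF A qr(1,2)])
  qed
qed

text \<open>A function \<open>f\<close> that vanishes on \<open>Z\<close> but not on
  \<open>V\<close> is algebraically independent of \<open>y\<close> on \<open>V\<close>. In a
  polynomial relation between \<open>f\<close> and \<open>y\<close> on \<open>V\<close>, restriction
  to \<open>Z\<close> leaves the constant term, which is 0 because \<open>y\<close> dominates on
  \<open>Z\<close>. What remains is a multiple of \<open>f\<close>, and \<open>f\<close> cancels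
  since \<open>V\<close> is irreducible.\<close>

lemma dominating_extend:
  fixes Z V :: "('i \<Rightarrow> 'k::field) set"
  assumes y: "dominating y n Z" and ZV: "Z \<subseteq> V" and V: "zirreducible V"
    and f: "f \<in> polyfun" "\<And>p. p \<in> Z \<Longrightarrow> f p = 0" "v \<in> V" "f v \<noteq> 0"
  shows "dominating (\<lambda>p. (y p)(n := f p)) (Suc n) V"
proof -
  let ?ev = "\<lambda>t (g :: (nat \<Rightarrow> 'k) \<Rightarrow> 'k). g t"
  have yp: "polymap y" "\<And>p. y p \<in> aspace n" using y by (auto simp: dominating_def)
  have key: "map_poly (?ev t) q = 0"
    if "q \<in> polys_over polyfun" "\<And>p. p \<in> V \<Longrightarrow> poly (map_poly (?ev (y p)) q) (f p) = 0" "t \<in> aspace n" for q t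
    using that
  proof (induction q arbitrary: t)
    case (pCons a q)
    have a: "a \<in> polyfun" and q: "q \<in> polys_over polyfun"
      using pCons.prems(1) by (auto simp: polys_over_def coeff_pCons split: nat.splits)
    have eq: "a (y p) + f p * poly (map_poly (?ev (y p)) q) (f p) = 0" if "p \<in> V" for p
      using pCons.prems(2)[OF that] by (simp add: map_poly_pCons)
    have a0: "a t = 0" if "t \<in> aspace n" for t
    proof (rule dominatingD[OF y a _ that])
      fix p assume "p \<in> Z"
      thus "a (y p) = 0" using eq[of p] f(2) ZV by auto
    qed
    have "poly (map_poly (?ev (y p)) q) (f p) = 0" if p: "p \<in> V" for p
    proof -
      have "(\<lambda>p. poly (map_poly (?ev (y p)) q) (f p)) = (\<lambda>p. \<Sum>i\<le>degree q. coeff q i (y p) * f p ^ i)"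
      proof
        fix p
        have "map_poly (?ev (y p)) q = (\<Sum>i\<le>degree q. monom (coeff q i (y p)) i)"
        proof (rule poly_eqI)
          fix k show "coeff (map_poly (?ev (y p)) q) k = coeff (\<Sum>i\<le>degree q. monom (coeff q i (y p)) i) k"
            by (cases "k \<le> degree q") (auto simp: coeff_map_poly coeff_sum coeff_eq_0)
        qed
        thus "poly (map_poly (?ev (y p)) q) (f p) = (\<Sum>i\<le>degree q. coeff q i (y p) * f p ^ i)"
          by (simp add: poly_sum poly_monom)
      qed
      moreover have "(\<lambda>p. \<Sum>i\<le>degree q. coeff q i (y p) * f p ^ i) \<in> polyfun"
        using q by (intro polyfun_sum pf_mult polyfun_power f(1) polyfun_subst[OF yp(1)] polys_over_coeff)
      ultimately have pf: "(\<lambda>p. poly (map_poly (?ev (y p)) q) (f p)) \<in> polyfun" by simp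
      have "f p * poly (map_poly (?ev (y p)) q) (f p) = 0" if "p \<in> V" for p
        using eq[OF that] a0[OF yp(2)] by simp
      thus ?thesis by (rule zirreducibleD[OF V f(1) pf _ f(3,4) p])
    qed
    hence "map_poly (?ev t) q = 0" using pCons.IH[OF q _ pCons.prems(3)] by blast
    thus ?case using a0[OF pCons.prems(3)] by (simp add: map_poly_pCons)
  qed simp
  show ?thesis unfolding dominating_def
  proof (intro conjI allI subsetI)
    show "polymap (\<lambda>p. (y p)(n := f p))" using yp f by (intro polymap_upd)
    show "(y p)(n := f p) \<in> aspace (Suc n)" for p using yp by (intro aspace_upd)
    fix t :: "nat \<Rightarrow> 'k" assume t: "t \<in> aspace (Suc n)"
    show "t \<in> zclosure ((\<lambda>p. (y p)(n := f p)) ` V)"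
    proof (rule zclosureI)
      fix g :: "(nat \<Rightarrow> 'k) \<Rightarrow> 'k" assume g: "g \<in> polyfun" "\<And>q. q \<in> (\<lambda>p. (y p)(n := f p)) ` V \<Longrightarrow> g q = 0"
      obtain q where q: "q \<in> polys_over polyfun" "\<And>t. g t = poly (map_poly (?ev (t(n := 0))) q) (t n)"
        using polyfun_expand[OF g(1), of n] by blast
      have "poly (map_poly (?ev (y p)) q) (f p) = 0" if "p \<in> V" for p
      proof -
        have "((y p)(n := f p))(n := 0) = y p" using yp(2)[of p] by (auto simp: aspace_def fun_eq_iff)
        thus ?thesis using g(2)[of "(y p)(n := f p)"] that q(2)[of "(y p)(n := f p)"] by simp
      qed
      from key[OF q(1) this aspace_upd_0[OF t]] show "g t = 0" using q(2)[of t] by simp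
    qed
  qed
qed

text \<open>Climbing the chain, each step adjoins a function that vanishes on \<open>Z j\<close> but
  not on \<open>Z (Suc j)\<close>.\<close>

lemma chain_in_imp_dominating:
  fixes W :: "('i \<Rightarrow> 'k::field) set"
  assumes "chain_in n W"
  shows "\<exists>y. dominating y n W"
proof -
  obtain Z where Z: "\<And>j. j \<le> n \<Longrightarrow> zclosed (Z j) \<and> zirreducible (Z j) \<and> Z j \<subseteq> W" "\<And>j. j < n \<Longrightarrow> Z j \<subset> Z (Suc j)"
    using assms unfolding chain_in_def by blast
  have "\<exists>y. dominating y j (Z j)" if "j \<le> n" for j
    using that
  proof (induction j)
    case 0
    obtain p where "p \<in> Z 0" using Z(1)[of 0] zirreducible_nonempty by blast
    hence "dominating (\<lambda>_ _. 0) 0 (Z 0)"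
      unfolding dominating_def aspace_0 polymap_def
      using zclosure_superset[of "(\<lambda>_ _. 0) ` Z 0"] by (auto intro: pf_const)
    thus ?case by blast
  next
    case (Suc j)
    then obtain y where y: "dominating y j (Z j)" by auto
    obtain v where v: "v \<in> Z (Suc j)" "v \<notin> Z j" using Z(2)[of j] Suc.prems by auto
    obtain f where f: "f \<in> polyfun" "\<And>q. q \<in> Z j \<Longrightarrow> f q = 0" "f v \<noteq> 0"
      using zclosed_separate[of "Z j" v] Z(1)[of j] Suc.prems v by auto
    have "Z j \<subseteq> Z (Suc j)" "zirreducible (Z (Suc j))" using Z(1)[of "Suc j"] Z(2)[of j] Suc.prems by auto
    hence "dominating (\<lambda>p. (y p)(j := f p)) (Suc j) (Z (Suc j))"
      using f v(1) by (intro dominating_extend[OF y])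
    thus ?case by blast
  qed
  thus ?thesis using dominating_mono Z(1)[of n] by blast
qed

text \<open>The closures of the images of the components cover the irreducible affine space, so one
  of them contains it.\<close>

lemma irreducible_dominating:
  fixes W :: "('i::finite \<Rightarrow> 'k::alg_closed_field) set"
  assumes W: "zclosed W" and y: "dominating y n W"
  obtains V where "zclosed V" "zirreducible V" "V \<subseteq> W" "dominating y n V"
proof -
  obtain F where F: "finite F" "\<And>V. V \<in> F \<Longrightarrow> zclosed V \<and> zirreducible V" "\<Union>F = W"
    using irreducible_decomposition[OF W] by blast
  have "zclosure (y ` W) \<subseteq> (\<Union>V\<in>F. zclosure (y ` V))"
  proof (rule zclosure_minimal)
    have "y ` V \<subseteq> zclosure (y ` V)" for V by (rule zclosure_superset)
    thus "y ` W \<subseteq> (\<Union>V\<in>F. zclosure (y ` V))" unfolding F(3)[symmetric] by blast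
    show "zclosed (\<Union>V\<in>F. zclosure (y ` V))" using F(1) by (intro zclosed_UN zclosed_zclosure)
  qed
  hence "aspace n \<subseteq> (\<Union>V\<in>F. zclosure (y ` V))" using y unfolding dominating_def by blast
  then obtain V where "V \<in> F" "aspace n \<subseteq> zclosure (y ` V)"
    using zirreducible_cover[OF zirreducible_aspace F(1), of "\<lambda>V. zclosure (y ` V)" n] zclosed_zclosure by blast
  thus ?thesis using that[of V] F y unfolding dominating_def by blast
qed

text \<open>Induction by slicing: fixing the last coordinate of \<open>y\<close> at a suitable value
  cuts out a proper closed subset that still dominates affine space of one dimension less.\<close>

lemma dominating_imp_chain_in:
  fixes W :: "('i::finite \<Rightarrow> 'k::alg_closed_field) set"
  assumes "zclosed W" "dominating y n W"
  shows "chain_in n W"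
  using assms
proof (induction n arbitrary: W y)
  case 0
  have "W \<noteq> {}"
  proof
    assume "W = {}"
    hence "zclosure (y ` W) = {}" using zclosure_closed[OF zclosed_empty] by simp
    thus False using 0(2) unfolding dominating_def aspace_0 by auto
  qed
  then obtain p where "p \<in> W" by blast
  thus ?case unfolding chain_in_def
    by (intro exI[of _ "\<lambda>_. {p}"]) (auto simp: zclosed_singleton zirreducible_singleton)
next
  case (Suc n)
  obtain V where V: "zclosed V" "zirreducible V" "V \<subseteq> W" "dominating y (Suc n) V"
    using irreducible_dominating[OF Suc.prems] by blast
  have y: "polymap y" "\<And>p. y p \<in> aspace (Suc n)" "aspace (Suc n) \<subseteq> zclosure (y ` V)"
    using V(4) by (auto simp: dominating_def)
  obtain s v where s: "s \<in> polyfun" "v \<in> V" "s (y v) \<noteq> 0"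
      "\<And>w. w \<in> zclosure (y ` V) \<Longrightarrow> s w \<noteq> 0 \<Longrightarrow> w \<in> y ` V"
    using image_contains_open[OF V(1,2) y(1)] by metis
  \<comment> \<open>\<open>y v\<close> lies in the open set \<open>s \<noteq> 0\<close> that is
    covered by the image, so the hyperplane through it meets this set in a nonempty, hence dense,
    subset.\<close>
  define c where "c = y v n"
  define W' where "W' = V \<inter> {p. y p n - c = 0}"
  have yn: "(\<lambda>p. y p n - c) \<in> polyfun"
    using y(1) by (intro polyfun_diff pf_const) (simp add: polymap_def)
  have W': "zclosed W'" unfolding W'_def by (rule zclosed_Int[OF V(1) zclosed_zero[OF yn]])
  have up: "polymap (\<lambda>p :: nat \<Rightarrow> 'k. p(n := c))"
    by (intro polymap_upd polymap_id pf_const)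
  have "dominating (\<lambda>p. (y p)(n := 0)) n W'"
    unfolding dominating_def
  proof (intro conjI allI subsetI)
    show "polymap (\<lambda>p. (y p)(n := 0))" by (intro polymap_upd y pf_const)
    show "(y p)(n := 0) \<in> aspace n" for p by (intro aspace_upd_0 y)
    fix t :: "nat \<Rightarrow> 'k" assume t: "t \<in> aspace n"
    show "t \<in> zclosure ((\<lambda>p. (y p)(n := 0)) ` W')"
    proof (rule zclosureI)
      fix g :: "(nat \<Rightarrow> 'k) \<Rightarrow> 'k" assume g: "g \<in> polyfun" "\<And>q. q \<in> (\<lambda>p. (y p)(n := 0)) ` W' \<Longrightarrow> g q = 0"
      have z: "s (u(n := c)) * g u = 0" if u: "u \<in> aspace n" for u
      proof (cases "s (u(n := c)) = 0")
        case False
        have "u(n := c) \<in> zclosure (y ` V)" using y(3) aspace_upd[OF u] by blast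
        from s(4)[OF this False] obtain p where p: "p \<in> V" "y p = u(n := c)" by (metis imageE)
        have "p \<in> W'" using p by (simp add: W'_def)
        moreover have "(y p)(n := 0) = u" using p(2) u by (auto simp: aspace_def fun_eq_iff)
        ultimately show ?thesis using g(2) by force
      qed simp
      show "g t = 0"
        by (rule zirreducibleD[OF zirreducible_aspace polyfun_subst[OF up s(1)] g(1) z
              aspace_upd_0[OF y(2)[of v]] _ t]) (use s(3) in \<open>simp_all add: c_def\<close>)
    qed
  qed
  hence "chain_in n W'" using Suc.IH[OF W'] by blast
  moreover have "W' \<subset> V"
  proof -
    \<comment> \<open>Moving the last coordinate off \<open>c\<close> while keeping
      \<open>s \<noteq> 0\<close> gives a point of \<open>V\<close> outside the slice.\<close>
    obtain e where e: "e \<notin> {c}" "s ((y v)(n := e)) \<noteq> 0"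
      using polyfun_line_nonzero[OF s(1,3)] by (metis finite.emptyI finite.insertI)
    have "(y v)(n := e) \<in> aspace (Suc n)" using y(2)[of v] by (auto simp: aspace_def)
    then obtain p where "p \<in> V" "y p = (y v)(n := e)" using s(4) e(2) y(3) by (metis imageE subsetD)
    hence "p \<in> V" "p \<notin> W'" using e(1) by (auto simp: W'_def)
    thus ?thesis unfolding W'_def by blast
  qed
  ultimately have "chain_in (Suc n) V" using chain_in_extend V by blast
  thus ?case using chain_in_mono V(3) by blast
qed

section \<open>Spaces spanned by monomials and finiteness of dimension\<close>

interpretation funs: vector_space "\<lambda>(c::'k::field) (f :: 'a \<Rightarrow> 'k) p. c * f p"
  by unfold_locales (auto simp: fun_eq_iff algebra_simps)

text \<open>Bounding each exponent rather than the total degree makes counting easy, and the bounds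
  simply add under multiplication.\<close>

definition monomials :: "nat \<Rightarrow> (('i::finite \<Rightarrow> 'k::field) \<Rightarrow> 'k) set" where
  "monomials D = (\<lambda>\<alpha> p. \<Prod>i\<in>UNIV. p i ^ \<alpha> i) ` PiE UNIV (\<lambda>_. {..<D})"

lemma card_monomials: "finite (monomials D :: (('i::finite \<Rightarrow> 'k::field) \<Rightarrow> 'k) set)" "card (monomials D :: (('i::finite \<Rightarrow> 'k::field) \<Rightarrow> 'k) set) \<le> D ^ card (UNIV :: 'i set)"
proof -
  have fin: "finite (PiE (UNIV :: 'i set) (\<lambda>_. {..<D}))" by (intro finite_PiE) auto
  thus "finite (monomials D :: (('i \<Rightarrow> 'k) \<Rightarrow> 'k) set)" unfolding monomials_def by blast
  have "card (monomials D :: (('i \<Rightarrow> 'k) \<Rightarrow> 'k) set) \<le> card (PiE (UNIV :: 'i set) (\<lambda>_. {..<D}))"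
    unfolding monomials_def by (rule card_image_le[OF fin])
  thus "card (monomials D :: (('i \<Rightarrow> 'k) \<Rightarrow> 'k) set) \<le> D ^ card (UNIV :: 'i set)" by (simp add: card_PiE)
qed

lemma monomialI: "(\<And>i. \<alpha> i < D) \<Longrightarrow> (\<lambda>p. \<Prod>i\<in>UNIV. p i ^ \<alpha> i) \<in> monomials D"
  unfolding monomials_def by (intro imageI) auto

lemma monomialE:
  assumes "f \<in> monomials D"
  obtains \<alpha> where "\<And>i. \<alpha> i < D" "f = (\<lambda>p. \<Prod>i\<in>UNIV. p i ^ \<alpha> i)"
  using assms unfolding monomials_def by (auto simp: PiE_def Pi_def)

lemma monomials_mono: "D \<le> E \<Longrightarrow> monomials D \<subseteq> monomials E"
  by (auto elim!: monomialE intro!: monomialI intro: less_le_trans)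

lemma span_monomials_mono: "D \<le> E \<Longrightarrow> funs.span (monomials D) \<subseteq> funs.span (monomials E)"
  by (rule funs.span_mono[OF monomials_mono])

lemma span_monomials_mult:
  fixes f g :: "('i::finite \<Rightarrow> 'k::field) \<Rightarrow> 'k"
  assumes f: "f \<in> funs.span (monomials D)" and g: "g \<in> funs.span (monomials E)"
  shows "(\<lambda>p. f p * g p) \<in> funs.span (monomials (D + E))"
proof -
  have 1: "(\<lambda>p. a p * g p) \<in> funs.span (monomials (D + E))" if a: "a \<in> monomials D" for a
    using g
  proof (induction rule: funs.span_induct_alt)
    case base
    show ?case using funs.span_zero by (simp add: zero_fun_def)
  next
    case (step c b g)
    obtain \<alpha> where \<alpha>: "\<And>i. \<alpha> i < D" "a = (\<lambda>p. \<Prod>i\<in>UNIV. p i ^ \<alpha> i)" using monomialE[OF a] by blast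
    obtain \<beta> where \<beta>: "\<And>i. \<beta> i < E" "b = (\<lambda>p. \<Prod>i\<in>UNIV. p i ^ \<beta> i)" using monomialE[OF step(1)] by blast
    have "(\<lambda>p :: 'i \<Rightarrow> 'k. \<Prod>i\<in>UNIV. p i ^ (\<alpha> i + \<beta> i)) \<in> monomials (D + E)"
      using \<alpha>(1) \<beta>(1) by (intro monomialI) (simp add: add_strict_mono)
    moreover have "(\<lambda>p. \<Prod>i\<in>UNIV. p i ^ (\<alpha> i + \<beta> i)) = (\<lambda>p. a p * b p)"
      by (simp add: \<alpha> \<beta> power_add prod.distrib)
    ultimately have "(\<lambda>p. a p * b p) \<in> monomials (D + E)" by (simp only:)
    hence "(\<lambda>p. a p * b p) \<in> funs.span (monomials (D + E))" by (rule funs.span_base)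
    hence "(\<lambda>p. c * (a p * b p)) + (\<lambda>p. a p * g p) \<in> funs.span (monomials (D + E))"
      using step(2) by (intro funs.span_add funs.span_scale)
    thus ?case by (simp add: plus_fun_def algebra_simps)
  qed
  show ?thesis
    using f
  proof (induction rule: funs.span_induct_alt)
    case base
    show ?case using funs.span_zero by (simp add: zero_fun_def)
  next
    case (step c a f)
    have "(\<lambda>p. c * (a p * g p)) + (\<lambda>p. f p * g p) \<in> funs.span (monomials (D + E))"
      by (intro funs.span_add funs.span_scale 1[OF step(1)] step(2))
    thus ?case by (simp add: plus_fun_def algebra_simps)
  qed
qed

lemma const_in_span_monomials:
  fixes c :: "'k::field"
  assumes "D \<ge> 1"
  shows "(\<lambda>_ :: 'i::finite \<Rightarrow> 'k. c) \<in> funs.span (monomials D)"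
proof -
  have "(\<lambda>p :: 'i \<Rightarrow> 'k. \<Prod>i\<in>UNIV. p i ^ 0) \<in> monomials D" using assms by (intro monomialI) simp
  hence "(\<lambda>p :: 'i \<Rightarrow> 'k. c * (\<Prod>i\<in>UNIV. p i ^ 0)) \<in> funs.span (monomials D)"
    by (intro funs.span_scale funs.span_base)
  thus ?thesis by simp
qed

lemma polyfun_in_span_monomials:
  fixes f :: "('i::finite \<Rightarrow> 'k::field) \<Rightarrow> 'k"
  assumes "f \<in> polyfun"
  obtains D where "f \<in> funs.span (monomials D)"
proof -
  have "\<exists>D. f \<in> funs.span (monomials D)" using assms
  proof induction
    case (pf_const c)
    show ?case using const_in_span_monomials[of 1] by blast
  next
    case (pf_coord i)
    have "(\<lambda>p :: 'i \<Rightarrow> 'k. \<Prod>j\<in>UNIV. p j ^ (if j = i then 1 else 0)) \<in> monomials 2"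
      by (intro monomialI) simp
    moreover have "(\<Prod>j\<in>UNIV. p j ^ (if j = i then 1 else 0)) = p i" for p :: "'i \<Rightarrow> 'k"
      by (subst prod.remove[of _ i]) auto
    ultimately show ?case using funs.span_base by auto
  next
    case (pf_add f g)
    then obtain D E where "f \<in> funs.span (monomials D)" "g \<in> funs.span (monomials E)" by blast
    hence "f + g \<in> funs.span (monomials (max D E))"
      using span_monomials_mono[of D "max D E"] span_monomials_mono[of E "max D E"]
      by (intro funs.span_add) auto
    thus ?case by (auto simp: plus_fun_def)
  next
    case (pf_mult f g)
    thus ?case using span_monomials_mult by blast
  qed
  thus ?thesis using that by blast
qed

text \<open>The summand 1 accounts for the empty product: exponents lie strictly below the bound, so
  the constant 1 needs a bound of at least 1.\<close>

lemma span_monomials_prod: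
  assumes "finite S" "\<And>j. j \<in> S \<Longrightarrow> f j \<in> funs.span (monomials \<delta>)"
  shows "(\<lambda>p. \<Prod>j\<in>S. f j p) \<in> funs.span (monomials (1 + card S * \<delta>))"
  using assms
proof (induction S rule: finite_induct)
  case empty
  show ?case using const_in_span_monomials[of 1 1] by simp
next
  case (insert x S)
  have "(\<lambda>p. f x p * (\<Prod>j\<in>S. f j p)) \<in> funs.span (monomials (\<delta> + (1 + card S * \<delta>)))"
    using insert by (intro span_monomials_mult) auto
  thus ?case using insert by (simp add: algebra_simps)
qed

text \<open>Count Lagrange polynomials on an \<open>n\<close>-dimensional grid with \<open>D\<close> points per axis: pulled back
  along a dominating map they remain linearly independent, but they lie in a space whose
  dimension grows only like a power of \<open>D\<close> with exponent the
  number of coordinates.\<close>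

lemma dominating_le_card:
  fixes y :: "('i::finite \<Rightarrow> 'k::alg_closed_field) \<Rightarrow> nat \<Rightarrow> 'k"
  assumes dom: "dominating y n W"
  shows "n \<le> card (UNIV :: 'i set)"
proof (rule ccontr)
  let ?N = "card (UNIV :: 'i set)"
  assume "\<not> n \<le> ?N"
  hence n: "n \<ge> Suc ?N" by simp
  have yp: "polymap y" using dom by (simp add: dominating_def)
  have "\<exists>D. (\<lambda>p. y p j) \<in> funs.span (monomials D)" for j
    using yp polyfun_in_span_monomials[of "\<lambda>p. y p j"] unfolding polymap_def by metis
  then obtain d where d: "\<And>j. (\<lambda>p. y p j) \<in> funs.span (monomials (d j))" by metis
  define \<delta> where "\<delta> = Max (insert 1 (d ` {..<n}))"
  have \<delta>: "\<delta> \<ge> 1" "\<And>j. j < n \<Longrightarrow> d j \<le> \<delta>" unfolding \<delta>_def by (auto intro!: Max_ge)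
  have lin: "(\<lambda>p. y p j - c) \<in> funs.span (monomials \<delta>)" if "j < n" for j c
  proof -
    have "(\<lambda>p. y p j) - (\<lambda>_. c) \<in> funs.span (monomials \<delta>)"
      using d[of j] span_monomials_mono[OF \<delta>(2)[OF that]] const_in_span_monomials[OF \<delta>(1)]
      by (intro funs.span_diff) auto
    thus ?thesis by (simp add: fun_diff_def)
  qed
  \<comment> \<open>Chosen larger than \<open>(1 + n * \<delta>) ^ ?N\<close>, so that the dimension
    bound \<open>D ^ ?N * (1 + n * \<delta>) ^ ?N\<close> stays below \<open>D ^ Suc ?N\<close>,
    hence below the number of grid points.\<close>
  define D where "D = (1 + n * \<delta>) ^ ?N + 1"
  obtain T :: "'k set" where T: "finite T" "card T = D"
    using infinite_arbitrarily_large[OF infinite_alg_closed] by blast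
  define G where "G = PiE {..<n} (\<lambda>_. T)"
  have G: "finite G" "card G = D ^ n" unfolding G_def using T by (auto simp: card_PiE finite_PiE)
  define S where "S \<tau> = Sigma {..<n} (\<lambda>j. T - {\<tau> j})" for \<tau> :: "nat \<Rightarrow> 'k"
  have finS: "finite (S \<tau>)" for \<tau> unfolding S_def using T by auto
  have cardS: "card (S \<tau>) \<le> n * D" for \<tau>
  proof -
    have "S \<tau> \<subseteq> {..<n} \<times> T" unfolding S_def by auto
    hence "card (S \<tau>) \<le> card ({..<n} \<times> T)" using T by (intro card_mono) auto
    thus ?thesis using T by (simp add: card_cartesian_product)
  qed
  \<comment> \<open>All wrong values on all axes occur as factors, so this vanishes at every grid
    point other than \<open>\<tau>\<close>.\<close>
  define L where "L \<tau> t = (\<Prod>(j, c)\<in>S \<tau>. t j - c)" for \<tau> t :: "nat \<Rightarrow> 'k"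
  have Lpoly: "L \<tau> \<in> polyfun" for \<tau>
    unfolding L_def case_prod_beta by (intro polyfun_prod polyfun_diff pf_coord pf_const)
  define ext where "ext \<sigma> j = (if j < n then \<sigma> j else 0)" for \<sigma> :: "nat \<Rightarrow> 'k" and j
  have ext: "ext \<sigma> \<in> aspace n" for \<sigma> by (auto simp: aspace_def ext_def)
  have L_diag: "L \<tau> (ext \<tau>) \<noteq> 0" if "\<tau> \<in> G" for \<tau>
    using finS that by (auto simp: L_def S_def ext_def)
  have L_off: "L \<tau> (ext \<sigma>) = 0" if \<tau>: "\<tau> \<in> G" "\<sigma> \<in> G" "\<tau> \<noteq> \<sigma>" for \<tau> \<sigma>
  proof -
    obtain j where j: "\<tau> j \<noteq> \<sigma> j" using \<tau>(3) by (auto simp: fun_eq_iff)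
    have "j < n"
    proof (rule ccontr)
      assume "\<not> j < n"
      thus False using \<tau>(1,2) j by (auto simp: G_def PiE_def extensional_def)
    qed
    hence "(j, \<sigma> j) \<in> S \<tau>" using \<tau>(2) j by (auto simp: S_def G_def)
    thus ?thesis unfolding L_def using finS[of \<tau>] \<open>j < n\<close>
      by (intro prod_zero) (auto simp: ext_def intro!: bexI[of _ "(j, \<sigma> j)"])
  qed
  define B where "B \<tau> = (\<lambda>p. L \<tau> (y p))" for \<tau>
  have inj: "inj_on B G"
  proof (rule inj_onI, rule ccontr)
    fix \<tau> \<sigma> assume *: "\<tau> \<in> G" "\<sigma> \<in> G" "B \<tau> = B \<sigma>" "\<tau> \<noteq> \<sigma>"
    have "L \<tau> (ext \<sigma>) - L \<sigma> (ext \<sigma>) = 0"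
      using fun_cong[OF *(3)] by (intro dominatingD[OF dom polyfun_diff[OF Lpoly Lpoly] _ ext]) (simp add: B_def)
    thus False using L_diag[OF *(2)] L_off[OF *(1,2,4)] by simp
  qed
  have "funs.independent (B ` G)"
  proof
    assume "funs.dependent (B ` G)"
    then obtain u where u: "\<exists>v\<in>B ` G. u v \<noteq> 0" "(\<Sum>v\<in>B ` G. (\<lambda>p. u v * v p)) = 0"
      using funs.dependent_finite[of "B ` G"] G by auto
    then obtain \<sigma> where \<sigma>: "\<sigma> \<in> G" "u (B \<sigma>) \<noteq> 0" by blast
    have s0: "(\<Sum>\<tau>\<in>G. u (B \<tau>) * L \<tau> (y p)) = 0" for p
    proof -
      have "(\<Sum>v\<in>B ` G. u v * v p) = 0" using fun_cong[OF u(2), of p] by (simp add: sum_fun_apply)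
      hence "(\<Sum>\<tau>\<in>G. u (B \<tau>) * B \<tau> p) = 0" by (simp add: sum.reindex[OF inj])
      thus ?thesis by (simp add: B_def)
    qed
    \<comment> \<open>A linear relation on the image of \<open>y\<close> extends to affine space by
      density and can be evaluated at the grid point of \<open>\<sigma>\<close>, where only one term
      survives.\<close>
    have "(\<lambda>t. \<Sum>\<tau>\<in>G. u (B \<tau>) * L \<tau> t) \<in> polyfun"
      by (intro polyfun_sum pf_mult pf_const Lpoly)
    from dominatingD[OF dom this _ ext[of \<sigma>]] s0 have "(\<Sum>\<tau>\<in>G. u (B \<tau>) * L \<tau> (ext \<sigma>)) = 0"
      by blast
    moreover have "(\<Sum>\<tau>\<in>G. u (B \<tau>) * L \<tau> (ext \<sigma>)) = u (B \<sigma>) * L \<sigma> (ext \<sigma>)"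
      using G(1) \<sigma>(1) L_off by (subst sum.remove[of _ \<sigma>]) (auto intro!: sum.neutral)
    ultimately show False using \<sigma> L_diag by auto
  qed
  moreover have "B ` G \<subseteq> funs.span (monomials (1 + n * D * \<delta>))"
  proof
    fix b assume "b \<in> B ` G"
    then obtain \<tau> where b: "b = B \<tau>" by blast
    have "(\<lambda>p. \<Prod>e\<in>S \<tau>. y p (fst e) - snd e) \<in> funs.span (monomials (1 + card (S \<tau>) * \<delta>))"
      using finS lin by (intro span_monomials_prod) (auto simp: S_def)
    thus "b \<in> funs.span (monomials (1 + n * D * \<delta>))"
      using span_monomials_mono[of "1 + card (S \<tau>) * \<delta>" "1 + n * D * \<delta>"] cardS[of \<tau>]
      by (auto simp: b B_def L_def case_prod_beta)
  qed
  ultimately have "card (B ` G) \<le> card (monomials (1 + n * D * \<delta>) :: (('i \<Rightarrow> 'k) \<Rightarrow> 'k) set)"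
    using funs.independent_span_bound[OF card_monomials(1)] by blast
  also have "\<dots> \<le> (1 + n * D * \<delta>) ^ ?N" by (rule card_monomials(2))
  also have "\<dots> \<le> (D * (1 + n * \<delta>)) ^ ?N"
    by (intro power_mono) (simp_all add: D_def algebra_simps)
  also have "\<dots> = D ^ ?N * (1 + n * \<delta>) ^ ?N" by (rule power_mult_distrib)
  also have "\<dots> < D ^ ?N * D" by (simp add: D_def)
  also have "\<dots> = D ^ Suc ?N" by simp
  also have "\<dots> \<le> D ^ n" using n by (intro power_increasing) (auto simp: D_def)
  also have "\<dots> = card (B ` G)" using card_image[OF inj] G by simp
  finally show False by simp
qed

lemma chain_in_le_card:
  fixes W :: "('i::finite \<Rightarrow> 'k::alg_closed_field) set"
  shows "chain_in n W \<Longrightarrow> n \<le> card (UNIV :: 'i set)"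
  using chain_in_imp_dominating dominating_le_card by blast

section \<open>Semicontinuity\<close>

text \<open>One step of Gaussian elimination with pivot \<open>e m x h\<^sub>0\<close>, which does not vanish at \<open>x = q\<close>,
  avoids determinants.\<close>

lemma generic_independence:
  fixes X :: "('i \<Rightarrow> 'k::field) set" and e :: "'c \<Rightarrow> ('i \<Rightarrow> 'k) \<Rightarrow> 'h \<Rightarrow> 'k"
  assumes X: "zirreducible X" "q \<in> X" and "finite S"
    and "\<And>i h. i \<in> S \<Longrightarrow> h \<in> H \<Longrightarrow> (\<lambda>x. e i x h) \<in> polyfun"
    and "\<And>c. (\<And>h. h \<in> H \<Longrightarrow> (\<Sum>i\<in>S. c i * e i q h) = 0) \<Longrightarrow> \<forall>i\<in>S. c i = 0"
    and "\<And>i. i \<in> S \<Longrightarrow> a i \<in> polyfun"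
    and "\<And>x h. x \<in> X \<Longrightarrow> h \<in> H \<Longrightarrow> (\<Sum>i\<in>S. a i x * e i x h) = 0"
  shows "\<forall>i\<in>S. \<forall>x\<in>X. a i x = 0"
  using assms(3-)
proof (induction S arbitrary: e a rule: finite_induct)
  case (insert m S)
  note e = insert.prems(1) and indep = insert.prems(2) and a = insert.prems(3) and rel = insert.prems(4)
  have "\<exists>h\<in>H. e m q h \<noteq> 0"
  proof (rule ccontr)
    assume "\<not> ?thesis"
    hence "\<forall>i\<in>insert m S. (if i = m then 1 else 0 :: 'k) = 0"
      using insert.hyps by (intro indep) (auto intro!: sum.neutral)
    thus False by auto
  qed
  then obtain h0 where h0: "h0 \<in> H" "e m q h0 \<noteq> 0" by blast
  define e' where "e' i x h = e i x h * e m x h0 - e m x h * e i x h0" for i x h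
  have aS: "\<forall>i\<in>S. \<forall>x\<in>X. a i x = 0"
  proof (rule insert.IH)
    show "(\<lambda>x. e' i x h) \<in> polyfun" if "i \<in> S" "h \<in> H" for i h
      unfolding e'_def using that h0 by (intro polyfun_diff pf_mult e) auto
    show "a i \<in> polyfun" if "i \<in> S" for i using a that by blast
  next
    fix c assume c: "\<And>h. h \<in> H \<Longrightarrow> (\<Sum>i\<in>S. c i * e' i q h) = 0"
    \<comment> \<open>A relation at \<open>q\<close> among the eliminated functions is a relation
      among the original ones, with the coefficient of \<open>e m\<close> determined by the
      others.\<close>
    define C where "C i = (if i = m then - (\<Sum>i\<in>S. c i * e i q h0) else c i * e m q h0)" for i
    have "\<forall>i\<in>insert m S. C i = 0"
    proof (rule indep)
      fix h assume h: "h \<in> H"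
      have "(\<Sum>i\<in>S. C i * e i q h) = (\<Sum>i\<in>S. c i * e m q h0 * e i q h)"
        using insert.hyps by (intro sum.cong) (auto simp: C_def)
      moreover have "C m * e m q h = - (\<Sum>i\<in>S. c i * e i q h0 * e m q h)"
        by (simp add: C_def sum_distrib_right)
      ultimately have "(\<Sum>i\<in>insert m S. C i * e i q h) =
          (\<Sum>i\<in>S. c i * e m q h0 * e i q h) - (\<Sum>i\<in>S. c i * e i q h0 * e m q h)"
        using insert.hyps by simp
      also have "\<dots> = (\<Sum>i\<in>S. c i * e' i q h)"
        by (simp add: e'_def sum_subtractf[symmetric] algebra_simps)
      finally show "(\<Sum>i\<in>insert m S. C i * e i q h) = 0" using c[OF h] by simp
    qed
    thus "\<forall>i\<in>S. c i = 0" using h0(2) insert.hyps by (auto simp: C_def split: if_splits)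
  next
    fix x h assume x: "x \<in> X" and h: "h \<in> H"
    have r: "(\<Sum>i\<in>S. a i x * e i x k) = - (a m x * e m x k)" if "k \<in> H" for k
      using rel[OF x that] insert.hyps by (simp add: eq_neg_iff_add_eq_0 add.commute)
    have "(\<Sum>i\<in>S. a i x * e' i x h) =
        (\<Sum>i\<in>S. a i x * e i x h) * e m x h0 - (\<Sum>i\<in>S. a i x * e i x h0) * e m x h"
      unfolding e'_def sum_distrib_right right_diff_distrib sum_subtractf by (simp only: mult_ac)
    also have "\<dots> = 0" by (simp add: r[OF h] r[OF h0(1)])
    finally show "(\<Sum>i\<in>S. a i x * e' i x h) = 0" .
  qed
  have em: "(\<lambda>x. e m x h0) \<in> polyfun" using e h0(1) by blast
  have am: "a m \<in> polyfun" using a by blast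
  have "e m x h0 * a m x = 0" if x: "x \<in> X" for x
    using rel[OF x h0(1)] aS x insert.hyps by (simp add: mult.commute)
  hence "a m x = 0" if "x \<in> X" for x
    using zirreducibleD[OF X(1) em am _ X(2) h0(2) that] by blast
  thus ?case using aS by blast
qed simp

text \<open>Write \<open>P(x, t)\<close> as a sum of products \<open>a\<^sub>i(x) b\<^sub>i(t)\<close> with as few terms as possible: then the
  \<open>b\<^sub>i\<close> are linearly independent, and so are the \<open>b\<^sub>i(y q h)\<close> as functions of \<open>h\<close>.\<close>

lemma dominating_spreads:
  fixes X :: "('i \<Rightarrow> 'k::field) set" and P :: "('i + nat \<Rightarrow> 'k) \<Rightarrow> 'k"
  assumes X: "zirreducible X" "q \<in> X"
    and poly: "\<And>h j. h \<in> H \<Longrightarrow> polymap (\<lambda>x. y x h)"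
    and dense: "aspace d \<subseteq> zclosure (y q ` H)" and vals: "\<And>x h. y x h \<in> aspace d"
    and P: "P \<in> polyfun" "\<And>x h. x \<in> X \<Longrightarrow> h \<in> H \<Longrightarrow> P (pair_pt x (y x h)) = 0"
    and xt: "x \<in> X" "t \<in> aspace d"
  shows "P (pair_pt x t) = 0"
proof -
  define good where "good S \<longleftrightarrow> finite S \<and> (\<exists>a b. (\<forall>i\<in>S. a i \<in> polyfun \<and> b i \<in> polyfun) \<and>
    (\<forall>x. \<forall>t\<in>aspace d. P (pair_pt x t) = (\<Sum>i\<in>S. a i x * b i t)))" for S :: "nat set"
  obtain l where l: "set l \<subseteq> polyfun \<times> polyfun" "\<forall>x t. P (pair_pt x t) = tensor_sum l x t"
    using polyfun_tensor[OF P(1)] by blast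
  have "good {..<length l}"
    unfolding good_def
  proof (intro conjI exI[of _ "\<lambda>i. fst (l ! i)"] exI[of _ "\<lambda>i. snd (l ! i)"] ballI allI)
    fix i assume "i \<in> {..<length l}"
    hence "l ! i \<in> polyfun \<times> polyfun" using l(1) nth_mem by blast
    thus "fst (l ! i) \<in> polyfun" "snd (l ! i) \<in> polyfun" by auto
  next
    fix x t show "P (pair_pt x t) = (\<Sum>i\<in>{..<length l}. fst (l ! i) x * snd (l ! i) t)"
      using l(2) by (simp add: tensor_sum_def sum_list_sum_nth case_prod_beta atLeast0LessThan)
  qed simp
  then obtain S where S: "good S" "\<And>T. good T \<Longrightarrow> card S \<le> card T"
    using ex_has_least_nat[of good "{..<length l}" card] by blast
  then obtain a b where ab: "finite S" "\<And>i. i \<in> S \<Longrightarrow> a i \<in> polyfun" "\<And>i. i \<in> S \<Longrightarrow> b i \<in> polyfun"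
    "\<And>x t. t \<in> aspace d \<Longrightarrow> P (pair_pt x t) = (\<Sum>i\<in>S. a i x * b i t)"
    unfolding good_def by blast
  have indep: "\<forall>i\<in>S. c i = 0" if c: "\<And>t. t \<in> aspace d \<Longrightarrow> (\<Sum>i\<in>S. c i * b i t) = 0" for c
  proof (rule ccontr)
    assume "\<not> ?thesis"
    then obtain j where j: "j \<in> S" "c j \<noteq> 0" by blast
    \<comment> \<open>The relation expresses \<open>b j\<close> through the other
      \<open>b i\<close>, which would give an expression with fewer terms.\<close>
    define a' where "a' i x = a i x - c i / c j * a j x" for i x
    have "good (S - {j})"
      unfolding good_def
    proof (intro conjI exI[of _ a'] exI[of _ b] ballI allI)
      show "a' i \<in> polyfun" if "i \<in> S - {j}" for i
        unfolding a'_def using that j ab by (intro polyfun_diff pf_mult pf_const) auto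
      show "b i \<in> polyfun" if "i \<in> S - {j}" for i using that ab by blast
      fix x t assume t: "t \<in> (aspace d :: (nat \<Rightarrow> 'k) set)"
      have cj: "(\<Sum>i\<in>S - {j}. c i * b i t) = - (c j * b j t)"
        using c[OF t] sum.remove[OF ab(1) j(1), of "\<lambda>i. c i * b i t"] by (simp add: eq_neg_iff_add_eq_0 add.commute)
      have "(\<Sum>i\<in>S - {j}. a' i x * b i t) =
          (\<Sum>i\<in>S - {j}. a i x * b i t) - a j x / c j * (\<Sum>i\<in>S - {j}. c i * b i t)"
        by (simp add: a'_def sum_distrib_left sum_subtractf[symmetric] algebra_simps)
      also have "\<dots> = (\<Sum>i\<in>S - {j}. a i x * b i t) + a j x * b j t"
        using j(2) unfolding cj by simp
      also have "\<dots> = P (pair_pt x t)"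
        using sum.remove[OF ab(1) j(1), of "\<lambda>i. a i x * b i t"] by (simp add: ab(4)[OF t] add.commute)
      finally show "P (pair_pt x t) = (\<Sum>i\<in>S - {j}. a' i x * b i t)" by simp
    qed (use ab(1) in simp)
    hence "card S \<le> card (S - {j})" by (rule S(2))
    thus False using card_Diff1_less[OF ab(1) j(1)] by simp
  qed
  have "\<forall>i\<in>S. \<forall>x\<in>X. a i x = 0"
  proof (rule generic_independence[OF X ab(1), of H "\<lambda>i x h. b i (y x h)"])
    show "(\<lambda>x. b i (y x h)) \<in> polyfun" if "i \<in> S" "h \<in> H" for i h
      using polyfun_subst[OF poly[OF that(2)] ab(3)[OF that(1)]] .
    show "\<forall>i\<in>S. c i = 0" if c: "\<And>h. h \<in> H \<Longrightarrow> (\<Sum>i\<in>S. c i * b i (y q h)) = 0" for c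
    proof (rule indep)
      fix t assume t: "t \<in> (aspace d :: (nat \<Rightarrow> 'k) set)"
      have "(\<lambda>t. \<Sum>i\<in>S. c i * b i t) \<in> polyfun" by (intro polyfun_sum pf_mult pf_const ab)
      thus "(\<Sum>i\<in>S. c i * b i t) = 0"
        using zclosureD[of t "y q ` H" "\<lambda>t. \<Sum>i\<in>S. c i * b i t"] dense t c by blast
    qed
    show "a i \<in> polyfun" if "i \<in> S" for i using ab that by blast
    show "(\<Sum>i\<in>S. a i x * b i (y x h)) = 0" if "x \<in> X" "h \<in> H" for x h
      using P(2)[OF that] ab(4)[OF vals[of x h], of x] by simp
  qed
  thus ?thesis using ab(4)[OF xt(2), of x] xt(1) by simp
qed

section \<open>Regular actions\<close>

locale algebraic_action =
  fixes G :: "('m::finite \<Rightarrow> 'k::alg_closed_field) monoid"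
    and X :: "('n::finite \<Rightarrow> 'k) set"
    and act :: "('m \<Rightarrow> 'k) \<Rightarrow> ('n \<Rightarrow> 'k) \<Rightarrow> ('n \<Rightarrow> 'k)"
  assumes alg_group: "affine_algebraic_group G"
    and variety: "affine_variety X" and irreducible: "zirreducible X"
    and action: "regular_action G X act"
begin

lemma is_group: "group G" and closed_G: "zclosed (carrier G)" and closed_X: "zclosed X"
  using alg_group variety by (auto simp: affine_algebraic_group_def affine_variety_def)

lemma one_G: "\<one>\<^bsub>G\<^esub> \<in> carrier G"
  and mult_G: "g \<in> carrier G \<Longrightarrow> h \<in> carrier G \<Longrightarrow> g \<otimes>\<^bsub>G\<^esub> h \<in> carrier G"
  and inv_G: "g \<in> carrier G \<Longrightarrow> inv\<^bsub>G\<^esub> g \<in> carrier G"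
  using is_group by (auto simp: group.is_monoid monoid.one_closed monoid.m_closed group.inv_closed)

lemma act_one: "x \<in> X \<Longrightarrow> act \<one>\<^bsub>G\<^esub> x = x"
  and act_mult: "g \<in> carrier G \<Longrightarrow> h \<in> carrier G \<Longrightarrow> x \<in> X \<Longrightarrow> act (g \<otimes>\<^bsub>G\<^esub> h) x = act g (act h x)"
  using action by (auto simp: regular_action_def)

lemma act_closed:
  assumes "h \<in> carrier G" "x \<in> X"
  shows "act h x \<in> X"
proof -
  have "\<forall>z\<in>prod_set (carrier G) X. act (z \<circ> Inl) (z \<circ> Inr) \<in> X"
    using action by (simp add: regular_action_def regular_map_def)
  from bspec[OF this, of "pair_pt h x"] show ?thesis using assms by simp
qed

lemma act_inv: "h \<in> carrier G \<Longrightarrow> x \<in> X \<Longrightarrow> act (inv\<^bsub>G\<^esub> h) (act h x) = x"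
  and act_inv': "h \<in> carrier G \<Longrightarrow> x \<in> X \<Longrightarrow> act h (act (inv\<^bsub>G\<^esub> h) x) = x"
  using act_mult[of "inv\<^bsub>G\<^esub> h" h x] act_mult[of h "inv\<^bsub>G\<^esub> h" x] act_one[of x] inv_G[of h]
  by (auto simp: group.l_inv[OF is_group] group.r_inv[OF is_group])

lemma ex_act_poly: "\<exists>\<alpha>. polymap \<alpha> \<and> (\<forall>h\<in>carrier G. \<forall>x\<in>X. \<alpha> (pair_pt h x) = act h x)"
proof -
  have "\<forall>j. \<exists>g\<in>polyfun. \<forall>z\<in>prod_set (carrier G) X. act (z \<circ> Inl) (z \<circ> Inr) j = g z"
    using action by (simp add: regular_action_def regular_map_def regular_fun_def)
  then obtain g where g: "\<And>j. g j \<in> polyfun"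
      "\<And>j z. z \<in> prod_set (carrier G) X \<Longrightarrow> act (z \<circ> Inl) (z \<circ> Inr) j = g j z" by metis
  have "polymap (\<lambda>z j. g j z)" using g(1) by (simp add: polymap_def)
  moreover have "(\<lambda>j. g j (pair_pt h x)) = act h x" if "h \<in> carrier G" "x \<in> X" for h x
    using g(2)[of "pair_pt h x"] that by (auto simp: fun_eq_iff)
  ultimately show ?thesis by blast
qed

text \<open>\<open>act\<close> is arbitrary away from \<open>carrier G\<close> and \<open>X\<close>.
  This polynomial map on the whole affine space agrees with it there, so that the results on
  closures, images and irreducibility apply.\<close>

definition act_poly :: "('m + 'n \<Rightarrow> 'k) \<Rightarrow> ('n \<Rightarrow> 'k)" where
  "act_poly = (SOME \<alpha>. polymap \<alpha> \<and> (\<forall>h\<in>carrier G. \<forall>x\<in>X. \<alpha> (pair_pt h x) = act h x))"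

lemma polymap_act: "polymap act_poly"
  and act_poly: "h \<in> carrier G \<Longrightarrow> x \<in> X \<Longrightarrow> act_poly (pair_pt h x) = act h x"
  using someI_ex[OF ex_act_poly] by (auto simp: act_poly_def)

lemma polymap_act_left: "polymap (\<lambda>x. act_poly (pair_pt h x))"
  and polymap_act_right: "polymap (\<lambda>h. act_poly (pair_pt h x))"
  by (intro polymap_comp[OF polymap_act] polymap_intros)+

lemma polyfun_translate: "f \<in> polyfun \<Longrightarrow> (\<lambda>x. f (act_poly (pair_pt h x))) \<in> polyfun"
  by (rule polyfun_subst[OF polymap_act_left])

section \<open>Orbits and their closures\<close>

definition sub_orbit :: "('m \<Rightarrow> 'k) set \<Rightarrow> ('n \<Rightarrow> 'k) \<Rightarrow> ('n \<Rightarrow> 'k) set" where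
  "sub_orbit V p = (\<lambda>h. act h p) ` V"

abbreviation "orb \<equiv> orbit G act"

lemma orb_eq: "orb p = sub_orbit (carrier G) p"
  by (simp add: orbit_def sub_orbit_def)

lemma sub_orbit_poly: "V \<subseteq> carrier G \<Longrightarrow> p \<in> X \<Longrightarrow> sub_orbit V p = (\<lambda>h. act_poly (pair_pt h p)) ` V"
  unfolding sub_orbit_def using act_poly by (intro image_cong) auto

lemma sub_orbit_subset: "V \<subseteq> carrier G \<Longrightarrow> sub_orbit V p \<subseteq> orb p"
  by (auto simp: orb_eq sub_orbit_def)

lemma orb_subset: "p \<in> X \<Longrightarrow> orb p \<subseteq> X"
  by (auto simp: orbit_def act_closed)

lemma orb_self: "p \<in> X \<Longrightarrow> p \<in> orb p"
  using act_one one_G by (force simp: orbit_def)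

lemma orb_act:
  assumes h: "h \<in> carrier G" and p: "p \<in> X"
  shows "orb (act h p) = orb p"
proof
  show "orb (act h p) \<subseteq> orb p"
    using act_mult[OF _ h p] mult_G[OF _ h] by (force simp: orbit_def)
  have "act g p = act (g \<otimes>\<^bsub>G\<^esub> inv\<^bsub>G\<^esub> h) (act h p)" if "g \<in> carrier G" for g
    using act_mult[OF that inv_G[OF h] act_closed[OF h p]] act_inv[OF h p] by simp
  thus "orb p \<subseteq> orb (act h p)" using mult_G inv_G[OF h] by (force simp: orbit_def)
qed

lemma orb_closure_subset: "p \<in> X \<Longrightarrow> zclosure (orb p) \<subseteq> X"
  by (rule zclosure_minimal[OF orb_subset closed_X])

text \<open>Translation by \<open>h\<close> is polynomial and maps the orbit into itself, so it maps
  the closure of the orbit into itself.\<close>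

lemma orb_closure_stable:
  assumes p: "p \<in> X" and z: "z \<in> zclosure (orb p)"
  shows "orb z \<subseteq> zclosure (orb p)"
proof
  fix w assume "w \<in> orb z"
  then obtain h where h: "h \<in> carrier G" "w = act h z" by (auto simp: orbit_def)
  have zX: "z \<in> X" using z orb_closure_subset[OF p] by blast
  have "(\<lambda>x. act_poly (pair_pt h x)) ` orb p \<subseteq> orb p"
  proof
    fix v assume "v \<in> (\<lambda>x. act_poly (pair_pt h x)) ` orb p"
    then obtain g where g: "g \<in> carrier G" "v = act_poly (pair_pt h (act g p))" by (auto simp: orbit_def)
    hence "v = act (h \<otimes>\<^bsub>G\<^esub> g) p" using act_poly[OF h(1) act_closed[OF g(1) p]] act_mult[OF h(1) g(1) p] by simp
    thus "v \<in> orb p" using mult_G[OF h(1) g(1)] by (auto simp: orbit_def)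
  qed
  hence "zclosure ((\<lambda>x. act_poly (pair_pt h x)) ` orb p) \<subseteq> zclosure (orb p)" by (rule zclosure_mono)
  moreover have "act_poly (pair_pt h z) \<in> zclosure ((\<lambda>x. act_poly (pair_pt h x)) ` orb p)"
    by (rule zclosure_image[OF polymap_act_left z])
  ultimately show "w \<in> zclosure (orb p)" using act_poly[OF h(1) zX] h(2) by auto
qed

text \<open>\<open>image_contains_open\<close> and \<open>generic_fibre_closure\<close> concern
  irreducible sets, so the group is treated one component at a time.\<close>

lemma components:
  obtains F where "finite F" "\<And>V. V \<in> F \<Longrightarrow> zclosed V" "\<And>V. V \<in> F \<Longrightarrow> zirreducible V"
    "\<And>V. V \<in> F \<Longrightarrow> V \<subseteq> carrier G" "\<Union>F = carrier G"
  using irreducible_decomposition[OF closed_G] by (metis Union_upper)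

section \<open>Invariant functions\<close>

definition invariant :: "(('n \<Rightarrow> 'k) \<Rightarrow> 'k) \<Rightarrow> bool" where
  "invariant f \<longleftrightarrow> f \<in> polyfun \<and> (\<forall>h\<in>carrier G. \<forall>x\<in>X. f (act h x) = f x)"

lemma invariant_imp_inv_regular: "invariant f \<Longrightarrow> inv_regular G X act f"
  unfolding invariant_def inv_regular_def regular_fun_def fun_act_def using inv_G by auto

lemma inv_regular_imp_invariant:
  assumes "inv_regular G X act f"
  obtains f' where "invariant f'" "\<And>x. x \<in> X \<Longrightarrow> f' x = f x"
proof -
  obtain f' where f': "f' \<in> polyfun" "\<And>x. x \<in> X \<Longrightarrow> f x = f' x"
    using assms by (auto simp: inv_regular_def regular_fun_def)
  have "f (act h x) = f x" if h: "h \<in> carrier G" and x: "x \<in> X" for h x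
  proof -
    have "\<forall>h\<in>carrier G. \<forall>x\<in>X. f (act (inv\<^bsub>G\<^esub> h) x) = f x"
      using assms by (simp add: inv_regular_def fun_act_def)
    hence "f (act (inv\<^bsub>G\<^esub> (inv\<^bsub>G\<^esub> h)) x) = f x" using inv_G[OF h] x by blast
    thus ?thesis using group.inv_inv[OF is_group h] by simp
  qed
  hence "invariant f'" unfolding invariant_def using f' act_closed by metis
  thus ?thesis using that f'(2) by metis
qed

lemma invariant_prod: "(\<And>i. i \<in> S \<Longrightarrow> invariant (f i)) \<Longrightarrow> invariant (\<lambda>x. \<Prod>i\<in>S. f i x)"
  unfolding invariant_def by (auto intro!: polyfun_prod prod.cong)

lemma nonzero_mult:
  "f \<in> polyfun \<Longrightarrow> g \<in> polyfun \<Longrightarrow> \<exists>x\<in>X. f x \<noteq> 0 \<Longrightarrow> \<exists>x\<in>X. g x \<noteq> 0 \<Longrightarrow> \<exists>x\<in>X. f x * g x \<noteq> 0"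
  using zirreducible_common_nonzero[OF irreducible, of f g] by auto

lemma nonzero_prod:
  assumes "finite S" "\<And>i. i \<in> S \<Longrightarrow> f i \<in> polyfun" "\<And>i. i \<in> S \<Longrightarrow> \<exists>x\<in>X. f i x \<noteq> 0"
  shows "\<exists>x\<in>X. (\<Prod>i\<in>S. f i x) \<noteq> 0"
  using assms
proof (induction S rule: finite_induct)
  case empty
  show ?case using zirreducible_nonempty[OF irreducible] by auto
next
  case (insert i S)
  have "\<exists>x\<in>X. f i x * (\<Prod>i\<in>S. f i x) \<noteq> 0"
  proof (rule nonzero_mult)
    show "f i \<in> polyfun" "\<exists>x\<in>X. f i x \<noteq> 0" using insert.prems by blast+
    show "(\<lambda>x. \<Prod>i\<in>S. f i x) \<in> polyfun" using insert.prems(1) by (intro polyfun_prod) blast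
    show "\<exists>x\<in>X. (\<Prod>i\<in>S. f i x) \<noteq> 0" using insert.prems by (intro insert.IH) blast+
  qed
  thus ?case using insert.hyps by simp
qed

lemma nonzero_power:
  fixes f :: "('n \<Rightarrow> 'k) \<Rightarrow> 'k"
  shows "\<exists>x\<in>X. f x \<noteq> 0 \<Longrightarrow> \<exists>x\<in>X. f x ^ n \<noteq> 0"
  by (elim bexE, rule bexI) (simp_all add: power_not_zero)

lemma cancel:
  assumes "f \<in> polyfun" "g \<in> polyfun" "h \<in> polyfun" "\<exists>x\<in>X. f x \<noteq> 0"
    "\<And>x. x \<in> X \<Longrightarrow> f x * g x = f x * h x" "x \<in> X"
  shows "g x = h x"
proof -
  obtain x0 where "x0 \<in> X" "f x0 \<noteq> 0" using assms(4) by blast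
  moreover have "f x * (g x - h x) = 0" if "x \<in> X" for x using assms(5)[OF that] by (simp add: algebra_simps)
  ultimately have "g x - h x = 0"
    using zirreducibleD[OF irreducible assms(1) polyfun_diff[OF assms(2,3)]] assms(6) by blast
  thus ?thesis by simp
qed

lemma nonzero_translate:
  assumes "\<exists>x\<in>X. f x \<noteq> 0" "h \<in> carrier G"
  shows "\<exists>x\<in>X. f (act_poly (pair_pt h x)) \<noteq> 0"
proof -
  obtain x where x: "x \<in> X" "f x \<noteq> 0" using assms(1) by blast
  have "act (inv\<^bsub>G\<^esub> h) x \<in> X" using act_closed inv_G assms(2) x by blast
  thus ?thesis using act_poly[OF assms(2)] act_inv'[OF assms(2) x(1)] x(2) by metis
qed

section \<open>Observability implies condition (a)\<close>

lemma observable_invariant: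
  assumes "observable G X act" "zclosed Y" "Y \<subset> X" "\<And>h y. h \<in> carrier G \<Longrightarrow> y \<in> Y \<Longrightarrow> act h y \<in> Y"
  obtains f where "invariant f" "\<exists>x\<in>X. f x \<noteq> 0" "\<And>y. y \<in> Y \<Longrightarrow> f y = 0"
proof -
  have "zclosed_in X Y" using zclosed_in_iff[OF closed_X] assms(2,3) by blast
  moreover have "H_stable G act Y" unfolding H_stable_def using assms(4) by blast
  ultimately obtain f where f: "inv_regular G X act f" "\<exists>x\<in>X. f x \<noteq> 0" "\<forall>y\<in>Y. f y = 0"
    using assms(1,3) unfolding observable_def by blast
  obtain f' where f': "invariant f'" "\<And>x. x \<in> X \<Longrightarrow> f' x = f x"
    using inv_regular_imp_invariant[OF f(1)] by blast
  have "\<exists>x\<in>X. f' x \<noteq> 0" using f(2) f'(2) by auto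
  moreover have "f' y = 0" if "y \<in> Y" for y using f(3) f'(2) assms(3) that by auto
  ultimately show ?thesis using that f'(1) by blast
qed

lemma observable_imp_quotients:
  assumes obs: "observable G X act"
  shows "quotients_of_invariants G X act"
  unfolding quotients_of_invariants_def
proof (intro allI impI)
  fix r assume r: "inv_rational G X act r"
  obtain f where f: "f \<in> polyfun" "\<And>x. x \<in> X \<Longrightarrow> fst r x = f x"
    using r by (auto simp: inv_rational_def rat_rep_def regular_fun_def)
  obtain g where g: "g \<in> polyfun" "\<And>x. x \<in> X \<Longrightarrow> snd r x = g x"
    using r by (auto simp: inv_rational_def rat_rep_def regular_fun_def)
  have g0: "\<exists>x\<in>X. g x \<noteq> 0" using r g(2) by (auto simp: inv_rational_def rat_rep_def)
  \<comment> \<open>\<open>fun_act\<close> acts through the inverse, so the hypothesis is used at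
    the inverse of \<open>h\<close>.\<close>
  have inv: "f (act h x) * g x = f x * g (act h x)" if h: "h \<in> carrier G" and x: "x \<in> X" for h x
  proof -
    have "\<forall>h\<in>carrier G. \<forall>x\<in>X. fst r (act (inv\<^bsub>G\<^esub> h) x) * snd r x = fst r x * snd r (act (inv\<^bsub>G\<^esub> h) x)"
      using r by (simp add: inv_rational_def rat_eq_def fun_act_def)
    hence "fst r (act (inv\<^bsub>G\<^esub> (inv\<^bsub>G\<^esub> h)) x) * snd r x = fst r x * snd r (act (inv\<^bsub>G\<^esub> (inv\<^bsub>G\<^esub> h)) x)"
      using inv_G[OF h] x by blast
    thus ?thesis using group.inv_inv[OF is_group h] f(2) g(2) x act_closed[OF h x] by simp
  qed
  define J where "J = {a \<in> polyfun. \<exists>b\<in>polyfun. \<forall>x\<in>X. a x * f x = b x * g x}"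
  have J: "ideal_of polyfun J"
    unfolding ideal_of_def
  proof (intro conjI ballI)
    show "J \<subseteq> polyfun" unfolding J_def by blast
    show "0 \<in> J" unfolding J_def
      using pf_const[of 0] by (auto simp: zero_fun_def intro!: bexI[of _ "\<lambda>_. 0"])
    fix a a' assume "a \<in> J" "a' \<in> J"
    then obtain b b' where "a \<in> polyfun" "a' \<in> polyfun" "b \<in> polyfun" "b' \<in> polyfun"
      "\<forall>x\<in>X. a x * f x = b x * g x" "\<forall>x\<in>X. a' x * f x = b' x * g x" unfolding J_def by blast
    thus "a + a' \<in> J" unfolding J_def
      using subring_add[OF subring_polyfun, of a a'] pf_add[of b b']
      by (auto simp: algebra_simps intro!: bexI[of _ "\<lambda>x. b x + b' x"])
  next
    fix c a :: "('n \<Rightarrow> 'k) \<Rightarrow> 'k" assume c: "c \<in> polyfun" and "a \<in> J"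
    then obtain b where "a \<in> polyfun" "b \<in> polyfun" "\<forall>x\<in>X. a x * f x = b x * g x" unfolding J_def by blast
    thus "c * a \<in> J" unfolding J_def
      using c subring_mult[OF subring_polyfun, of c a] pf_mult[of c b]
      by (auto simp: mult.assoc intro!: bexI[of _ "\<lambda>x. c x * b x"])
  qed
  define Y where "Y = X \<inter> {x. \<forall>a\<in>J. a x = 0}"
  have "zclosed Y" unfolding Y_def
    using ideal_sub[OF J] by (intro zclosed_Int closed_X zclosed_zeros)
  moreover have "Y \<subset> X"
  proof -
    \<comment> \<open>\<open>g\<close> is itself a denominator and does not vanish on all of
      \<open>X\<close>.\<close>
    have "g \<in> J" unfolding J_def using f g by (auto simp: mult.commute)
    thus ?thesis using g0 unfolding Y_def by blast
  qed
  moreover have "act h y \<in> Y" if h: "h \<in> carrier G" and y: "y \<in> Y" for h y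
  proof -
    have yX: "y \<in> X" using y by (simp add: Y_def)
    have "a (act h y) = 0" if aJ: "a \<in> J" for a
    proof -
      obtain b where ab: "a \<in> polyfun" "b \<in> polyfun" "\<And>x. x \<in> X \<Longrightarrow> a x * f x = b x * g x"
        using aJ unfolding J_def by blast
      let ?t = "\<lambda>u x. u (act_poly (pair_pt h x))"
      \<comment> \<open>Translating a denominator and its numerator gives a denominator again: after
        multiplication with the translate of \<open>g\<close> the invariance of the fraction
        applies, and this factor is then cancelled.\<close>
      have "?t a x * f x = ?t b x * g x" if x: "x \<in> X" for x
      proof (rule cancel[OF polyfun_translate[OF g(1), of h] _ _ nonzero_translate[OF g0 h] _ x])
        show "(\<lambda>x. ?t a x * f x) \<in> polyfun" "(\<lambda>x. ?t b x * g x) \<in> polyfun"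
          by (intro pf_mult polyfun_translate ab f g)+
        fix x assume x: "x \<in> X"
        have "a (act h x) * f (act h x) = b (act h x) * g (act h x)" by (rule ab(3)[OF act_closed[OF h x]])
        hence "g (act h x) * (a (act h x) * f x) = g (act h x) * (b (act h x) * g x)"
          using inv[OF h x] by algebra
        thus "?t g x * (?t a x * f x) = ?t g x * (?t b x * g x)" by (simp add: act_poly[OF h x])
      qed
      hence "\<exists>b\<in>polyfun. \<forall>x\<in>X. ?t a x * f x = b x * g x"
        by (intro bexI[of _ "?t b", OF _ polyfun_translate[OF ab(2)]] ballI)
      hence tJ: "?t a \<in> J" unfolding J_def using polyfun_translate[OF ab(1), of h] by simp
      have "\<forall>a\<in>J. a y = 0" using y unfolding Y_def by blast
      from bspec[OF this tJ] have "?t a y = 0" .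
      thus ?thesis using act_poly[OF h yX] by simp
    qed
    thus ?thesis using act_closed[OF h yX] by (simp add: Y_def)
  qed
  ultimately obtain F where F: "invariant F" "\<exists>x\<in>X. F x \<noteq> 0" "\<And>y. y \<in> Y \<Longrightarrow> F y = 0"
    using observable_invariant[OF obs] by blast
  have Fp: "F \<in> polyfun" using F(1) by (simp add: invariant_def)
  \<comment> \<open>\<open>J\<close> is an ideal of functions on the whole affine space that
    contains those vanishing on \<open>X\<close>, so its zeros lie in \<open>X\<close>.\<close>
  have "F p = 0" if p: "\<And>a. a \<in> J \<Longrightarrow> a p = 0" for p
  proof -
    have "vanish X \<subseteq> J" unfolding J_def vanish_def using pf_const[of 0] by force
    hence "p \<in> X" using p zclosed_eq_zeros[OF closed_X] by blast
    thus ?thesis using p F(3) by (auto simp: Y_def)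
  qed
  then obtain n where "F ^ n \<in> J" using nullstellensatz[OF J Fp] by blast
  then obtain b where b: "b \<in> polyfun" "\<And>x. x \<in> X \<Longrightarrow> F x ^ n * f x = b x * g x"
    unfolding J_def by auto
  \<comment> \<open>\<open>b\<close> is the product of the invariant \<open>F ^ n\<close> and an
    invariant fraction; the factor \<open>?t g x * g x\<close> clears the denominators.\<close>
  have "invariant b"
    unfolding invariant_def
  proof (intro conjI ballI b(1))
    fix h x assume h: "h \<in> carrier G" and x: "x \<in> X"
    let ?t = "\<lambda>u x. u (act_poly (pair_pt h x))"
    have "?t b x = b x"
    proof (rule cancel[OF _ polyfun_translate[OF b(1)] b(1) _ _ x])
      show "(\<lambda>x. ?t g x * g x) \<in> polyfun" by (intro pf_mult polyfun_translate g)
      show "\<exists>x\<in>X. ?t g x * g x \<noteq> 0" by (intro nonzero_mult polyfun_translate g nonzero_translate g0 h)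
      fix x assume x: "x \<in> X"
      have "F (act h x) = F x" using F(1) h x by (simp add: invariant_def)
      hence b': "F x ^ n * f (act h x) = b (act h x) * g (act h x)" using b(2)[OF act_closed[OF h x]] by simp
      have "(g (act h x) * g x) * b (act h x) = F x ^ n * (f (act h x) * g x)"
        using b' by (metis mult.assoc mult.commute)
      also have "\<dots> = (g (act h x) * g x) * b x"
        unfolding inv[OF h x] using b(2)[OF x] by (metis mult.assoc mult.commute)
      finally have "(g (act h x) * g x) * b (act h x) = (g (act h x) * g x) * b x" .
      thus "(?t g x * g x) * ?t b x = (?t g x * g x) * b x" by (simp add: act_poly[OF h x])
    qed
    thus "b (act h x) = b x" by (simp add: act_poly[OF h x])
  qed
  moreover have "invariant (\<lambda>x. F x ^ n)"
    using F(1) unfolding invariant_def by (auto intro: polyfun_power)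
  ultimately show "\<exists>f g. inv_regular G X act f \<and> inv_regular G X act g \<and> (\<exists>x\<in>X. g x \<noteq> 0) \<and> rat_eq X (f, g) r"
    using invariant_imp_inv_regular nonzero_power[OF F(2), of n] b(2) f(2) g(2)
    by (intro exI[of _ b] exI[of _ "\<lambda>x. F x ^ n"]) (auto simp: rat_eq_def mult.commute)
qed

section \<open>Dimension of boundary orbits and of generic orbits\<close>

lemma orbit_closure_components:
  assumes F: "finite F" "\<Union>F = carrier G" and V: "\<And>V. V \<in> F \<Longrightarrow> V \<subseteq> carrier G" and p: "p \<in> X"
  shows "zclosure (orb p) \<subseteq> (\<Union>V\<in>F. zclosure (sub_orbit V p))"
proof (rule zclosure_minimal)
  have "sub_orbit V p \<subseteq> zclosure (sub_orbit V p)" for V by (rule zclosure_superset)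
  thus "orb p \<subseteq> (\<Union>V\<in>F. zclosure (sub_orbit V p))"
    unfolding orb_eq F(2)[symmetric] by (auto simp: sub_orbit_def)
  show "zclosed (\<Union>V\<in>F. zclosure (sub_orbit V p))" using F(1) by (intro zclosed_UN zclosed_zclosure)
qed

lemma zirreducible_sub_orbit:
  assumes "zirreducible V" "V \<subseteq> carrier G" "p \<in> X"
  shows "zirreducible (sub_orbit V p)"
  unfolding sub_orbit_poly[OF assms(2,3)] by (rule zirreducible_image[OF assms(1) polymap_act_right])

text \<open>A component of the closure of the boundary orbit is a closed subset of a component \<open>W\<close> of the
  closure of the big orbit; it is a proper subset, since otherwise both orbits would contain nonempty
  open subsets of \<open>W\<close>.\<close>

lemma boundary_orbit:
  assumes x: "x \<in> X" and z: "z \<in> zclosure (orb x)" "z \<notin> orb x" and ch: "chain_in d (zclosure (orb z))"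
  shows "chain_in (Suc d) (zclosure (orb x))"
proof -
  obtain F where F: "finite F" "\<And>V. V \<in> F \<Longrightarrow> zclosed V" "\<And>V. V \<in> F \<Longrightarrow> zirreducible V"
    "\<And>V. V \<in> F \<Longrightarrow> V \<subseteq> carrier G" "\<Union>F = carrier G" using components by blast
  have zX: "z \<in> X" using z orb_closure_subset[OF x] by blast
  obtain Z where Z: "zirreducible Z" "Z \<subseteq> zclosure (orb z)" "chain_in d Z"
    using chain_in_top[OF ch] by blast
  obtain V where V: "V \<in> F" "Z \<subseteq> zclosure (sub_orbit V z)"
    using zirreducible_cover[OF Z(1) F(1), of "\<lambda>V. zclosure (sub_orbit V z)"]
      Z(2) orbit_closure_components[OF F(1,5,4) zX] zclosed_zclosure by blast
  have irrZ: "zirreducible (zclosure (sub_orbit V z))"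
    by (intro zirreducible_zclosure zirreducible_sub_orbit F zX V)
  have sub: "zclosure (sub_orbit V z) \<subseteq> zclosure (orb x)"
    using sub_orbit_subset[OF F(4)[OF V(1)]] orb_closure_stable[OF x z(1)]
    by (intro zclosure_minimal[OF _ zclosed_zclosure]) blast
  obtain V' where V': "V' \<in> F" "zclosure (sub_orbit V z) \<subseteq> zclosure (sub_orbit V' x)"
    using zirreducible_cover[OF irrZ F(1), of "\<lambda>V. zclosure (sub_orbit V x)"]
      sub orbit_closure_components[OF F(1,5,4) x] zclosed_zclosure by blast
  let ?W = "zclosure (sub_orbit V' x)"
  have "zclosure (sub_orbit V z) \<noteq> ?W"
  proof
    assume eq: "zclosure (sub_orbit V z) = ?W"
    note so = sub_orbit_poly[OF F(4)[OF V'(1)] x]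
    obtain s where s: "s \<in> polyfun" "\<exists>v\<in>V'. s (act_poly (pair_pt v x)) \<noteq> 0"
      "\<And>w. w \<in> ?W \<Longrightarrow> s w \<noteq> 0 \<Longrightarrow> w \<in> sub_orbit V' x"
      using image_contains_open[OF F(2,3)[OF V'(1)] polymap_act_right[of x]] unfolding so by metis
    then obtain w where "w \<in> sub_orbit V' x" "s w \<noteq> 0" unfolding so by blast
    moreover have "w \<in> zclosure (sub_orbit V z)"
      using eq zclosure_superset[of "sub_orbit V' x"] \<open>w \<in> sub_orbit V' x\<close> by blast
    \<comment> \<open>The orbit piece of \<open>z\<close> is dense in \<open>?W\<close>, so it meets
      the open set \<open>s \<noteq> 0\<close>, which lies in the orbit of \<open>x\<close>; a
      common point makes the orbits equal.\<close>
    ultimately obtain v where v: "v \<in> sub_orbit V z" "s v \<noteq> 0" using zclosureD[OF _ s(1)] by blast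
    have "v \<in> sub_orbit V' x" using s(3) v eq zclosure_superset by blast
    hence "v \<in> orb x" using sub_orbit_subset[OF F(4)[OF V'(1)]] by blast
    obtain h where h: "h \<in> carrier G" "v = act h z" using v(1) F(4)[OF V(1)] by (auto simp: sub_orbit_def)
    obtain g where g: "g \<in> carrier G" "v = act g x" using \<open>v \<in> orb x\<close> by (auto simp: orbit_def)
    have "orb z = orb x" using orb_act[OF h(1) zX] orb_act[OF g(1) x] h(2) g(2) by simp
    thus False using z(2) orb_self[OF zX] by blast
  qed
  hence "zclosure (sub_orbit V z) \<subset> ?W" using V'(2) by blast
  moreover have "zirreducible ?W" by (intro zirreducible_zclosure zirreducible_sub_orbit F x V')
  ultimately have "chain_in (Suc d) ?W"
    using chain_in_extend[OF chain_in_mono[OF Z(3) V(2)]] zclosed_zclosure by blast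
  thus ?thesis using chain_in_mono zclosure_mono[OF sub_orbit_subset[OF F(4)[OF V'(1)]]] by blast
qed

text \<open>Semicontinuity of the orbit dimension. A map \<open>y\<close> dominating on the orbit of
  \<open>q\<close> gives the map taking \<open>h\<close> and \<open>x\<close> to the pair of
  \<open>x\<close> and \<open>y\<close> at the translate of \<open>x\<close>, whose image is dense
  in the product of \<open>X\<close> with affine \<open>d\<close>-space by
  \<open>dominating_spreads\<close>. The image of one component contains a nonempty open set, so
  over generic \<open>x\<close> the values of \<open>y\<close> on the orbit of \<open>x\<close> are
  dense too.\<close>

lemma generic_orbit_chain:
  assumes q: "q \<in> X" and ch: "chain_in d (zclosure (orb q))"
  obtains u where "u \<in> polyfun" "\<exists>x\<in>X. u x \<noteq> 0"
    "\<And>x. x \<in> X \<Longrightarrow> u x \<noteq> 0 \<Longrightarrow> chain_in d (zclosure (orb x))"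
proof -
  obtain F where F: "finite F" "\<And>V. V \<in> F \<Longrightarrow> zclosed V" "\<And>V. V \<in> F \<Longrightarrow> zirreducible V"
    "\<And>V. V \<in> F \<Longrightarrow> V \<subseteq> carrier G" "\<Union>F = carrier G" using components by blast
  obtain y where y: "dominating y d (orb q)"
    using chain_in_imp_dominating[OF ch] dominating_zclosure_iff by blast
  have yp: "polymap y" "\<And>p. y p \<in> aspace d" "aspace d \<subseteq> zclosure (y ` orb q)"
    using y by (auto simp: dominating_def)
  define \<Phi> where "\<Phi> z = pair_pt (z \<circ> Inr) (y (act_poly z))" for z :: "'m + 'n \<Rightarrow> 'k"
  have \<Phi>: "polymap \<Phi>" unfolding \<Phi>_def
    by (intro polymap_pair polymap_snd polymap_comp[OF yp(1) polymap_act])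
  have irr: "zirreducible (prod_set X (aspace d :: (nat \<Rightarrow> 'k) set))"
    by (rule zirreducible_prod_set[OF irreducible zirreducible_aspace])
  have "prod_set X (aspace d) \<subseteq> zclosure (\<Phi> ` prod_set (carrier G) X)"
  proof
    fix w :: "'n + nat \<Rightarrow> 'k" assume "w \<in> prod_set X (aspace d)"
    then obtain x t where w: "w = pair_pt x t" "x \<in> X" "t \<in> aspace d" by (auto simp: prod_set_def)
    show "w \<in> zclosure (\<Phi> ` prod_set (carrier G) X)"
    proof (rule zclosureI, unfold w(1))
      fix P :: "('n + nat \<Rightarrow> 'k) \<Rightarrow> 'k"
      assume P: "P \<in> polyfun" "\<And>z. z \<in> \<Phi> ` prod_set (carrier G) X \<Longrightarrow> P z = 0"
      show "P (pair_pt x t) = 0"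
      proof (rule dominating_spreads[OF irreducible q, where H = "carrier G" and y = "\<lambda>x h. y (act_poly (pair_pt h x))"])
        show "polymap (\<lambda>x. y (act_poly (pair_pt h x)))" for h
          by (rule polymap_comp[OF yp(1) polymap_act_left])
        have "(\<lambda>h. y (act_poly (pair_pt h q))) ` carrier G = y ` orb q"
          unfolding orb_eq sub_orbit_poly[OF subset_refl q] by (simp add: image_image)
        thus "aspace d \<subseteq> zclosure ((\<lambda>h. y (act_poly (pair_pt h q))) ` carrier G)" using yp(3) by simp
        show "P (pair_pt x (y (act_poly (pair_pt h x)))) = 0" if "x \<in> X" "h \<in> carrier G" for x h
          using that by (intro P(2)) (auto simp: \<Phi>_def intro!: image_eqI[of _ _ "pair_pt h x"])
      qed (use P(1) yp(2) w in auto)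
    qed
  qed
  also have "\<dots> \<subseteq> (\<Union>V\<in>F. zclosure (\<Phi> ` prod_set V X))"
  proof (rule zclosure_minimal)
    have "\<Phi> ` prod_set V X \<subseteq> zclosure (\<Phi> ` prod_set V X)" for V by (rule zclosure_superset)
    thus "\<Phi> ` prod_set (carrier G) X \<subseteq> (\<Union>V\<in>F. zclosure (\<Phi> ` prod_set V X))"
      unfolding F(5)[symmetric] prod_set_eq by blast
    show "zclosed (\<Union>V\<in>F. zclosure (\<Phi> ` prod_set V X))" using F(1) by (intro zclosed_UN zclosed_zclosure)
  qed
  finally obtain V where V: "V \<in> F" "prod_set X (aspace d) \<subseteq> zclosure (\<Phi> ` prod_set V X)"
    using zirreducible_cover[OF irr F(1), of "\<lambda>V. zclosure (\<Phi> ` prod_set V X)"] zclosed_zclosure by blast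
  obtain s where s: "s \<in> polyfun" "\<exists>z\<in>prod_set V X. s (\<Phi> z) \<noteq> 0"
    "\<And>w. w \<in> zclosure (\<Phi> ` prod_set V X) \<Longrightarrow> s w \<noteq> 0 \<Longrightarrow> w \<in> \<Phi> ` prod_set V X"
    using image_contains_open[OF zclosed_prod_set[OF F(2)[OF V(1)] closed_X]
        zirreducible_prod_set[OF F(3)[OF V(1)] irreducible] \<Phi>] by metis
  obtain h0 x0 where hx: "h0 \<in> V" "x0 \<in> X" "s (\<Phi> (pair_pt h0 x0)) \<noteq> 0"
    using s(2) by (auto simp: prod_set_def)
  \<comment> \<open>The second component of a point at which \<open>s\<close> is nonzero; hence
    \<open>s (pair_pt x t0)\<close> is a nonzero function of \<open>x\<close> on
    \<open>X\<close>.\<close>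
  define t0 where "t0 = y (act_poly (pair_pt h0 x0))"
  have t0: "t0 \<in> aspace d" unfolding t0_def by (rule yp(2))
  show ?thesis
  proof (rule that[OF polyfun_pair_left[OF s(1), of t0]])
    show "\<exists>x\<in>X. s (pair_pt x t0) \<noteq> 0" using hx by (auto simp: \<Phi>_def t0_def)
    fix x assume x: "x \<in> X" "s (pair_pt x t0) \<noteq> 0"
    have "dominating y d (orb x)"
      unfolding dominating_def
    proof (intro conjI allI yp subsetI)
      fix t :: "nat \<Rightarrow> 'k" assume t: "t \<in> aspace d"
      show "t \<in> zclosure (y ` orb x)"
      proof (rule zclosureI)
        fix g :: "(nat \<Rightarrow> 'k) \<Rightarrow> 'k" assume g: "g \<in> polyfun" "\<And>q. q \<in> y ` orb x \<Longrightarrow> g q = 0"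
        \<comment> \<open>For this fixed \<open>x\<close> the set \<open>s \<noteq> 0\<close> is
          nonempty and open in affine space and consists of values of \<open>y\<close> on the orbit
          of \<open>x\<close>.\<close>
        have zero: "s (pair_pt x t) * g t = 0" if t: "t \<in> aspace d" for t
        proof (cases "s (pair_pt x t) = 0")
          case False
          have "pair_pt x t \<in> prod_set X (aspace d)" using t x(1) by simp
          hence "pair_pt x t \<in> \<Phi> ` prod_set V X" using V(2) s(3)[OF _ False] by blast
          then obtain h x' where h: "h \<in> V" "x' \<in> X" "pair_pt x t = \<Phi> (pair_pt h x')"
            by (auto simp: prod_set_def)
          have "x = x'" "t = y (act_poly (pair_pt h x'))"
            using arg_cong[OF h(3), of "\<lambda>z. z \<circ> Inl"] arg_cong[OF h(3), of "\<lambda>z. z \<circ> Inr"]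
            by (simp_all add: \<Phi>_def)
          hence "t \<in> y ` orb x" using F(4)[OF V(1)] h(1) act_poly x(1) by (auto simp: orbit_def)
          thus ?thesis using g(2) by simp
        qed simp
        show "g t = 0"
          by (rule zirreducibleD[OF zirreducible_aspace polyfun_pair_right[OF s(1)] g(1) zero t0 x(2) t])
      qed
    qed
    hence "dominating y d (zclosure (orb x))" using dominating_mono zclosure_superset by blast
    thus "chain_in d (zclosure (orb x))" by (rule dominating_imp_chain_in[OF zclosed_zclosure])
  qed
qed

section \<open>Observability implies condition (b)\<close>

lemma observable_imp_open:
  assumes obs: "observable G X act"
  shows "\<exists>U. zopen_in X U \<and> U \<noteq> {} \<and> U \<subseteq> Omega G X act"
proof -
  define D where "D = {n. \<exists>q\<in>X. chain_in n (zclosure (orb q))}"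
  have "D \<subseteq> {..card (UNIV :: 'n set)}" unfolding D_def using chain_in_le_card by auto
  hence finD: "finite D" using finite_subset by blast
  have ne: "orb p \<noteq> {}" if "p \<in> X" for p using orb_self[OF that] by blast
  obtain p0 where "p0 \<in> X" using zirreducible_nonempty[OF irreducible] by blast
  hence "0 \<in> D" unfolding D_def using zdim_ge_iff[OF ne, of p0 0] by (auto simp: zero_enat_def[symmetric])
  define d where "d = Max D"
  have "d \<in> D" unfolding d_def using Max_in[OF finD] \<open>0 \<in> D\<close> by blast
  then obtain q0 where "q0 \<in> X" "chain_in d (zclosure (orb q0))" unfolding D_def by blast
  then obtain u where u: "u \<in> polyfun" "\<exists>x\<in>X. u x \<noteq> 0"
    "\<And>x. x \<in> X \<Longrightarrow> u x \<noteq> 0 \<Longrightarrow> chain_in d (zclosure (orb x))"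
    using generic_orbit_chain by blast
  have max: "n \<le> d" if "q \<in> X" "chain_in n (zclosure (orb q))" for n q
    unfolding d_def using that finD by (intro Max_ge) (auto simp: D_def)
  \<comment> \<open>The intersection of all translates of \<open>u = 0\<close> in \<open>X\<close>,
    that is, the points whose whole orbit lies there: closed, and the largest stable subset of this
    zero set.\<close>
  define Y where "Y = X \<inter> {x. \<forall>f\<in>(\<lambda>h x. u (act_poly (pair_pt h x))) ` carrier G. f x = 0}"
  have Y: "x \<in> Y \<longleftrightarrow> x \<in> X \<and> (\<forall>h\<in>carrier G. u (act h x) = 0)" for x
    unfolding Y_def using act_poly by auto
  have "zclosed Y" unfolding Y_def
    using polyfun_translate[OF u(1)] by (intro zclosed_Int closed_X zclosed_zeros) auto
  moreover have "Y \<subset> X" using u(2) Y act_one one_G by (metis psubsetI subsetI)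
  moreover have "act h y \<in> Y" if "h \<in> carrier G" "y \<in> Y" for h y
    using that act_closed act_mult mult_G unfolding Y by metis
  ultimately obtain f where f: "invariant f" "\<exists>x\<in>X. f x \<noteq> 0" "\<And>y. y \<in> Y \<Longrightarrow> f y = 0"
    using observable_invariant[OF obs] by blast
  have fp: "f \<in> polyfun" using f(1) by (simp add: invariant_def)
  have big: "chain_in d (zclosure (orb x))" if x: "x \<in> X" "f x \<noteq> 0" for x
  proof -
    obtain h where h: "h \<in> carrier G" "u (act h x) \<noteq> 0" using f(3) x Y by blast
    show ?thesis using u(3)[OF act_closed[OF h(1) x(1)] h(2)] orb_act[OF h(1) x(1)] by simp
  qed
  define U where "U = {x \<in> X. f x \<noteq> 0}"
  have "zopen_in X U"
  proof -
    have "X - U = X \<inter> {x. f x = 0}" unfolding U_def by blast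
    thus ?thesis unfolding zopen_in_def zclosed_in_def using zclosed_zero[OF fp] U_def by blast
  qed
  moreover have "U \<noteq> {}" using f(2) by (auto simp: U_def)
  moreover have "x \<in> Omega G X act" if "x \<in> U" for x
  proof -
    have x: "x \<in> X" "f x \<noteq> 0" using that by (auto simp: U_def)
    have "zclosure (orb x) \<subseteq> orb x"
    proof (rule subsetI, rule ccontr)
      fix z assume z: "z \<in> zclosure (orb x)" "z \<notin> orb x"
      have zX: "z \<in> X" using z orb_closure_subset[OF x(1)] by blast
      have "f z - f x = 0"
        by (rule zclosureD[OF z(1) polyfun_diff[OF fp pf_const]])
          (use f(1) x(1) in \<open>auto simp: invariant_def orbit_def\<close>)
      hence "chain_in d (zclosure (orb z))" using big[OF zX] x(2) by simp
      from max[OF x(1) boundary_orbit[OF x(1) z this]] show False by simp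
    qed
    hence "zclosed (orb x)" using zclosed_zclosure zclosure_superset by (metis subset_antisym)
    hence "zclosed_in X (orb x)" using zclosed_in_iff[OF closed_X] orb_subset[OF x(1)] by blast
    moreover have "zdim (orb q) \<le> zdim (orb x)" if q: "q \<in> X" for q
    proof -
      have "zdim (orb q) \<le> enat d"
      proof (rule ccontr)
        assume "\<not> zdim (orb q) \<le> enat d"
        hence "enat (Suc d) \<le> zdim (orb q)" by (simp add: Suc_ile_eq not_le)
        hence "chain_in (Suc d) (zclosure (orb q))" using zdim_ge_iff[OF ne[OF q]] by blast
        from max[OF q this] show False by simp
      qed
      also have "enat d \<le> zdim (orb x)" using zdim_ge_iff[OF ne[OF x(1)]] big[OF x] by blast
      finally show ?thesis .
    qed
    ultimately show ?thesis unfolding Omega_def using x(1) by blast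
  qed
  ultimately show ?thesis by blast
qed

section \<open>Invariants from a relation\<close>

text \<open>Artin's argument: a shortest relation has coefficients with invariant ratios.\<close>

lemma invariant_from_relation:
  assumes quot: "quotients_of_invariants G X act"
    and "finite S" "\<And>i. i \<in> S \<Longrightarrow> c i \<in> polyfun" "\<And>i. i \<in> S \<Longrightarrow> v i \<in> polyfun"
    "c0 \<in> polyfun" "\<exists>x\<in>X. c0 x \<noteq> 0"
    "\<And>x h. x \<in> X \<Longrightarrow> h \<in> carrier G \<Longrightarrow> (\<Sum>i\<in>S. c i x * v i (act h x)) = c0 x"
  shows "\<exists>p q. invariant q \<and> (\<exists>x\<in>X. q x \<noteq> 0) \<and> (\<exists>T\<subseteq>S. \<forall>x\<in>X. (\<Sum>i\<in>T. p i x * v i x) = q x)"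
  using assms(2-)
proof (induction "card S" arbitrary: S c c0 rule: less_induct)
  case less
  note fin = less.prems(1) and c = less.prems(2) and v = less.prems(3) and c0 = less.prems(4,5)
    and rel = less.prems(6)
  show ?case
  \<comment> \<open>The condition says that the ratio of each coefficient to \<open>c0\<close> is an
    invariant rational function. If it fails, a shorter relation is constructed.\<close>
  proof (cases "\<forall>i\<in>S. \<forall>g\<in>carrier G. \<forall>x\<in>X. c i (act g x) * c0 x = c0 (act g x) * c i x")
    case True
    have "\<forall>i\<in>S. \<exists>z. invariant (fst z) \<and> invariant (snd z) \<and> (\<exists>x\<in>X. snd z x \<noteq> 0) \<and>
      (\<forall>x\<in>X. fst z x * c0 x = c i x * snd z x)"
    proof
      fix i assume i: "i \<in> S"
      have "inv_rational G X act (c i, c0)"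
        unfolding inv_rational_def rat_rep_def rat_eq_def regular_fun_def fun_act_def
        using True i c[OF i] c0 inv_G by (auto simp: mult.commute)
      then obtain f g where fg: "inv_regular G X act f" "inv_regular G X act g" "\<exists>x\<in>X. g x \<noteq> 0"
          "rat_eq X (f, g) (c i, c0)"
        using quot unfolding quotients_of_invariants_def by blast
      obtain p where p: "invariant p" "\<And>x. x \<in> X \<Longrightarrow> p x = f x" using inv_regular_imp_invariant[OF fg(1)] by blast
      obtain q where q: "invariant q" "\<And>x. x \<in> X \<Longrightarrow> q x = g x" using inv_regular_imp_invariant[OF fg(2)] by blast
      show "\<exists>z. invariant (fst z) \<and> invariant (snd z) \<and> (\<exists>x\<in>X. snd z x \<noteq> 0) \<and>
          (\<forall>x\<in>X. fst z x * c0 x = c i x * snd z x)"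
        using p q fg(3,4) by (intro exI[of _ "(p, q)"]) (auto simp: rat_eq_def)
    qed
    from bchoice[OF this] obtain z where z: "\<forall>i\<in>S. invariant (fst (z i)) \<and> invariant (snd (z i)) \<and>
      (\<exists>x\<in>X. snd (z i) x \<noteq> 0) \<and> (\<forall>x\<in>X. fst (z i) x * c0 x = c i x * snd (z i) x)" by blast
    define p q where "p i = fst (z i)" and "q i = snd (z i)" for i
    have pq: "\<And>i. i \<in> S \<Longrightarrow> invariant (p i)" "\<And>i. i \<in> S \<Longrightarrow> invariant (q i)"
      "\<And>i. i \<in> S \<Longrightarrow> \<exists>x\<in>X. q i x \<noteq> 0" "\<And>i x. i \<in> S \<Longrightarrow> x \<in> X \<Longrightarrow> p i x * c0 x = c i x * q i x"
      using z by (simp_all add: p_def q_def)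
    have pqp: "\<And>i. i \<in> S \<Longrightarrow> p i \<in> polyfun" "\<And>i. i \<in> S \<Longrightarrow> q i \<in> polyfun"
      using pq(1,2) by (auto simp: invariant_def)
    \<comment> \<open>The product of the denominators is an invariant common denominator, and
      \<open>p'\<close> are the numerators over it.\<close>
    define Q where "Q x = (\<Prod>j\<in>S. q j x)" for x
    define p' where "p' i x = p i x * (\<Prod>j\<in>S - {i}. q j x)" for i x
    have "invariant Q" unfolding Q_def using pq(2) by (rule invariant_prod)
    moreover have "\<exists>x\<in>X. Q x \<noteq> 0" unfolding Q_def by (rule nonzero_prod[OF fin pqp(2) pq(3)])
    moreover have "(\<Sum>i\<in>S. p' i x * v i x) = Q x" if x: "x \<in> X" for x
    proof (rule cancel[OF c0(1) _ _ c0(2) _ x])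
      show "(\<lambda>x. \<Sum>i\<in>S. p' i x * v i x) \<in> polyfun" unfolding p'_def
        using pqp v by (intro polyfun_sum pf_mult polyfun_prod) auto
      show "Q \<in> polyfun" using \<open>invariant Q\<close> by (simp add: invariant_def)
      fix x assume x: "x \<in> X"
      have "c0 x * (\<Sum>i\<in>S. p' i x * v i x) = (\<Sum>i\<in>S. (c i x * v i x) * Q x)"
        unfolding sum_distrib_left
      proof (rule sum.cong[OF refl])
        fix i assume i: "i \<in> S"
        have "Q x = q i x * (\<Prod>j\<in>S - {i}. q j x)" unfolding Q_def by (rule prod.remove[OF fin i])
        thus "c0 x * (p' i x * v i x) = (c i x * v i x) * Q x"
          using pq(4)[OF i x] by (simp add: p'_def) algebra
      qed
      also have "\<dots> = (\<Sum>i\<in>S. c i x * v i x) * Q x" by (simp add: sum_distrib_right)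
      \<comment> \<open>The relation at the identity of the group, where everything becomes a
        function of \<open>x\<close> alone.\<close>
      also have "(\<Sum>i\<in>S. c i x * v i x) = c0 x" using rel[OF x one_G] act_one[OF x] by simp
      finally show "c0 x * (\<Sum>i\<in>S. p' i x * v i x) = c0 x * Q x" .
    qed
    ultimately show ?thesis by (intro exI[of _ p'] exI[of _ Q]) auto
  next
    case False
    then obtain i g x1 where i: "i \<in> S" and g: "g \<in> carrier G" and x1: "x1 \<in> X"
        "c i (act g x1) * c0 x1 \<noteq> c0 (act g x1) * c i x1" by blast
    let ?t = "\<lambda>u x. u (act_poly (pair_pt g x))"
    \<comment> \<open>The relation and its translate by \<open>g\<close>, cross-multiplied by their
      right hand sides and subtracted: this leaves right hand side 0, with a nonzero
      \<open>i\<close>-th coefficient by the choice of \<open>i\<close> and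
      \<open>g\<close>.\<close>
    define e where "e j x = ?t c0 x * c j x - c0 x * ?t (c j) x" for j x
    have ep: "e j \<in> polyfun" if "j \<in> S" for j
      unfolding e_def using c[OF that] c0(1) by (intro polyfun_diff pf_mult polyfun_translate)
    have e0: "\<exists>x\<in>X. e i x \<noteq> 0" using x1 by (intro bexI[of _ x1]) (auto simp: e_def act_poly[OF g] mult.commute)
    have e_rel: "(\<Sum>j\<in>S. e j x * v j (act h x)) = 0" if x: "x \<in> X" and h: "h \<in> carrier G" for x h
    proof -
      \<comment> \<open>Replacing \<open>x\<close> by its translate under \<open>g\<close> and
        multiplying \<open>h\<close> by the inverse of \<open>g\<close> leaves the argument of the
        \<open>v j\<close> unchanged.\<close>
      have hg: "h \<otimes>\<^bsub>G\<^esub> inv\<^bsub>G\<^esub> g \<in> carrier G" using mult_G[OF h inv_G[OF g]] .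
      have "act (h \<otimes>\<^bsub>G\<^esub> inv\<^bsub>G\<^esub> g) (act g x) = act h x"
        using act_mult[OF h inv_G[OF g] act_closed[OF g x]] act_inv[OF g x] by simp
      hence r: "(\<Sum>j\<in>S. ?t (c j) x * v j (act h x)) = ?t c0 x"
        using rel[OF act_closed[OF g x] hg] by (simp add: act_poly[OF g x])
      have "(\<Sum>j\<in>S. e j x * v j (act h x)) =
          ?t c0 x * (\<Sum>j\<in>S. c j x * v j (act h x)) - c0 x * (\<Sum>j\<in>S. ?t (c j) x * v j (act h x))"
        by (simp add: e_def sum_distrib_left left_diff_distrib sum_subtractf mult.assoc)
      thus ?thesis using rel[OF x h] r by (simp add: mult.commute)
    qed
    have "\<exists>p q. invariant q \<and> (\<exists>x\<in>X. q x \<noteq> 0) \<and> (\<exists>T\<subseteq>S - {i}. \<forall>x\<in>X. (\<Sum>i\<in>T. p i x * v i x) = q x)"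
    proof (rule less.hyps)
      show "card (S - {i}) < card S" by (rule card_Diff1_less[OF fin i])
      show "finite (S - {i})" using fin by simp
      show "(\<lambda>x. e i x * c j x - c i x * e j x) \<in> polyfun" if "j \<in> S - {i}" for j
        using that i c ep by (intro polyfun_diff pf_mult) auto
      show "v j \<in> polyfun" if "j \<in> S - {i}" for j using that v by blast
      show "(\<lambda>x. e i x * c0 x) \<in> polyfun" by (intro pf_mult ep[OF i] c0)
      show "\<exists>x\<in>X. e i x * c0 x \<noteq> 0" by (intro nonzero_mult ep[OF i] c0 e0)
      fix x h assume x: "x \<in> X" and h: "h \<in> carrier G"
      \<comment> \<open>Index \<open>i\<close> is eliminated between the two relations. The right
        hand side \<open>e i x * c0 x\<close> is nonzero as a function on \<open>X\<close> because
        \<open>X\<close> is irreducible.\<close>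
      let ?f = "\<lambda>j. (e i x * c j x - c i x * e j x) * v j (act h x)"
      have "(\<Sum>j\<in>S - {i}. ?f j) = (\<Sum>j\<in>S. ?f j)"
        using sum.remove[OF fin i, of ?f] by (simp add: mult.commute)
      also have "\<dots> = e i x * (\<Sum>j\<in>S. c j x * v j (act h x)) - c i x * (\<Sum>j\<in>S. e j x * v j (act h x))"
        by (simp add: sum_distrib_left left_diff_distrib sum_subtractf mult.assoc)
      finally show "(\<Sum>j\<in>S - {i}. ?f j) = e i x * c0 x" by (simp add: rel[OF x h] e_rel[OF x h])
    qed
    thus ?thesis by (meson Diff_subset subset_trans)
  qed
qed

section \<open>Conditions (a) and (b) imply observability\<close>

lemma open_imp_observable:
  assumes quot: "quotients_of_invariants G X act"
    and U: "zopen_in X U" "U \<noteq> {}" "U \<subseteq> Omega G X act"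
  shows "observable G X act"
  unfolding observable_def
proof (intro allI impI)
  fix Y assume "zclosed_in X Y \<and> H_stable G act Y \<and> Y \<subset> X"
  hence Y: "zclosed Y" "Y \<subset> X" "\<And>h y. h \<in> carrier G \<Longrightarrow> y \<in> Y \<Longrightarrow> act h y \<in> Y"
    using zclosed_in_iff[OF closed_X] by (auto simp: H_stable_def)
  obtain w where w: "w \<in> polyfun" "\<And>y. y \<in> Y \<Longrightarrow> w y = 0" "\<exists>x\<in>X. w x \<noteq> 0"
    using zclosed_separate[OF Y(1)] Y(2) by (metis psubsetE subsetI)
  have "zclosed (X - U)" using U(1) zclosed_in_iff[OF closed_X] by (simp add: zopen_in_def)
  moreover obtain x2 where x2: "x2 \<in> U" "x2 \<in> X" using U(1,2) by (auto simp: zopen_in_def)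
  ultimately obtain u0 where u0: "u0 \<in> polyfun" "\<And>x. x \<in> X - U \<Longrightarrow> u0 x = 0" "u0 x2 \<noteq> 0"
    using zclosed_separate[of "X - U" x2] by blast
  obtain F where F: "finite F" "\<And>V. V \<in> F \<Longrightarrow> zclosed V" "\<And>V. V \<in> F \<Longrightarrow> zirreducible V"
    "\<And>V. V \<in> F \<Longrightarrow> V \<subseteq> carrier G" "\<Union>F = carrier G" using components by blast
  define \<Phi> where "\<Phi> z = pair_pt (z \<circ> Inr) (act_poly z)" for z :: "'m + 'n \<Rightarrow> 'k"
  have \<Phi>: "polymap \<Phi>" unfolding \<Phi>_def by (intro polymap_pair polymap_snd polymap_act)
  define \<Gamma> where "\<Gamma> V = \<Phi> ` prod_set V X" for V
  have \<Gamma>: "pair_pt x y \<in> \<Gamma> V \<longleftrightarrow> x \<in> X \<and> y \<in> sub_orbit V x" if V: "V \<in> F" for V x y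
  proof -
    have eq: "pair_pt x y = \<Phi> (pair_pt h x') \<longleftrightarrow> x = x' \<and> y = act_poly (pair_pt h x')" for h x'
      unfolding \<Phi>_def by (metis pair_pt_simps(3,4))
    have "pair_pt x y \<in> \<Gamma> V \<longleftrightarrow> (\<exists>h\<in>V. \<exists>x'\<in>X. pair_pt x y = \<Phi> (pair_pt h x'))"
      unfolding \<Gamma>_def prod_set_def by blast
    also have "\<dots> \<longleftrightarrow> x \<in> X \<and> (\<exists>h\<in>V. y = act_poly (pair_pt h x))" unfolding eq by blast
    also have "\<dots> \<longleftrightarrow> x \<in> X \<and> y \<in> sub_orbit V x" using sub_orbit_poly[OF F(4)[OF V]] by blast
    finally show ?thesis .
  qed
  have "\<forall>V\<in>F. \<exists>f. f \<in> polyfun \<and> (\<exists>x\<in>X. f x \<noteq> 0) \<and>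
      (\<forall>x y. x \<in> X \<longrightarrow> f x \<noteq> 0 \<longrightarrow> pair_pt x y \<in> zclosure (\<Gamma> V) \<longrightarrow> y \<in> zclosure (orb x))"
  proof
    fix V assume V: "V \<in> F"
    note cl = zclosed_prod_set[OF F(2)[OF V] closed_X] zirreducible_prod_set[OF F(3)[OF V] irreducible]
    obtain s where s: "s \<in> polyfun" "\<exists>z\<in>prod_set V X. s (\<Phi> z) \<noteq> 0"
      "\<And>z. z \<in> zclosure (\<Gamma> V) \<Longrightarrow> s z \<noteq> 0 \<Longrightarrow> z \<in> \<Gamma> V"
      using image_contains_open[OF cl \<Phi>] unfolding \<Gamma>_def by metis
    have s2: "\<exists>z\<in>\<Gamma> V. s z \<noteq> 0" using s(2) by (auto simp: \<Gamma>_def)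
    have irr: "zirreducible (\<Gamma> V)" unfolding \<Gamma>_def by (rule zirreducible_image[OF cl(2) \<Phi>])
    have "z \<circ> Inl \<in> X" if "z \<in> \<Gamma> V" for z
      using that by (auto simp: \<Gamma>_def \<Phi>_def prod_set_def)
    from generic_fibre_closure[OF irreducible irr this s(1) s2 s(3)]
    obtain f where f: "f \<in> polyfun" "\<exists>x\<in>X. f x \<noteq> 0"
      "\<And>x y. x \<in> X \<Longrightarrow> f x \<noteq> 0 \<Longrightarrow> pair_pt x y \<in> zclosure (\<Gamma> V) \<Longrightarrow> y \<in> zclosure {y. pair_pt x y \<in> \<Gamma> V}"
      by blast
    have "{y. pair_pt x y \<in> \<Gamma> V} \<subseteq> orb x" for x
      using \<Gamma>[OF V] sub_orbit_subset[OF F(4)[OF V]] by blast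
    hence "zclosure {y. pair_pt x y \<in> \<Gamma> V} \<subseteq> zclosure (orb x)" for x by (rule zclosure_mono)
    thus "\<exists>f. f \<in> polyfun \<and> (\<exists>x\<in>X. f x \<noteq> 0) \<and>
      (\<forall>x y. x \<in> X \<longrightarrow> f x \<noteq> 0 \<longrightarrow> pair_pt x y \<in> zclosure (\<Gamma> V) \<longrightarrow> y \<in> zclosure (orb x))"
      using f by blast
  qed
  from bchoice[OF this] obtain f where f: "\<And>V. V \<in> F \<Longrightarrow> f V \<in> polyfun" "\<And>V. V \<in> F \<Longrightarrow> \<exists>x\<in>X. f V x \<noteq> 0"
    "\<And>V x y. V \<in> F \<Longrightarrow> x \<in> X \<Longrightarrow> f V x \<noteq> 0 \<Longrightarrow> pair_pt x y \<in> zclosure (\<Gamma> V) \<Longrightarrow> y \<in> zclosure (orb x)"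
    by blast
  \<comment> \<open>The factors exclude the points over which the closure of some
    \<open>\<Gamma> V\<close> may leave the orbit closure, the points of \<open>X\<close> outside
    \<open>U\<close>, and the points of \<open>Y\<close>.\<close>
  define a where "a x = (\<Prod>V\<in>F. f V x) * (u0 x * w x)" for x
  have prodf: "(\<lambda>x. \<Prod>V\<in>F. f V x) \<in> polyfun" by (intro polyfun_prod f)
  have a: "a \<in> polyfun" unfolding a_def by (intro pf_mult prodf u0 w)
  have a0: "\<exists>x\<in>X. a x \<noteq> 0"
    unfolding a_def using u0(3) x2(2)
    by (intro nonzero_mult prodf pf_mult u0(1) w(1,3) nonzero_prod F(1) f(1,2)) auto
  \<comment> \<open>The common zeros of \<open>J\<close> are the points of the closure of the graph
    whose second component lies in \<open>Y\<close>. A power of \<open>a\<close> in \<open>J\<close>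
    is exactly the relation that is sought.\<close>
  define J where "J = {E \<in> polyfun. \<exists>l. set l \<subseteq> polyfun \<times> vanish Y \<and>
     (\<forall>x\<in>X. \<forall>h\<in>carrier G. E (pair_pt x (act h x)) = tensor_sum l x (act h x))}"
  have J: "ideal_of polyfun J"
    unfolding ideal_of_def
  proof (intro conjI ballI)
    show "J \<subseteq> polyfun" unfolding J_def by blast
    show "0 \<in> J" unfolding J_def
      using subring_0[OF subring_polyfun] by (auto simp: tensor_sum_def intro!: exI[of _ "[]"])
    fix E E' assume "E \<in> J" "E' \<in> J"
    then obtain l l' where l: "E \<in> polyfun" "E' \<in> polyfun" "set l \<subseteq> polyfun \<times> vanish Y" "set l' \<subseteq> polyfun \<times> vanish Y"
      "\<forall>x\<in>X. \<forall>h\<in>carrier G. E (pair_pt x (act h x)) = tensor_sum l x (act h x)"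
      "\<forall>x\<in>X. \<forall>h\<in>carrier G. E' (pair_pt x (act h x)) = tensor_sum l' x (act h x)"
      unfolding J_def by blast
    thus "E + E' \<in> J" unfolding J_def
      using subring_add[OF subring_polyfun l(1,2)]
      by (auto simp: tensor_sum_append intro!: exI[of _ "l @ l'"])
  next
    fix R E :: "('n + 'n \<Rightarrow> 'k) \<Rightarrow> 'k" assume R: "R \<in> polyfun" and "E \<in> J"
    then obtain l where l: "E \<in> polyfun" "set l \<subseteq> polyfun \<times> vanish Y"
      "\<forall>x\<in>X. \<forall>h\<in>carrier G. E (pair_pt x (act h x)) = tensor_sum l x (act h x)" unfolding J_def by blast
    obtain m where m: "set m \<subseteq> polyfun \<times> polyfun" "\<forall>x y. R (pair_pt x y) = tensor_sum m x y"
      using polyfun_tensor[OF R] by blast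
    have "set (tensor_mult m l) \<subseteq> polyfun \<times> vanish Y"
      by (auto simp: set_tensor_mult dest!: subsetD[OF m(1)] subsetD[OF l(2)]
          intro!: subring_mult[OF subring_polyfun] ideal_mult[OF ideal_vanish])
    thus "R * E \<in> J" unfolding J_def using subring_mult[OF subring_polyfun R l(1)] l(3) m(2)
      by (auto simp: tensor_sum_mult intro!: exI[of _ "tensor_mult m l"])
  qed
  have "a (z \<circ> Inl) = 0" if z: "\<And>E. E \<in> J \<Longrightarrow> E z = 0" for z
  proof (rule ccontr)
    assume az: "a (z \<circ> Inl) \<noteq> 0"
    define x y where "x = z \<circ> Inl" and "y = z \<circ> Inr"
    have zxy: "z = pair_pt x y" unfolding x_def y_def by simp
    have "z \<in> zclosure (\<Union>V\<in>F. \<Gamma> V)"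
    proof (rule zclosureI)
      fix E :: "('n + 'n \<Rightarrow> 'k) \<Rightarrow> 'k" assume E: "E \<in> polyfun" "\<And>q. q \<in> (\<Union>V\<in>F. \<Gamma> V) \<Longrightarrow> E q = 0"
      have "E (pair_pt x (act h x)) = 0" if x: "x \<in> X" and h: "h \<in> carrier G" for x h
      proof -
        obtain V where V: "V \<in> F" "h \<in> V" using h F(5) by blast
        have "pair_pt x (act h x) \<in> \<Gamma> V" using \<Gamma>[OF V(1)] V(2) x by (auto simp: sub_orbit_def)
        thus ?thesis using E(2) V(1) by blast
      qed
      hence "E \<in> J" unfolding J_def using E(1) by (auto simp: tensor_sum_def intro!: exI[of _ "[]"])
      thus "E z = 0" by (rule z)
    qed
    also have "zclosure (\<Union>V\<in>F. \<Gamma> V) \<subseteq> (\<Union>V\<in>F. zclosure (\<Gamma> V))"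
    proof (rule zclosure_minimal)
      have "\<Gamma> V \<subseteq> zclosure (\<Gamma> V)" for V by (rule zclosure_superset)
      thus "(\<Union>V\<in>F. \<Gamma> V) \<subseteq> (\<Union>V\<in>F. zclosure (\<Gamma> V))" by blast
      show "zclosed (\<Union>V\<in>F. zclosure (\<Gamma> V))" using F(1) by (intro zclosed_UN zclosed_zclosure)
    qed
    finally obtain V where V: "V \<in> F" "z \<in> zclosure (\<Gamma> V)" by blast
    have "\<Gamma> V \<subseteq> {z. z \<circ> Inl \<in> X}" by (auto simp: \<Gamma>_def \<Phi>_def prod_set_def)
    from zclosure_minimal[OF this zclosed_preimage[OF polymap_fst closed_X]]
    have xX: "x \<in> X" using V(2) unfolding x_def by blast
    have "d y = 0" if d: "d \<in> vanish Y" for d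
    proof -
      have "(\<lambda>z. d (z \<circ> Inr)) \<in> J" unfolding J_def
        using d polyfun_snd[of d] pf_const[of 1]
        by (auto simp: vanish_def tensor_sum_def intro!: exI[of _ "[(\<lambda>_. 1, d)]"])
      from z[OF this] show ?thesis by (simp add: y_def)
    qed
    hence yY: "y \<in> Y" using zclosed_eq_zeros[OF Y(1)] by blast
    have nz: "f V x \<noteq> 0" "u0 x \<noteq> 0" "w x \<noteq> 0"
      using az F(1) V(1) unfolding a_def x_def[symmetric] by auto
    have "y \<in> zclosure (orb x)" using f(3)[OF V(1) xX nz(1)] V(2) zxy by simp
    moreover have "x \<in> Omega G X act" using u0(2)[of x] nz(2) xX U(3) by blast
    hence "zclosed (orb x)" unfolding Omega_def using zclosed_in_iff[OF closed_X] by blast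
    ultimately have "y \<in> orb x" using zclosure_closed by blast
    then obtain h where h: "h \<in> carrier G" "y = act h x" by (auto simp: orbit_def)
    \<comment> \<open>Stability of \<open>Y\<close> moves \<open>x\<close> itself into
      \<open>Y\<close>, where \<open>w\<close> vanishes.\<close>
    have "x = act (inv\<^bsub>G\<^esub> h) y" using act_inv[OF h(1) xX] h(2) by simp
    hence "x \<in> Y" using Y(3)[OF inv_G[OF h(1)] yY] by simp
    thus False using w(2) nz(3) by blast
  qed
  then obtain N where "(\<lambda>z. a (z \<circ> Inl)) ^ N \<in> J"
    using nullstellensatz[OF J polyfun_fst[OF a]] by blast
  then obtain l where l: "set l \<subseteq> polyfun \<times> vanish Y"
    "\<forall>x\<in>X. \<forall>h\<in>carrier G. ((\<lambda>z. a (z \<circ> Inl)) ^ N) (pair_pt x (act h x)) = tensor_sum l x (act h x)"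
    unfolding J_def by blast
  have mem: "fst (l ! i) \<in> polyfun" "snd (l ! i) \<in> vanish Y" if "i \<in> {..<length l}" for i
  proof -
    have "l ! i \<in> polyfun \<times> vanish Y" using l(1) nth_mem that by blast
    thus "fst (l ! i) \<in> polyfun" "snd (l ! i) \<in> vanish Y" by auto
  qed
  have "\<exists>p q. invariant q \<and> (\<exists>x\<in>X. q x \<noteq> 0) \<and>
      (\<exists>T\<subseteq>{..<length l}. \<forall>x\<in>X. (\<Sum>i\<in>T. p i x * snd (l ! i) x) = q x)"
  proof (rule invariant_from_relation[OF quot, where c = "\<lambda>i. fst (l ! i)" and ?c0.0 = "\<lambda>x. a x ^ N"])
    show "(\<lambda>x. a x ^ N) \<in> polyfun" by (rule polyfun_power[OF a])
    show "\<exists>x\<in>X. a x ^ N \<noteq> 0" by (rule nonzero_power[OF a0])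
    show "(\<Sum>i\<in>{..<length l}. fst (l ! i) x * snd (l ! i) (act h x)) = a x ^ N"
      if "x \<in> X" "h \<in> carrier G" for x h
      using l(2) that by (simp add: tensor_sum_def sum_list_sum_nth case_prod_beta atLeast0LessThan)
  qed (use mem in \<open>auto simp: vanish_def\<close>)
  then obtain p q T where q: "invariant q" "\<exists>x\<in>X. q x \<noteq> 0" "T \<subseteq> {..<length l}"
    "\<And>x. x \<in> X \<Longrightarrow> (\<Sum>i\<in>T. p i x * snd (l ! i) x) = q x" by blast
  have "q y = 0" if y: "y \<in> Y" for y
  proof -
    have "(\<Sum>i\<in>T. p i y * snd (l ! i) y) = 0"
      using mem(2) q(3) y by (intro sum.neutral) (auto simp: vanish_def)
    thus ?thesis using q(4)[of y] y Y(2) by auto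
  qed
  thus "\<exists>f. inv_regular G X act f \<and> (\<exists>x\<in>X. f x \<noteq> 0) \<and> (\<forall>y\<in>Y. f y = 0)"
    using invariant_imp_inv_regular[OF q(1)] q(2) by blast
qed

end

theorem theorem6p5:
  fixes G :: "('m::finite \<Rightarrow> 'k::alg_closed_field) monoid"
    and X :: "('n::finite \<Rightarrow> 'k) set"
    and act :: "('m \<Rightarrow> 'k) \<Rightarrow> ('n \<Rightarrow> 'k) \<Rightarrow> ('n \<Rightarrow> 'k)"
  assumes "affine_algebraic_group G"
    and "affine_variety X" and "zirreducible X"
    and "regular_action G X act"
  shows "observable G X act \<longleftrightarrow>
           (quotients_of_invariants G X act \<and>
            (\<exists>U. zopen_in X U \<and> U \<noteq> {} \<and> U \<subseteq> Omega G X act))"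
proof -
  interpret algebraic_action G X act
    using assms by unfold_locales
  show ?thesis
    using observable_imp_quotients observable_imp_open open_imp_observable by blast
qed

end
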